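(* Let $p$ be a prime and let $R$ be a totally ramified extension of $\mathbb{Z}_p$ of degree $n$. Then $$\zeta_{H(R)}^{\triangleleft}(s) = \zeta_{\mathbb{Z}_p^{2n}}(s)\; \frac{\sum_{w \in S_{n-1}} p^{- \mathrm{len}(w) + 2\, \mathrm{len}^{[n-3]}(w)\, s} \prod_{j \in \mathrm{Des}(w)} x_{j+1}}{(1 - p^{2n - 3s}) \prod_{i = 1}^{n-1} (1 - x_i)},$$ where $x_i = p^{(2n+i)(n-i) - (3n-i)s}$ for $i\in\{1,\dots,n-1\}$.
   Context: A finite extension $R$ of $\mathbb{Z}_p$ means a compact discrete valuation ring of characteristic zero with residue characteristic $p$ (equivalently, the ring of integers of a finite extension of $\mathbb{Q}_p$). It is totally ramified if its residue field is $\mathbb{F}_p$ (inertia degree $f=1$); its degree $n$ is its rank as a $\mathbb{Z}_p$-module. For a ring $\mathcal{R}$, the Heisenberg group $H(\mathcal{R})$ is the group of upper unitriangular $3\times 3$ matrices over $\mathcal{R}$. For a finitely generated profinite group $G$, the normal zeta function is $\zeta^{\triangleleft}_G(s)=\sum_{m=1}^\infty a^{\triangleleft}_m(G)m^{-s}$, where $a^{\triangleleft}_m(G)$ is the number of open normal subgroups of $G$ of index $m$ and $s$ is a complex variable (with sufficiently large real part). Also, $\zeta_{\mathbb{Z}_p^{2n}}(s)=\prod_{i=0}^{2n-1}(1-p^{i-s})^{-1}$, which is the (normal) zeta function of the group $\mathbb{Z}_p^{2n}$. Statistics on the symmetric group $S_{n-1}$ (permutations of $\{1,\dots,n-1\}$,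 with Coxeter generators the adjacent transpositions $s_i=(i\ \,i+1)$): $\mathrm{len}$ is the Coxeter length (number of inversions); $\mathrm{Des}(w)=\{i\in\{1,\dots,n-2\} : w(i+1)<w(i)\}$ is the right descent set; and $\mathrm{len}^{[n-3]}(w)$ is the length of the unique shortest element of the coset $wW$, where $W=\langle s_1,\dots,s_{n-3}\rangle$; explicitly $\mathrm{len}^{[n-3]}(w)=(n-1)-w(n-1)$. For $n=1$, $S_0$ is the trivial group, on whose only element all lengths are $0$ and the descent set is empty. *)

theory Defs
  imports
    "HOL-Analysis.Analysis"
    "HOL-Algebra.QuotRing"
    "HOL-Algebra.IntRing"
    "HOL-Algebra.Ring_Divisibility"
    "HOL-Algebra.Sym_Groups"
    "HOL-Algebra.Algebraic_Closure_Type"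
begin

subsection \<open>Totally ramified extensions of the $p$-adic integers\<close>

definition discrete_valuation_ring :: "('a, 'm) ring_scheme \<Rightarrow> bool" where
  "discrete_valuation_ring R \<longleftrightarrow>
     principal_domain R \<and> (\<exists>!M. maximalideal M R) \<and> \<not> field R"

definition residue_field :: "('a, 'm) ring_scheme \<Rightarrow> 'a set ring" where
  "residue_field R = R Quot (THE M. maximalideal M R)"

definition has_characteristic :: "('a, 'm) ring_scheme \<Rightarrow> nat \<Rightarrow> bool" where
  "has_characteristic R c \<longleftrightarrow>
     (\<forall>m::nat. [m] \<cdot>\<^bsub>R\<^esub> \<one>\<^bsub>R\<^esub> = \<zero>\<^bsub>R\<^esub> \<longleftrightarrow> c dvd m)"

text \<open>
  The ring of $p$-adic integers as the inverse limit of the rings of integers modulo $p^k$;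
  the component of index \<open>k\<close> is represented by its least non-negative residue.
\<close>

definition padic_int_ring :: "nat \<Rightarrow> (nat \<Rightarrow> int) ring" where
  "padic_int_ring p =
     \<lparr> carrier = {x. \<forall>k. 0 \<le> x k \<and> x k < int p ^ k \<and> x (Suc k) mod int p ^ k = x k},
       monoid.mult = (\<lambda>x y k. (x k * y k) mod int p ^ k),
       one = (\<lambda>k. 1 mod int p ^ k),
       ring.zero = (\<lambda>k. 0),
       add = (\<lambda>x y k. (x k + y k) mod int p ^ k) \<rparr>"

text \<open>
  \<open>R\<close> is free of rank \<open>n\<close> as a module over the $p$-adic integers, which act through a ring
  homomorphism \<open>\<phi>\<close>. If \<open>R\<close> is a discrete valuation ring of residue characteristic $p$,
  there is at most one such \<open>\<phi>\<close>, because it is automatically continuous.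
\<close>

definition padic_rank :: "nat \<Rightarrow> ('a, 'm) ring_scheme \<Rightarrow> nat \<Rightarrow> bool" where
  "padic_rank p R n \<longleftrightarrow>
     (\<exists>\<phi> \<in> ring_hom (padic_int_ring p) R. \<exists>b \<in> {..<n} \<rightarrow> carrier R.
        bij_betw (\<lambda>c. \<Oplus>\<^bsub>R\<^esub>i\<in>{..<n}. \<phi> (c i) \<otimes>\<^bsub>R\<^esub> b i)
          ({..<n} \<rightarrow>\<^sub>E carrier (padic_int_ring p)) (carrier R))"

text \<open>
  The sort makes the type a Hausdorff topological commutative ring that is an integral domain of
  characteristic zero. If it is compact and a discrete valuation ring, then its topology is
  necessarily the one given by the powers of the maximal ideal.
\<close>

definition finite_padic_extension ::
  "nat \<Rightarrow> 'a::{idom, ring_char_0, topological_group_add, topological_semigroup_mult, t2_space} itself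
    \<Rightarrow> bool" where
  "finite_padic_extension p _ \<longleftrightarrow>
     compact (UNIV :: 'a set) \<and>
     discrete_valuation_ring (ring_of_type_algebra :: 'a ring) \<and>
     has_characteristic (residue_field (ring_of_type_algebra :: 'a ring)) p"

definition totally_ramified_extension ::
  "nat \<Rightarrow> nat \<Rightarrow>
   'a::{idom, ring_char_0, topological_group_add, topological_semigroup_mult, t2_space} itself
    \<Rightarrow> bool" where
  "totally_ramified_extension p n T \<longleftrightarrow>
     finite_padic_extension p T \<and>
     residue_field (ring_of_type_algebra :: 'a ring) \<simeq> ZFact (int p) \<and>
     padic_rank p (ring_of_type_algebra :: 'a ring) n"


subsection \<open>The Heisenberg group and normal zeta functions\<close>

text \<open>
  The indices are spelled out because the library order on the index type \<open>3\<close> has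
  \<open>3 = 0\<close> as least element.
\<close>

definition heisenberg_group :: "('a::comm_ring_1 ^ 3 ^ 3) monoid" where
  "heisenberg_group =
     \<lparr> carrier = {A. A $ 1 $ 1 = 1 \<and> A $ 2 $ 2 = 1 \<and> A $ 3 $ 3 = 1 \<and>
                     A $ 2 $ 1 = 0 \<and> A $ 3 $ 1 = 0 \<and> A $ 3 $ 2 = 0},
       monoid.mult = (**),
       one = mat 1 \<rparr>"

text \<open>For \<open>m \<ge> 1\<close>, the condition on \<open>card\<close> includes that the index is finite.\<close>

definition normal_subgroup_count :: "('g, 'm) monoid_scheme \<Rightarrow> 'g topology \<Rightarrow> nat \<Rightarrow> nat" where
  "normal_subgroup_count G T m =
     card {N. N \<lhd> G \<and> openin T N \<and> card (rcosets\<^bsub>G\<^esub> N) = m}"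

definition normal_zeta_term ::
  "('g, 'm) monoid_scheme \<Rightarrow> 'g topology \<Rightarrow> complex \<Rightarrow> nat \<Rightarrow> complex" where
  "normal_zeta_term G T s m = of_nat (normal_subgroup_count G T m) * of_nat m powr (- s)"

definition normal_zeta :: "('g, 'm) monoid_scheme \<Rightarrow> 'g topology \<Rightarrow> complex \<Rightarrow> complex" where
  "normal_zeta G T s = (\<Sum>m. normal_zeta_term G T s (Suc m))"

definition padic_lattice_zeta :: "nat \<Rightarrow> nat \<Rightarrow> complex \<Rightarrow> complex" where
  "padic_lattice_zeta p d s = (\<Prod>i<d. inverse (1 - of_nat p powr (of_nat i - s)))"


subsection \<open>Statistics on symmetric groups\<close>

definition adjacent_transposition :: "nat \<Rightarrow> nat \<Rightarrow> nat" where
  "adjacent_transposition i = Transposition.transpose i (Suc i)"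

definition coxeter_length :: "nat \<Rightarrow> (nat \<Rightarrow> nat) \<Rightarrow> nat" where
  "coxeter_length N w =
     (LEAST k. \<exists>is. set is \<subseteq> {1..N - 1} \<and> length is = k \<and>
                   foldr (\<circ>) (map adjacent_transposition is) id = w)"

text \<open>
  The length of the shortest element of the left coset of \<open>w\<close> modulo the parabolic subgroup
  generated by the adjacent transpositions with index in \<open>I\<close>.
\<close>

definition parabolic_length :: "nat \<Rightarrow> nat set \<Rightarrow> (nat \<Rightarrow> nat) \<Rightarrow> nat" where
  "parabolic_length N I w =
     Min (coxeter_length N `
       (w <#\<^bsub>sym_group N\<^esub> generate (sym_group N) (adjacent_transposition ` I)))"

definition right_descents :: "nat \<Rightarrow> (nat \<Rightarrow> nat) \<Rightarrow> nat set" where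
  "right_descents N w = {i \<in> {1..N - 1}. w (i + 1) < w i}"

end

theory Submission
  imports Defs "HOL-Number_Theory.Cong"
begin

text \<open>
Write \<open>T\<close> for \<open>p\<close> to the power \<open>-s\<close> and \<open>\<pi>\<close> for a uniformizer of \<open>R\<close>; total ramification makes
\<open>p\<close> a unit times the \<open>n\<close>-th power of \<open>\<pi>\<close>.  In the coordinates \<open>((a, b), c)\<close> of a unitriangular matrix
(\<open>c\<close> is the corner), the commutators of one element with the whole group fill the ideal generated by
\<open>a\<close> and \<open>b\<close> in the centre.  Modulo this ideal the correction term \<open>a b'\<close> in a
product vanishes, so the normal subgroups are exactly the additive subgroups \<open>Y\<close> of
\<open>(R \<times> R) \<times> R\<close> that contain the central elements \<open>r a\<close> and \<open>r b\<close> for all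
\<open>((a, b), c)\<close> in \<open>Y\<close>; even the cosets are the same sets (\<open>normal_hmat_iff\<close>,
\<open>card_rcosets_hmat\<close>).  Finite index implies openness, because \<open>Y\<close> then contains a
multiple of everything and ideals are open in the compact ring \<open>R\<close>.

Let \<open>M\<close> be the centre part of \<open>Y\<close> and \<open>\<Lambda>\<close> its projection to \<open>R \<times> R\<close>.  The condition on
\<open>Y\<close> says that the ideal generated by the entries of \<open>\<Lambda>\<close> lies in \<open>M\<close>, that is, that
\<open>\<Lambda> = \<pi> ^ c \<Lambda>'\<close> for a lattice \<open>\<Lambda>'\<close>, where \<open>c\<close> is the conductor of \<open>M\<close>, the least exponent of
a power of \<open>\<pi>\<close> that generates an ideal inside \<open>M\<close>.  Since \<open>\<Lambda>\<close> is free of rank \<open>2 n\<close>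
over the p-adic integers, each pair \<open>(\<Lambda>', M)\<close> comes from \<open>[R : M] ^ (2 n)\<close> subgroups
\<open>Y\<close> (\<open>card_relative_complements\<close>, \<open>split_heis_fibre\<close>), and the zeta function is the product of the
zeta function of \<open>R \<times> R\<close> (\<open>zeta_padic_free\<close>) and the sum over all \<open>M\<close> of
\<open>(p ^ (2 n) T) ^ m T ^ (2 c)\<close>, where \<open>p ^ m\<close> is the index of \<open>M\<close> (\<open>heis_sum_split\<close>).

To evaluate this sum, attach to \<open>M\<close> its finite set of gaps, the natural numbers that are not the
valuation of an element of \<open>M\<close>.  Both \<open>m\<close> and \<open>c\<close> can be read off: they are the
number of gaps and the largest gap plus one (or \<open>0\<close> if there are no gaps).  Removing the largest gap one step at a time counts
the \<open>M\<close> with a given gap set: each gap \<open>g\<close> contributes a factor \<open>p\<close> for every generator of the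
complement below \<open>g\<close> (\<open>card_lattices_gaps\<close>).  Multiplication by \<open>\<pi>\<close> splits off the factor
\<open>1 / (1 - p ^ (2 n) T ^ 3)\<close> and leaves the gap sets without \<open>0\<close>.  Such a set is determined
by the least non-gaps \<open>i + n a i\<close> in the residue classes of \<open>i = 1, ..., n - 1\<close>.  Sorting these
numbers gives a permutation \<open>w\<close> and increments that are arbitrary natural numbers, except that they are
positive at the descents of \<open>w\<close> (\<open>bij_gap_sets\<close>).  All exponents become linear in the increments, with
constant terms \<open>- inversions\<close> and \<open>2 (n - 1 - w (n - 1)) s\<close>, so that the sum is a
product of geometric series for each \<open>w\<close> (\<open>has_sum_gap_sets\<close>).  The two statistics on \<open>w\<close> are its
Coxeter length and its parabolic length (\<open>coxeter_length_inversions\<close>,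
\<open>parabolic_length_last\<close>).
\<close>

section \<open>Subgroups of abelian groups and their indices\<close>

definition add_subgroup :: "'b::ab_group_add set \<Rightarrow> bool" where
  "add_subgroup A \<longleftrightarrow> 0 \<in> A \<and> (\<forall>x\<in>A. \<forall>y\<in>A. x - y \<in> A)"

text \<open>
An infinite index is represented by \<open>0\<close>.
\<close>

definition add_index :: "'b::ab_group_add set \<Rightarrow> 'b set \<Rightarrow> nat" where
  "add_index G H = card ((\<lambda>x. (+) x ` H) ` G)"

lemma add_subgroupI: "0 \<in> A \<Longrightarrow> (\<And>x y. x \<in> A \<Longrightarrow> y \<in> A \<Longrightarrow> x - y \<in> A) \<Longrightarrow> add_subgroup A"
  by (simp add: add_subgroup_def)

lemma add_subgroup_zero: "add_subgroup A \<Longrightarrow> 0 \<in> A"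
  by (simp add: add_subgroup_def)

lemma add_subgroup_diff: "add_subgroup A \<Longrightarrow> x \<in> A \<Longrightarrow> y \<in> A \<Longrightarrow> x - y \<in> A"
  by (simp add: add_subgroup_def)

lemma add_subgroup_minus: "add_subgroup A \<Longrightarrow> x \<in> A \<Longrightarrow> - x \<in> A"
  using add_subgroup_diff[of A 0 x] add_subgroup_zero[of A] by simp

lemma add_subgroup_add: "add_subgroup A \<Longrightarrow> x \<in> A \<Longrightarrow> y \<in> A \<Longrightarrow> x + y \<in> A"
  using add_subgroup_diff[of A x "- y"] add_subgroup_minus[of A y] by simp

lemma add_subgroup_sum: "add_subgroup A \<Longrightarrow> (\<And>i. i \<in> I \<Longrightarrow> f i \<in> A) \<Longrightarrow> sum f I \<in> A"
  by (induction I rule: infinite_finite_induct) (auto intro: add_subgroup_zero add_subgroup_add)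

lemma add_subgroup_of_nat: "add_subgroup A \<Longrightarrow> x \<in> A \<Longrightarrow> of_nat k * x \<in> A" for x :: "'b::comm_ring_1"
  by (induction k) (auto simp: algebra_simps intro: add_subgroup_zero add_subgroup_add)

lemma add_subgroup_of_int: "add_subgroup A \<Longrightarrow> x \<in> A \<Longrightarrow> of_int k * x \<in> A" for x :: "'b::comm_ring_1"
proof (cases k)
  case (neg j)
  assume "add_subgroup A" "x \<in> A"
  then show ?thesis using add_subgroup_minus[OF _ add_subgroup_of_nat[of A x "Suc j"]] 
    by (simp only: neg of_int_minus of_int_of_nat_eq mult_minus_left)
qed (simp add: add_subgroup_of_nat)

lemma add_subgroup_UNIV: "add_subgroup UNIV"
  by (simp add: add_subgroup_def)

lemma add_subgroup_singleton: "add_subgroup {0}"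
  by (simp add: add_subgroup_def)

lemma add_subgroup_Int: "add_subgroup A \<Longrightarrow> add_subgroup B \<Longrightarrow> add_subgroup (A \<inter> B)"
  by (simp add: add_subgroup_def)

lemma add_subgroup_Times: "add_subgroup A \<Longrightarrow> add_subgroup B \<Longrightarrow> add_subgroup (A \<times> B)"
  by (auto simp: add_subgroup_def zero_prod_def)

lemma set_plusE: assumes "x \<in> A + B" obtains a b where "a \<in> A" "b \<in> B" "x = a + b"
  using assms by (auto simp: set_plus_def)

lemma add_subgroup_plus: assumes "add_subgroup A" "add_subgroup B" shows "add_subgroup (A + B)"
proof (rule add_subgroupI)
  show "0 \<in> A + B" using set_plus_intro[of 0 A 0 B] add_subgroup_zero[OF assms(1)] add_subgroup_zero[OF assms(2)] by simp
  fix x y assume "x \<in> A + B" "y \<in> A + B"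
  then obtain a b a' b' where *: "a \<in> A" "b \<in> B" "x = a + b" "a' \<in> A" "b' \<in> B" "y = a' + b'"
    by (auto elim!: set_plusE)
  have "x - y = (a - a') + (b - b')" using * by simp
  then show "x - y \<in> A + B" using set_plus_intro[of "a - a'" A "b - b'" B] assms * add_subgroup_diff by metis
qed

lemma subset_plus_left: "add_subgroup B \<Longrightarrow> A \<subseteq> A + B"
  by (metis add.right_neutral add_subgroup_zero set_plus_intro subsetI)

lemma subset_plus_right: "add_subgroup A \<Longrightarrow> B \<subseteq> A + B"
  by (metis add.left_neutral add_subgroup_zero set_plus_intro subsetI)

lemma plus_subset: "add_subgroup C \<Longrightarrow> A \<subseteq> C \<Longrightarrow> B \<subseteq> C \<Longrightarrow> A + B \<subseteq> C"
  by (auto elim!: set_plusE intro: add_subgroup_add)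

lemma coset_eq_iff: assumes "add_subgroup H"
  shows "(+) x ` H = (+) y ` H \<longleftrightarrow> x - y \<in> H"
proof
  assume "(+) x ` H = (+) y ` H"
  moreover have "x \<in> (+) x ` H" using add_subgroup_zero[OF assms] by (metis add.right_neutral image_eqI)
  ultimately obtain h where "h \<in> H" "x = y + h" by auto
  then show "x - y \<in> H" by simp
next
  have aux: "(+) x ` H \<subseteq> (+) y ` H" if "x - y \<in> H" for x y
  proof
    fix z assume "z \<in> (+) x ` H"
    then obtain h where "h \<in> H" "z = x + h" by auto
    then have "z = y + ((x - y) + h)" "(x - y) + h \<in> H" using add_subgroup_add[OF assms] that by auto
    then show "z \<in> (+) y ` H" by blast
  qed
  assume "x - y \<in> H"
  then show "(+) x ` H = (+) y ` H" using aux[of x y] aux[of y x] add_subgroup_minus[OF assms, of "x - y"] by auto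
qed

text \<open>
An index is the number of classes of the relation of lying in the same coset, so two indices agree as soon as
the relations do.
\<close>

lemma card_image_eqI:
  assumes "\<And>x y. x \<in> A \<Longrightarrow> y \<in> A \<Longrightarrow> f x = f y \<longleftrightarrow> g x = g y"
  shows "card (f ` A) = card (g ` A)"
proof (rule bij_betw_same_card)
  have 1: "g (inv_into A f (f x)) = g x" if "x \<in> A" for x
    using that assms[of "inv_into A f (f x)" x] by (simp add: f_inv_into_f inv_into_into)
  have 2: "f (inv_into A g (g x)) = f x" if "x \<in> A" for x
    using that assms[of "inv_into A g (g x)" x] by (simp add: f_inv_into_f inv_into_into)
  show "bij_betw (\<lambda>c. g (inv_into A f c)) (f ` A) (g ` A)"
    by (rule bij_betw_byWitness[where f' = "\<lambda>c. f (inv_into A g c)"]) (auto simp: 1 2 f_inv_into_f)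
qed

text \<open>
A representative \<open>r A\<close> of every coset \<open>A\<close> of \<open>G\<close> identifies the cosets of \<open>H\<close> in \<open>F\<close> with pairs
of a coset of \<open>G\<close> in \<open>F\<close> and a coset of \<open>H\<close> in \<open>G\<close>.  The product formula for cardinalities then also covers
infinite indices.
\<close>

lemma add_index_mult:
  assumes "add_subgroup F" "add_subgroup G" "add_subgroup H" "H \<subseteq> G" "G \<subseteq> F"
  shows "add_index F H = add_index F G * add_index G H"
proof -
  define r where "r A = (SOME x. x \<in> F \<and> (+) x ` G = A)" for A
  have r: "r ((+) x ` G) \<in> F" "r ((+) x ` G) - x \<in> G" if "x \<in> F" for x
    using someI[of "\<lambda>y. y \<in> F \<and> (+) y ` G = (+) x ` G" x] that coset_eq_iff[OF assms(2)]
    unfolding r_def by auto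
  define g where "g x = ((+) x ` G, (+) (x - r ((+) x ` G)) ` H)" for x
  have "card ((\<lambda>x. (+) x ` H) ` F) = card (g ` F)"
  proof (rule card_image_eqI)
    fix x y assume "x \<in> F" "y \<in> F"
    show "(+) x ` H = (+) y ` H \<longleftrightarrow> g x = g y"
    proof
      assume "(+) x ` H = (+) y ` H"
      then have *: "x - y \<in> H" by (simp add: coset_eq_iff assms)
      then have eq: "(+) x ` G = (+) y ` G" using assms by (auto simp: coset_eq_iff)
      show "g x = g y" using * by (simp add: g_def eq coset_eq_iff[OF assms(3)])
    next
      assume "g x = g y"
      then have eq: "(+) x ` G = (+) y ` G"
        by (simp add: g_def)
      from \<open>g x = g y\<close> have "(+) (x - r ((+) y ` G)) ` H = (+) (y - r ((+) y ` G)) ` H"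
        unfolding g_def eq by blast
      then show "(+) x ` H = (+) y ` H" by (simp add: coset_eq_iff[OF assms(3)])
    qed
  qed
  also have "g ` F = (\<lambda>x. (+) x ` G) ` F \<times> (\<lambda>x. (+) x ` H) ` G"
  proof (intro equalityI subsetI)
    fix z assume "z \<in> g ` F"
    then obtain x where x: "x \<in> F" "z = g x" by auto
    have "x - r ((+) x ` G) \<in> G" using add_subgroup_minus[OF assms(2) r(2)[OF x(1)]] by simp
    then show "z \<in> (\<lambda>x. (+) x ` G) ` F \<times> (\<lambda>x. (+) x ` H) ` G" using x by (auto simp: g_def)
  next
    fix z assume "z \<in> (\<lambda>x. (+) x ` G) ` F \<times> (\<lambda>x. (+) x ` H) ` G"
    then obtain x y where xy: "x \<in> F" "y \<in> G" "z = ((+) x ` G, (+) y ` H)" by auto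
    define w where "w = r ((+) x ` G) + y"
    have w: "w \<in> F" using r[OF xy(1)] xy assms add_subgroup_add[OF assms(1)] by (auto simp: w_def)
    have "w - x = (r ((+) x ` G) - x) + y" by (simp add: w_def)
    then have "w - x \<in> G" using r(2)[OF xy(1)] xy(2) add_subgroup_add[OF assms(2)] by metis
    then have "(+) w ` G = (+) x ` G" by (simp add: coset_eq_iff assms)
    then have "g w = z" using xy by (simp add: g_def w_def)
    then show "z \<in> g ` F" using w by blast
  qed
  finally show ?thesis by (simp add: add_index_def card_cartesian_product)
qed

lemma add_index_plus:
  assumes "add_subgroup N" "add_subgroup K"
  shows "add_index (N + K) N = add_index K (N \<inter> K)"
proof -
  have "(\<lambda>x. (+) x ` N) ` (N + K) = (\<lambda>x. (+) x ` N) ` K"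
  proof (intro equalityI subsetI)
    fix z assume "z \<in> (\<lambda>x. (+) x ` N) ` (N + K)"
    then obtain a b where "a \<in> N" "b \<in> K" "z = (+) (a + b) ` N" by (auto elim!: set_plusE)
    then have "z = (+) b ` N" using assms by (simp add: coset_eq_iff)
    then show "z \<in> (\<lambda>x. (+) x ` N) ` K" using \<open>b \<in> K\<close> by blast
  qed (use subset_plus_right[OF assms(1)] in blast)
  moreover have "card ((\<lambda>x. (+) x ` N) ` K) = card ((\<lambda>x. (+) x ` (N \<inter> K)) ` K)"
    using assms by (intro card_image_eqI) (auto simp: coset_eq_iff add_subgroup_Int add_subgroup_diff)
  ultimately show ?thesis by (simp add: add_index_def)
qed

lemma add_index_image:
  assumes "\<And>x y. f (x - y) = f x - f y" "inj f" "add_subgroup H"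
  shows "add_index (f ` G) (f ` H) = add_index G H"
proof -
  have f0: "f 0 = 0" using assms(1)[of 0 0] by simp
  have sub: "add_subgroup (f ` H)"
    using assms by (auto simp: add_subgroup_def f0[symmetric] simp flip: assms(1))
  have "card ((\<lambda>x. (+) (f x) ` f ` H) ` G) = card ((\<lambda>x. (+) x ` H) ` G)"
    by (rule card_image_eqI)
      (simp add: coset_eq_iff[OF sub] coset_eq_iff[OF assms(3)] inj_image_mem_iff[OF assms(2)] flip: assms(1))
  then show ?thesis by (simp add: add_index_def image_image)
qed

lemma add_index_self: "add_subgroup G \<Longrightarrow> add_index G G = 1"
proof -
  assume G: "add_subgroup G"
  have "(\<lambda>x. (+) x ` G) ` G = {(+) 0 ` G}"
    using G add_subgroup_zero[OF G] coset_eq_iff[OF G, of _ 0] by (auto simp del: add_0_left)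
  then show ?thesis by (simp add: add_index_def)
qed

lemma finite_cosets: "add_index G H \<noteq> 0 \<Longrightarrow> finite ((\<lambda>x. (+) x ` H) ` G)"
  unfolding add_index_def by (metis card.infinite)

section \<open>Subgroups with prescribed sum and intersection\<close>

text \<open>
Modulo \<open>q P + K\<close>, the group \<open>P\<close> is a free module over the integers modulo \<open>q\<close> with basis
\<open>b\<close>.  A subgroup \<open>N\<close> with sum \<open>P\<close> and intersection \<open>M\<close> contains
\<open>b i - z\<close> for a \<open>z \<in> K\<close> that is unique modulo \<open>M\<close>.  It contains \<open>q P\<close> as well, so it is determined by
these cosets; and every choice of cosets occurs, because a relation between the \<open>b i - z\<close> modulo
\<open>K\<close> has coefficients divisible by \<open>q\<close> and therefore, by the last assumption, lies in \<open>M\<close>.  Any two such \<open>N\<close> differ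
by a homomorphism from \<open>P / K\<close> to \<open>K / M\<close>, which is what the formula counts.
This one count serves three times below: for lattices in a p-adic lattice, for lattices with a given gap
set, and for normal subgroups with given projection and centre.
\<close>

lemma card_relative_complements:
  fixes b :: "'i \<Rightarrow> 'b::comm_ring_1" and q :: int
  assumes P: "add_subgroup P" and K: "add_subgroup K" "K \<subseteq> P" and M: "add_subgroup M" "M \<subseteq> K"
    and qK: "\<And>x. x \<in> K \<Longrightarrow> of_int q * x \<in> M"
    and I: "finite I" and b: "\<And>i. i \<in> I \<Longrightarrow> b i \<in> P"
    and gen: "\<And>x. x \<in> P \<Longrightarrow> \<exists>c. \<exists>y\<in>P. x - (\<Sum>i\<in>I. of_int (c i) * b i) - of_int q * y \<in> K"
    and ind: "\<And>c y. y \<in> P \<Longrightarrow> (\<Sum>i\<in>I. of_int (c i) * b i) - of_int q * y \<in> K \<Longrightarrow> \<forall>i\<in>I. q dvd c i"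
    and tf: "\<And>y. y \<in> P \<Longrightarrow> of_int q * y \<in> K \<Longrightarrow> of_int q * y \<in> M"
  shows "card {N. add_subgroup N \<and> N + K = P \<and> N \<inter> K = M} = add_index K M ^ card I"
proof -
  define \<N> where "\<N> = {N. add_subgroup N \<and> N + K = P \<and> N \<inter> K = M}"
  define S where "S N i = {z \<in> K. b i - z \<in> N}" for N i
  define \<C> where "\<C> = (\<lambda>x. (+) x ` M) ` K"
  define \<Phi> where "\<Phi> N = restrict (S N) I" for N
  have qP: "of_int q * y \<in> N" if N: "N \<in> \<N>" and y: "y \<in> P" for N y
  proof -
    obtain u z where *: "u \<in> N" "z \<in> K" "y = u + z" using N y by (auto simp: \<N>_def elim!: set_plusE)
    have "of_int q * z \<in> N" using qK[OF *(2)] N by (auto simp: \<N>_def)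
    moreover have "of_int q * u \<in> N" using N * by (auto simp: \<N>_def intro: add_subgroup_of_int)
    ultimately show ?thesis using add_subgroup_add[of N "of_int q * u" "of_int q * z"] N *
      by (simp add: distrib_left \<N>_def)
  qed
  have Scos: "S N i = (+) z ` M" if N: "N \<in> \<N>" and i: "i \<in> I" and z: "z \<in> S N i" for N i z
  proof (intro equalityI subsetI)
    fix w assume "w \<in> S N i"
    then have "w - z = (b i - z) - (b i - w)" "w - z \<in> K" "b i - w \<in> N" "b i - z \<in> N"
      using z K add_subgroup_diff[of K w z] by (auto simp: S_def)
    then have "w - z \<in> M" using N add_subgroup_diff[of N "b i - z" "b i - w"] by (auto simp: \<N>_def)
    then show "w \<in> (+) z ` M" by (intro image_eqI[of _ _ "w - z"]) auto
  next
    fix w assume "w \<in> (+) z ` M"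
    then obtain m where m: "m \<in> M" "w = z + m" by auto
    then have "m \<in> N" using N by (auto simp: \<N>_def)
    then have "b i - z - m \<in> N" using z N add_subgroup_diff[of N "b i - z" m] by (auto simp: \<N>_def S_def)
    moreover have "w \<in> K" using z m M K add_subgroup_add[of K z m] by (auto simp: S_def)
    ultimately show "w \<in> S N i" using m by (simp add: S_def diff_diff_eq)
  qed
  have Sne: "\<exists>z. z \<in> S N i" if N: "N \<in> \<N>" and i: "i \<in> I" for N i
  proof -
    obtain u z where "u \<in> N" "z \<in> K" "b i = u + z" using N b[OF i] by (auto simp: \<N>_def elim!: set_plusE)
    then show ?thesis by (intro exI[of _ z]) (simp add: S_def)
  qed
  have into: "\<Phi> N \<in> I \<rightarrow>\<^sub>E \<C>" if N: "N \<in> \<N>" for N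
    using Scos[OF N] Sne[OF N] by (fastforce simp: \<Phi>_def \<C>_def S_def)
  have le: "N \<subseteq> N'" if N: "N \<in> \<N>" and N': "N' \<in> \<N>" and eq: "\<Phi> N = \<Phi> N'" for N N'
  proof
    fix x assume x: "x \<in> N"
    have xP: "x \<in> P" using N x subset_plus_left[OF K(1), of N] by (auto simp: \<N>_def)
    obtain c y where y: "y \<in> P" and k: "x - (\<Sum>i\<in>I. of_int (c i) * b i) - of_int q * y \<in> K" (is "?k \<in> K")
      using gen[OF xP] by auto
    obtain z where z: "\<And>i. i \<in> I \<Longrightarrow> z i \<in> S N i" using Sne[OF N] by metis
    have zN: "b i - z i \<in> N" "b i - z i \<in> N'" "z i \<in> K" if "i \<in> I" for i
      using z[OF that] fun_cong[OF eq, of i] that by (auto simp: \<Phi>_def S_def)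
    define w where "w = (\<Sum>i\<in>I. of_int (c i) * (b i - z i)) + of_int q * y"
    have sub: "add_subgroup N" "add_subgroup N'" using N N' by (simp_all add: \<N>_def)
    have w: "w \<in> N" "w \<in> N'" unfolding w_def
      by (rule add_subgroup_add[OF sub(1) add_subgroup_sum[OF sub(1) add_subgroup_of_int[OF sub(1) zN(1)]] qP[OF N y]],
          assumption,
          rule add_subgroup_add[OF sub(2) add_subgroup_sum[OF sub(2) add_subgroup_of_int[OF sub(2) zN(2)]] qP[OF N' y]])
    have eqk: "x - w = ?k + (\<Sum>i\<in>I. of_int (c i) * z i)"
      by (simp add: w_def right_diff_distrib sum_subtractf)
    have "x - w \<in> K" unfolding eqk using zN by (intro add_subgroup_add[OF K(1) k] add_subgroup_sum[OF K(1)] add_subgroup_of_int[OF K(1)]) auto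
    moreover have "x - w \<in> N" using x w N add_subgroup_diff by (auto simp: \<N>_def)
    ultimately have "x - w \<in> N'" using N N' by (auto simp: \<N>_def)
    then show "x \<in> N'" using w add_subgroup_add[of N' "x - w" w] N' by (auto simp: \<N>_def)
  qed
  have surj: "\<exists>N\<in>\<N>. \<Phi> N = f" if f: "f \<in> I \<rightarrow>\<^sub>E \<C>" for f
  proof -
    have "\<forall>i\<in>I. \<exists>z\<in>K. f i = (+) z ` M" using f unfolding \<C>_def PiE_iff by blast
    then obtain z where z: "\<And>i. i \<in> I \<Longrightarrow> z i \<in> K" "\<And>i. i \<in> I \<Longrightarrow> f i = (+) (z i) ` M" by metis
    \<comment> \<open>The candidate is spanned by the shifted basis, by \<open>q P\<close> and by \<open>M\<close>.\<close>
    define N where "N = {(\<Sum>i\<in>I. of_int (c i) * (b i - z i)) + of_int q * y + m | c y m. y \<in> P \<and> m \<in> M}"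
    have NI: "(\<Sum>i\<in>I. of_int (c i) * (b i - z i)) + of_int q * y + m \<in> N" if "y \<in> P" "m \<in> M" for c y m
      using that by (auto simp: N_def)
    have N: "add_subgroup N"
    proof (rule add_subgroupI)
      show "0 \<in> N" using NI[of 0 0 "\<lambda>_. 0"] P M add_subgroup_zero by auto
      fix u v assume "u \<in> N" "v \<in> N"
      then obtain c y m c' y' m' where *: "y \<in> P" "m \<in> M" "y' \<in> P" "m' \<in> M"
        "u = (\<Sum>i\<in>I. of_int (c i) * (b i - z i)) + of_int q * y + m"
        "v = (\<Sum>i\<in>I. of_int (c' i) * (b i - z i)) + of_int q * y' + m'" by (auto simp: N_def)
      have "u - v = (\<Sum>i\<in>I. of_int (c i - c' i) * (b i - z i)) + of_int q * (y - y') + (m - m')"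
        by (simp add: * algebra_simps sum_subtractf sum.distrib)
      then show "u - v \<in> N" using NI[of "y - y'" "m - m'" "\<lambda>i. c i - c' i"] * P M add_subgroup_diff by metis
    qed
    have MN: "M \<subseteq> N" using NI[of 0 _ "\<lambda>_. 0"] P add_subgroup_zero by auto
    have zb: "b i - z i \<in> N" if "i \<in> I" for i
    proof -
      have "b i - z i = (\<Sum>j\<in>I. of_int (if j = i then 1 else 0) * (b j - z j))"
        using that I by (subst sum.cong[OF refl, of _ _ "\<lambda>j. if j = i then b j - z j else 0"]) auto
      then show ?thesis using NI[of 0 0 "\<lambda>j. if j = i then 1 else 0"] P M add_subgroup_zero by auto
    qed
    have qPN: "of_int q * y \<in> N" if "y \<in> P" for y
      using NI[of y 0 "\<lambda>_. 0"] that M add_subgroup_zero by auto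
    have zP: "z i \<in> P" "b i - z i \<in> P" if "i \<in> I" for i
      using z(1)[OF that] K b[OF that] add_subgroup_diff[OF P, of "b i" "z i"] by auto
    have NP: "N \<subseteq> P"
      using zP M K by (auto simp: N_def intro!: add_subgroup_add[OF P] add_subgroup_sum[OF P] add_subgroup_of_int[OF P])
    have "N + K = P"
    proof (intro equalityI subsetI)
      fix x assume "x \<in> P"
      then obtain c y where y: "y \<in> P" and k: "x - (\<Sum>i\<in>I. of_int (c i) * b i) - of_int q * y \<in> K" (is "?k \<in> K")
        using gen by blast
      have x: "x = ((\<Sum>i\<in>I. of_int (c i) * (b i - z i)) + of_int q * y) + (?k + (\<Sum>i\<in>I. of_int (c i) * z i))"
        by (simp add: right_diff_distrib sum_subtractf)
      have 1: "(\<Sum>i\<in>I. of_int (c i) * (b i - z i)) + of_int q * y \<in> N"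
        by (rule add_subgroup_add[OF N add_subgroup_sum[OF N add_subgroup_of_int[OF N zb]] qPN[OF y]])
      have 2: "?k + (\<Sum>i\<in>I. of_int (c i) * z i) \<in> K"
        by (rule add_subgroup_add[OF K(1) k add_subgroup_sum[OF K(1) add_subgroup_of_int[OF K(1) z(1)]]])
      show "x \<in> N + K" by (subst x) (rule set_plus_intro[OF 1 2])
    qed (use plus_subset[OF P NP K(2)] in blast)
    moreover have "N \<inter> K = M"
    proof (intro equalityI subsetI)
      fix x assume x: "x \<in> N \<inter> K"
      then obtain c y m where *: "y \<in> P" "m \<in> M"
        "x = (\<Sum>i\<in>I. of_int (c i) * (b i - z i)) + of_int q * y + m" by (auto simp: N_def)
      have k: "(\<Sum>i\<in>I. of_int (c i) * z i) - m \<in> K"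
        using z M * by (intro add_subgroup_diff[OF K(1)] add_subgroup_sum[OF K(1)] add_subgroup_of_int[OF K(1)]) auto
      have "(\<Sum>i\<in>I. of_int (c i) * b i) - of_int q * (- y) = x + ((\<Sum>i\<in>I. of_int (c i) * z i) - m)"
        by (simp add: * right_diff_distrib sum_subtractf)
      then have "(\<Sum>i\<in>I. of_int (c i) * b i) - of_int q * (- y) \<in> K"
        using add_subgroup_add[OF K(1) _ k, of x] x by simp
      then have "\<forall>i\<in>I. q dvd c i" using ind[of "- y" c] add_subgroup_minus[OF P *(1)] by blast
      then obtain d where d: "\<And>i. i \<in> I \<Longrightarrow> c i = q * d i" unfolding dvd_def by metis
      define w where "w = (\<Sum>i\<in>I. of_int (d i) * (b i - z i)) + y"
      have w: "w \<in> P" unfolding w_def using zP * by (intro add_subgroup_add[OF P] add_subgroup_sum[OF P] add_subgroup_of_int[OF P]) auto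
      have "(\<Sum>i\<in>I. of_int (c i) * (b i - z i)) = of_int q * (\<Sum>i\<in>I. of_int (d i) * (b i - z i))"
        unfolding sum_distrib_left by (rule sum.cong) (auto simp: d mult.assoc)
      then have xw: "x = of_int q * w + m" by (simp add: * w_def distrib_left)
      have "of_int q * w = x - m" by (simp add: xw)
      then have "of_int q * w \<in> K" using add_subgroup_diff[OF K(1), of x m] x * M by auto
      then have "of_int q * w \<in> M" by (rule tf[OF w])
      then show "x \<in> M" using xw add_subgroup_add[OF M(1)] * by auto
    qed (use MN M in auto)
    ultimately have NN: "N \<in> \<N>" using N by (simp add: \<N>_def)
    moreover have "\<Phi> N = f"
    proof
      fix i show "\<Phi> N i = f i"
      proof (cases "i \<in> I")
        case True
        then have "z i \<in> S N i" using z zb by (auto simp: S_def)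
        then show ?thesis using True Scos[OF NN True] z(2)[OF True] by (simp add: \<Phi>_def)
      next
        case False then show ?thesis using f by (auto simp: \<Phi>_def PiE_def extensional_def)
      qed
    qed
    ultimately show ?thesis by blast
  qed
  have "bij_betw \<Phi> \<N> (I \<rightarrow>\<^sub>E \<C>)"
    unfolding bij_betw_def
  proof
    show "inj_on \<Phi> \<N>" by (rule inj_onI, rule equalityI) (use le in simp_all)
    show "\<Phi> ` \<N> = I \<rightarrow>\<^sub>E \<C>" using into surj by blast
  qed
  then have "card \<N> = card (I \<rightarrow>\<^sub>E \<C>)" by (rule bij_betw_same_card)
  also have "\<dots> = card \<C> ^ card I" using I by (simp add: card_PiE)
  finally show ?thesis by (simp add: \<N>_def \<C>_def add_index_def)
qed

section \<open>Iterated extensions of p-adic lines\<close>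

lemma add_subgroup_times_image: "add_subgroup V \<Longrightarrow> add_subgroup ((*) c ` V)" for c :: "'b::comm_ring_1"
proof (rule add_subgroupI)
  assume V: "add_subgroup V"
  show "0 \<in> (*) c ` V" using add_subgroup_zero[OF V] by (intro image_eqI[of _ _ 0]) auto
  fix x y assume "x \<in> (*) c ` V" "y \<in> (*) c ` V"
  then show "x - y \<in> (*) c ` V" using add_subgroup_diff[OF V] by (auto simp flip: right_diff_distrib)
qed

text \<open>
The quotient \<open>V / K\<close> behaves like the p-adic integers with generator \<open>b\<close>: it is torsion
free, and the multiples of \<open>b\<close> represent its residues modulo \<open>p\<close>.  The integers are another example; they have the same
subgroups of index a power of \<open>p\<close>, and only such subgroups are counted.
\<close>

locale padic_step =
  fixes p :: nat and V K :: "'b::comm_ring_1 set" and b :: 'b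
  assumes prime: "Factorial_Ring.prime p"
    and V: "add_subgroup V" and K: "add_subgroup K" "K \<subseteq> V" and b: "b \<in> V"
    and decomp1: "x \<in> V \<Longrightarrow> \<exists>c. \<exists>y\<in>V. x - of_int c * b - of_nat p * y \<in> K"
    and pure1: "x \<in> V \<Longrightarrow> of_nat p * x \<in> K \<Longrightarrow> x \<in> K"
    and indep1: "y \<in> V \<Longrightarrow> b - of_nat p * y \<notin> K"
begin

text \<open>
The residues modulo \<open>p ^ k\<close> are found digit by digit.
\<close>

lemma decomp: "x \<in> V \<Longrightarrow> \<exists>c. \<exists>y\<in>V. x - of_int c * b - of_nat p ^ k * y \<in> K"
proof (induction k)
  case 0
  then show ?case using add_subgroup_zero[OF K(1)] by (intro exI[of _ 0] bexI[of _ x]) auto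
next
  case (Suc k)
  then obtain c y where y: "y \<in> V" "x - of_int c * b - of_nat p ^ k * y \<in> K" by blast
  obtain d w where w: "w \<in> V" "y - of_int d * b - of_nat p * w \<in> K" using decomp1[OF y(1)] by blast
  have "x - of_int (c + int p ^ k * d) * b - of_nat p ^ Suc k * w
      = (x - of_int c * b - of_nat p ^ k * y) + of_nat (p ^ k) * (y - of_int d * b - of_nat p * w)"
    by (simp add: algebra_simps)
  also have "\<dots> \<in> K" by (intro add_subgroup_add[OF K(1) y(2)] add_subgroup_of_nat[OF K(1) w(2)])
  finally show ?case using w(1) by blast
qed

lemma pure: "x \<in> V \<Longrightarrow> of_nat p ^ k * x \<in> K \<Longrightarrow> x \<in> K"
proof (induction k)
  case (Suc k)
  have "of_nat (p ^ k) * x \<in> V" by (rule add_subgroup_of_nat[OF V Suc.prems(1)])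
  then show ?case using pure1[of "of_nat p ^ k * x"] Suc by (simp add: mult.assoc)
qed simp

lemma indep: "y \<in> V \<Longrightarrow> of_int c * b - of_nat p ^ k * y \<in> K \<Longrightarrow> int p ^ k dvd c"
proof (induction k arbitrary: c)
  case (Suc k)
  have yk: "of_nat (p ^ k) * y \<in> V" by (rule add_subgroup_of_nat[OF V Suc.prems(1)])
  have "int p dvd c"
  proof (rule ccontr)
    assume "\<not> int p dvd c"
    then have "coprime c (int p)" using prime prime_imp_coprime[of "int p" c] by (simp add: ac_simps)
    then obtain u w where uw: "u * c + w * int p = 1" using bezout_int[of c "int p"] by auto
    have "b = of_int (u * c + w * int p) * b" by (simp only: uw of_int_1 mult_1_left)
    then have "b - of_nat p * (of_int w * b + of_int u * (of_nat (p ^ k) * y))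
       = of_int u * (of_int c * b - of_nat p ^ Suc k * y)"
      by (simp add: algebra_simps)
    also have "\<dots> \<in> K" by (rule add_subgroup_of_int[OF K(1) Suc.prems(2)])
    finally show False using indep1 add_subgroup_add[OF V add_subgroup_of_int[OF V b] add_subgroup_of_int[OF V yk]] by blast
  qed
  then obtain c' where c': "c = int p * c'" by (auto simp: dvd_def)
  have "of_nat p * (of_int c' * b - of_nat p ^ k * y) \<in> K"
    using Suc.prems(2) by (simp add: c' algebra_simps)
  moreover have "of_int c' * b - of_nat p ^ k * y \<in> V"
    using add_subgroup_diff[OF V add_subgroup_of_int[OF V b, of c'] yk] by simp
  ultimately have "of_int c' * b - of_nat p ^ k * y \<in> K" using pure1 by blast
  then have "int p ^ k dvd c'" using Suc.IH Suc.prems(1) by blast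
  then show ?case by (simp add: c')
qed simp

text \<open>
The preimage of the subgroup of index \<open>p ^ a\<close> in \<open>V / K\<close>.
\<close>

definition level :: "nat \<Rightarrow> 'b set" where
  "level a = (*) (of_nat p ^ a) ` V + K"

lemma levelI: "v \<in> V \<Longrightarrow> z \<in> K \<Longrightarrow> of_nat p ^ a * v + z \<in> level a"
  unfolding level_def by (intro set_plus_intro) auto

lemma levelE: assumes "x \<in> level a" obtains v z where "v \<in> V" "z \<in> K" "x = of_nat p ^ a * v + z"
  using assms unfolding level_def by (auto elim!: set_plusE)

lemma add_subgroup_level: "add_subgroup (level a)"
  unfolding level_def by (intro add_subgroup_plus add_subgroup_times_image V K)

lemma K_level: "K \<subseteq> level a"
  using levelI[OF add_subgroup_zero[OF V]] by auto

lemma level_V: "level a \<subseteq> V"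
proof
  fix x assume "x \<in> level a"
  then obtain v z where *: "v \<in> V" "z \<in> K" "x = of_nat p ^ a * v + z" by (rule levelE)
  show "x \<in> V" using add_subgroup_add[OF V add_subgroup_of_nat[OF V *(1), of "p ^ a"], of z] * K by auto
qed

lemma mem_level_iff: "of_int c * b \<in> level a \<longleftrightarrow> int p ^ a dvd c"
proof
  assume "of_int c * b \<in> level a"
  then obtain v z where *: "v \<in> V" "z \<in> K" "of_int c * b = of_nat p ^ a * v + z" by (rule levelE)
  then show "int p ^ a dvd c" by (intro indep[of v]) auto
next
  assume "int p ^ a dvd c"
  then obtain d where "c = int p ^ a * d" by (auto simp: dvd_def)
  then show "of_int c * b \<in> level a"
    using levelI[OF add_subgroup_of_int[OF V b, of d] add_subgroup_zero[OF K(1)], of a] by (simp add: mult.assoc)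
qed

lemma add_index_level: "add_index V (level a) = p ^ a"
proof -
  let ?f = "\<lambda>c::int. (+) (of_int c * b) ` level a"
  have p0: "p > 0" using prime prime_gt_0_nat by blast
  have "(\<lambda>x. (+) x ` level a) ` V = ?f ` {0..<int p ^ a}"
  proof (intro equalityI subsetI)
    fix C assume "C \<in> (\<lambda>x. (+) x ` level a) ` V"
    then obtain x where x: "x \<in> V" "C = (+) x ` level a" by auto
    obtain c y where y: "y \<in> V" "x - of_int c * b - of_nat p ^ a * y \<in> K" using decomp[OF x(1)] by blast
    define d where "d = c mod (int p ^ a)"
    have "int p ^ a dvd c - d" by (simp add: d_def)
    then have 1: "of_int (c - d) * b \<in> level a" by (simp only: mem_level_iff)
    have 2: "x - of_int c * b \<in> level a" using levelI[OF y, of a] by simp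
    have "x - of_int d * b \<in> level a" using add_subgroup_add[OF add_subgroup_level 2 1] by (simp add: algebra_simps)
    then have "C = ?f d" by (simp add: x(2) coset_eq_iff[OF add_subgroup_level])
    then show "C \<in> ?f ` {0..<int p ^ a}" using p0 by (simp add: d_def)
  qed (use add_subgroup_of_int[OF V b] in auto)
  moreover have "inj_on ?f {0..<int p ^ a}"
  proof (rule inj_onI)
    fix c d assume *: "c \<in> {0..<int p ^ a}" "d \<in> {0..<int p ^ a}" "?f c = ?f d"
    then have "of_int (c - d) * b \<in> level a"
      by (simp add: coset_eq_iff[OF add_subgroup_level] left_diff_distrib)
    then have "int p ^ a dvd c - d" by (simp only: mem_level_iff)
    then have "c mod int p ^ a = d mod int p ^ a" by (simp add: mod_eq_dvd_iff)
    then show "c = d" using * by simp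
  qed
  ultimately have "add_index V (level a) = card {0..<int p ^ a}" by (simp add: add_index_def card_image)
  then show ?thesis by (simp add: nat_power_eq)
qed

lemma level_inj: "level a = level a' \<Longrightarrow> a = a'"
  by (metis add_index_level power_inject_exp prime prime_gt_1_nat)

end

text \<open>
In the additive group of \<open>R\<close> these are the subgroups of finite index, or equivalently the
open subgroups.
\<close>

definition p_open :: "nat \<Rightarrow> 'b::comm_ring_1 set \<Rightarrow> 'b set set" where
  "p_open p V = {L. add_subgroup L \<and> L \<subseteq> V \<and> (\<exists>t. \<forall>x\<in>V. of_nat p ^ t * x \<in> L)}"

lemma p_open_Int: "L \<in> p_open p V \<Longrightarrow> add_subgroup K \<Longrightarrow> K \<subseteq> V \<Longrightarrow> L \<inter> K \<in> p_open p K"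
proof -
  assume "L \<in> p_open p V" and K: "add_subgroup K" "K \<subseteq> V"
  then obtain t where t: "\<forall>x\<in>V. of_nat p ^ t * x \<in> L" "add_subgroup L" by (auto simp: p_open_def)
  have "\<forall>x\<in>K. of_nat p ^ t * x \<in> L \<inter> K" using t K add_subgroup_of_nat[OF K(1), of _ "p ^ t"] by auto
  then show ?thesis using t K by (auto simp: p_open_def add_subgroup_Int)
qed

lemma p_open_plus: "L \<in> p_open p V \<Longrightarrow> add_subgroup V \<Longrightarrow> add_subgroup K \<Longrightarrow> K \<subseteq> V \<Longrightarrow> L + K \<in> p_open p V"
  unfolding p_open_def using subset_plus_left[of K L] add_subgroup_plus[of L K] plus_subset[of V L K] by blast

context padic_step begin

text \<open>
As in the p-adic integers, the powers of \<open>p\<close> generate all subgroups of finite index.  The exponent is the least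
\<open>a\<close> with \<open>p ^ a b \<in> L\<close>: if \<open>c b \<in> L\<close>, then \<open>L\<close> also contains
\<open>gcd c (p ^ t) b\<close>, and the gcd is a power of \<open>p\<close>.
\<close>

lemma level_of_p_open:
  assumes "L \<in> p_open p V" "K \<subseteq> L"
  shows "\<exists>a. L = level a"
proof -
  obtain t where t: "\<And>x. x \<in> V \<Longrightarrow> of_nat p ^ t * x \<in> L" and L: "add_subgroup L" "L \<subseteq> V"
    using assms by (auto simp: p_open_def)
  define a where "a = (LEAST a. of_nat p ^ a * b \<in> L)"
  have a: "of_nat p ^ a * b \<in> L" unfolding a_def by (rule LeastI[of _ t]) (rule t[OF b])
  have least: "a \<le> j" if "of_nat p ^ j * b \<in> L" for j using that by (simp add: a_def Least_le)
  have dvd: "int p ^ a dvd c" if "of_int c * b \<in> L" for c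
  proof -
    obtain u w where uw: "u * c + w * int p ^ t = gcd c (int p ^ t)" using bezout_int by blast
    have "gcd c (int p ^ t) dvd int p ^ t" by simp
    then obtain j where j: "gcd c (int p ^ t) = int p ^ j"
      using divides_primepow[of "int p" "gcd c (int p ^ t)" t] prime by (auto simp: normalize_power)
    have "of_int (int p ^ j) * b = of_int u * (of_int c * b) + of_int w * (of_nat p ^ t * b)"
      by (simp add: uw[symmetric] j[symmetric] distrib_right mult.assoc)
    also have "\<dots> \<in> L" by (intro add_subgroup_add[OF L(1)] add_subgroup_of_int[OF L(1)] that t b)
    finally have "a \<le> j" by (intro least) simp
    then show ?thesis using j by (metis gcd_dvd1 le_imp_power_dvd dvd_trans)
  qed
  have "L = level a"
  proof (intro equalityI subsetI)
    fix x assume x: "x \<in> L"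
    obtain c y where y: "y \<in> V" and z: "x - of_int c * b - of_nat p ^ t * y \<in> K" (is "?z \<in> K")
      using decomp[of x t] x L by blast
    have "of_int c * b = x - of_nat p ^ t * y - ?z" by simp
    also have "\<dots> \<in> L" 
      by (rule add_subgroup_diff[OF L(1) add_subgroup_diff[OF L(1) x t[OF y]] subsetD[OF assms(2) z]])
    finally obtain c' where c': "c = int p ^ a * c'" using dvd by (auto simp: dvd_def)
    have "a \<le> t" using least t b by blast
    then have "of_nat p ^ t = (of_nat p ^ a * of_nat p ^ (t - a) :: 'b)" by (simp flip: power_add)
    then have "x = of_nat p ^ a * (of_int c' * b + of_nat (p ^ (t - a)) * y) + ?z"
      by (simp add: c' algebra_simps)
    moreover have "of_int c' * b + of_nat (p ^ (t - a)) * y \<in> V"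
      by (intro add_subgroup_add[OF V] add_subgroup_of_int[OF V] add_subgroup_of_nat[OF V] b y)
    ultimately show "x \<in> level a" using levelI z by metis
  next
    fix x assume "x \<in> level a"
    then obtain v z where v: "v \<in> V" "z \<in> K" "x = of_nat p ^ a * v + z" by (rule levelE)
    obtain c y where y: "y \<in> V" and z: "v - of_int c * b - of_nat p ^ t * y \<in> K" (is "?z \<in> K")
      using decomp[OF v(1)] by blast
    have "x = of_int c * (of_nat p ^ a * b) + of_nat p ^ t * (of_nat (p ^ a) * y) + of_nat (p ^ a) * ?z + z"
      by (simp add: v(3) algebra_simps)
    also have "\<dots> \<in> L" using z v(2) assms(2)
      by (intro add_subgroup_add[OF L(1)] add_subgroup_of_int[OF L(1) a] t add_subgroup_of_nat[OF V y] add_subgroup_of_nat[OF L(1)]) auto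
    finally show "x \<in> L" .
  qed
  then show ?thesis ..
qed

text \<open>
The image of \<open>L\<close> in \<open>V / K\<close> is generated by \<open>p ^ a b\<close> over the p-adic integers, and any lift of this generator to \<open>L\<close> will do.
\<close>

lemma step_sub:
  assumes L: "add_subgroup L" "L + K = level a" and b': "b' \<in> L" "b' - of_nat p ^ a * b \<in> K"
  shows "padic_step p L (L \<inter> K) b'"
proof
  have LV: "L \<subseteq> V" using subset_plus_left[OF K(1), of L] L level_V by auto
  show "Factorial_Ring.prime p" "add_subgroup L" "add_subgroup (L \<inter> K)" "L \<inter> K \<subseteq> L" "b' \<in> L"
    using prime L K b' by (auto intro: add_subgroup_Int)
  fix x assume x: "x \<in> L"
  show "\<exists>c. \<exists>y\<in>L. x - of_int c * b' - of_nat p * y \<in> L \<inter> K"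
  proof -
    have "x \<in> level a" using x subset_plus_left[OF K(1), of L] L by auto
    then obtain v z where v: "v \<in> V" "z \<in> K" "x = of_nat p ^ a * v + z" by (rule levelE)
    obtain c y where y: "y \<in> V" and z: "v - of_int c * b - of_nat p * y \<in> K" (is "?z \<in> K")
      using decomp1[OF v(1)] by blast
    have "of_nat p ^ a * y \<in> L + K" using levelI[OF y add_subgroup_zero[OF K(1)], of a] L by simp
    then obtain l z'' where l: "l \<in> L" "z'' \<in> K" "of_nat p ^ a * y = l + z''" by (rule set_plusE)
    define z3 b0 where "z3 = ?z" and "b0 = b' - of_nat p ^ a * b"
    have "x - of_int c * b' - of_nat p * l
       = of_nat (p ^ a) * z3 + of_nat p * z'' + z - of_int c * b0
         + of_nat p * (of_nat p ^ a * y - (l + z''))"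
      by (simp add: v(3) z3_def b0_def algebra_simps)
    also have "of_nat p * (of_nat p ^ a * y - (l + z'')) = 0" using l(3) by simp
    also have "of_nat (p ^ a) * z3 + of_nat p * z'' + z - of_int c * b0 + 0 \<in> K"
      using z l(2) v(2) b'(2) unfolding z3_def[symmetric] b0_def[symmetric]
      by (intro add_subgroup_add[OF K(1)] add_subgroup_diff[OF K(1)] add_subgroup_of_nat[OF K(1)] add_subgroup_of_int[OF K(1)] add_subgroup_zero[OF K(1)])
    finally have "x - of_int c * b' - of_nat p * l \<in> K" .
    moreover have "x - of_int c * b' - of_nat p * l \<in> L"
      using x b' l by (intro add_subgroup_diff[OF L(1)] add_subgroup_of_nat[OF L(1)] add_subgroup_of_int[OF L(1)])
    ultimately show ?thesis using l(1) by blast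
  qed
  show "x \<in> L \<inter> K" if "of_nat p * x \<in> L \<inter> K" using pure1 x LV that by blast
  show "b' - of_nat p * x \<notin> L \<inter> K"
  proof
    assume "b' - of_nat p * x \<in> L \<inter> K"
    then have 1: "b' - of_nat p * x \<in> K" by simp
    have "x \<in> level a" using x subset_plus_left[OF K(1), of L] L by auto
    then obtain v z where v: "v \<in> V" "z \<in> K" "x = of_nat p ^ a * v + z" by (rule levelE)
    have "of_nat p ^ a * (b - of_nat p * v) = (b' - of_nat p * x) - (b' - of_nat p ^ a * b) + of_nat p * z"
      by (simp add: v(3) algebra_simps)
    also have "\<dots> \<in> K" by (rule add_subgroup_add[OF K(1) add_subgroup_diff[OF K(1) 1 b'(2)] add_subgroup_of_nat[OF K(1) v(2)]])
    finally have "b - of_nat p * v \<in> K"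
      using pure[of "b - of_nat p * v" a] add_subgroup_diff[OF V b add_subgroup_of_nat[OF V v(1)]] by blast
    then show False using indep1 v by blast
  qed
qed

lemma step_level: "padic_step p (level a) K (of_nat p ^ a * b)"
proof -
  have "level a + K = level a"
    using plus_subset[OF add_subgroup_level subset_refl K_level] subset_plus_left[OF K(1)] by blast
  moreover have "level a \<inter> K = K" using K_level by auto
  moreover have "of_nat p ^ a * b \<in> level a" using levelI[OF b add_subgroup_zero[OF K(1)]] by simp
  ultimately show ?thesis using step_sub[OF add_subgroup_level, of a a "of_nat p ^ a * b"] add_subgroup_zero[OF K(1)] by simp
qed

text \<open>
The group \<open>level a / K\<close> is generated by one element, so \<open>card_relative_complements\<close> applies with a basis
of size one.
\<close>

lemma card_step_fibre:
  assumes M: "M \<in> p_open p K"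
  shows "card {N. add_subgroup N \<and> N + K = level a \<and> N \<inter> K = M} = add_index K M"
proof -
  interpret L: padic_step p "level a" K "of_nat p ^ a * b" by (rule step_level)
  obtain t where t: "\<And>x. x \<in> K \<Longrightarrow> of_nat p ^ t * x \<in> M" using M by (auto simp: p_open_def)
  have "card {N. add_subgroup N \<and> N + K = level a \<and> N \<inter> K = M} = add_index K M ^ card {()}"
  proof (rule card_relative_complements[where q = "int p ^ t" and b = "\<lambda>_. of_nat p ^ a * b"])
    show "add_subgroup M" "M \<subseteq> K" using M by (auto simp: p_open_def)
    fix x assume "x \<in> level a"
    then obtain c y where "y \<in> level a" "x - of_int c * (of_nat p ^ a * b) - of_nat p ^ t * y \<in> K"
      using L.decomp by blast
    then show "\<exists>c. \<exists>y\<in>level a. x - (\<Sum>i\<in>{()}. of_int (c i) * (of_nat p ^ a * b)) - of_int (int p ^ t) * y \<in> K"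
      by (intro exI[of _ "\<lambda>_. c"] bexI[of _ y]) simp_all
  next
    fix y assume "y \<in> level a" "of_int (int p ^ t) * y \<in> K"
    then have "y \<in> K" using L.pure[of y t] by simp
    then show "of_int (int p ^ t) * y \<in> M" using t by simp
  qed (use t K_level L.b L.indep in \<open>auto simp: add_subgroup_level K\<close>)
  then show ?thesis by simp
qed

end

text \<open>
A group that is an iterated extension of \<open>d\<close> p-adic lines.  It plays the role of a free module of rank
\<open>d\<close> over the p-adic integers, but the inductive form passes to p-open subgroups and to products
without any choice of a basis.
\<close>

inductive padic_free :: "nat \<Rightarrow> 'b::comm_ring_1 set \<Rightarrow> nat \<Rightarrow> bool" for p where
  padic_free_0: "padic_free p {0} 0"
| padic_free_Suc: "padic_step p V K b \<Longrightarrow> padic_free p K d \<Longrightarrow> padic_free p V (Suc d)"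

lemma padic_free_add_subgroup: "padic_free p V d \<Longrightarrow> add_subgroup V"
  by (induction rule: padic_free.induct) (auto simp: add_subgroup_singleton padic_step.V)

text \<open>
By \<open>step_sub\<close> the filtration of \<open>V\<close> restricts to \<open>L\<close>.  This replaces the theorem that a submodule of full rank in a free
module over the p-adic integers is free of the same rank.
\<close>

lemma padic_free_p_open: "padic_free p V d \<Longrightarrow> L \<in> p_open p V \<Longrightarrow> padic_free p L d"
proof (induction arbitrary: L rule: padic_free.induct)
  case padic_free_0
  then have "L = {0}" using add_subgroup_zero by (auto simp: p_open_def)
  then show ?case by (simp add: padic_free.padic_free_0)
next
  case (padic_free_Suc V K b d)
  interpret padic_step p V K b by fact
  have L: "add_subgroup L" using padic_free_Suc.prems by (simp add: p_open_def)
  obtain a where a: "L + K = level a"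
    using level_of_p_open[OF p_open_plus[OF padic_free_Suc.prems V K] subset_plus_right[OF L]] by blast
  have "of_nat p ^ a * b \<in> L + K" using levelI[OF b add_subgroup_zero[OF K(1)], of a] a by simp
  then obtain b' z where b': "b' \<in> L" "z \<in> K" "of_nat p ^ a * b = b' + z" by (rule set_plusE)
  have "b' - of_nat p ^ a * b \<in> K" using add_subgroup_minus[OF K(1) b'(2)] b'(3) by simp
  then have "padic_step p L (L \<inter> K) b'" by (intro step_sub[OF L a b'(1)])
  moreover have "padic_free p (L \<inter> K) d" by (intro padic_free_Suc.IH p_open_Int[OF padic_free_Suc.prems K])
  ultimately show ?case by (rule padic_free.padic_free_Suc)
qed

lemma padic_free_add_index_pow: "padic_free p V d \<Longrightarrow> L \<in> p_open p V \<Longrightarrow> \<exists>m. add_index V L = p ^ m"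
proof (induction arbitrary: L rule: padic_free.induct)
  case padic_free_0
  then have "L = {0}" using add_subgroup_zero by (auto simp: p_open_def)
  then show ?case by (intro exI[of _ 0]) (simp add: add_index_self add_subgroup_singleton)
next
  case (padic_free_Suc V K b d)
  interpret padic_step p V K b by fact
  have L: "add_subgroup L" "L \<subseteq> V" using padic_free_Suc.prems by (simp_all add: p_open_def)
  obtain a where a: "L + K = level a"
    using level_of_p_open[OF p_open_plus[OF padic_free_Suc.prems V K] subset_plus_right[OF L(1)]] by blast
  obtain m where m: "add_index K (L \<inter> K) = p ^ m"
    using padic_free_Suc.IH p_open_Int[OF padic_free_Suc.prems K] by blast
  have "add_index V L = add_index V (L + K) * add_index (L + K) L"
    using L K V by (intro add_index_mult add_subgroup_plus subset_plus_left plus_subset)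
  also have "\<dots> = p ^ (a + m)" by (simp add: a add_index_level power_add add_index_plus[OF L(1) K(1), unfolded a] m)
  finally show ?case ..
qed

lemma padic_free_add_index_p: "padic_free p V d \<Longrightarrow> add_index V ((*) (of_nat p) ` V) = p ^ d"
proof (induction rule: padic_free.induct)
  case padic_free_0
  then show ?case by (simp add: add_index_self add_subgroup_singleton)
next
  case (padic_free_Suc V K b d)
  interpret padic_step p V K b by fact
  let ?L = "(*) (of_nat p) ` V"
  have L: "add_subgroup ?L" "?L \<subseteq> V" using add_subgroup_times_image[OF V] add_subgroup_of_nat[OF V] by auto
  have a: "?L + K = level 1" by (simp add: level_def)
  have m: "?L \<inter> K = (*) (of_nat p) ` K" using pure1 K add_subgroup_of_nat[OF K(1)] by blast
  have "add_index V ?L = add_index V (?L + K) * add_index (?L + K) ?L"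
    using L K V by (intro add_index_mult add_subgroup_plus subset_plus_left plus_subset)
  also have "\<dots> = p ^ Suc d" by (simp only: a add_index_level add_index_plus[OF L(1) K(1), unfolded a] m padic_free_Suc.IH) simp
  finally show ?case .
qed

text \<open>
A basis modulo every power of \<open>p\<close>.  The integral span of \<open>b\<close> need not be all of \<open>V\<close>; it is only dense for
the p-adic topology.
\<close>

definition padic_basis :: "nat \<Rightarrow> 'b::comm_ring_1 set \<Rightarrow> nat \<Rightarrow> (nat \<Rightarrow> 'b) \<Rightarrow> bool" where
  "padic_basis p V d b \<longleftrightarrow> (\<forall>i<d. b i \<in> V) \<and>
    (\<forall>k. \<forall>x\<in>V. \<exists>c. \<exists>y\<in>V. x = (\<Sum>i<d. of_int (c i) * b i) + of_nat p ^ k * y) \<and>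
    (\<forall>k c. \<forall>y\<in>V. (\<Sum>i<d. of_int (c i) * b i) = of_nat p ^ k * y \<longrightarrow> (\<forall>i<d. int p ^ k dvd c i)) \<and>
    (\<forall>k. \<forall>y\<in>V. of_nat p ^ k * y = 0 \<longrightarrow> y = 0)"

lemma padic_free_basis:
  assumes "padic_free p V d"
  shows "\<exists>b. padic_basis p V d b"
  using assms
proof (induction rule: padic_free.induct)
  case padic_free_0
  then show ?case by (simp add: padic_basis_def)
next
  case (padic_free_Suc V K e d)
  interpret padic_step p V K e by fact
  obtain b where B: "padic_basis p K d b" using padic_free_Suc.IH by blast
  have b0: "\<And>i. i < d \<Longrightarrow> b i \<in> K"
    using B by (simp add: padic_basis_def)
  have gen: "\<And>k x. x \<in> K \<Longrightarrow> \<exists>c. \<exists>y\<in>K. x = (\<Sum>i<d. of_int (c i) * b i) + of_nat p ^ k * y"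
    using B by (simp add: padic_basis_def)
  have "\<forall>k c. \<forall>y\<in>K. (\<Sum>i<d. of_int (c i) * b i) = of_nat p ^ k * y \<longrightarrow> (\<forall>i<d. int p ^ k dvd c i)"
    using B unfolding padic_basis_def by (elim conjE)
  then have ind: "\<And>k c y. y \<in> K \<Longrightarrow> (\<Sum>i<d. of_int (c i) * b i) = of_nat p ^ k * y \<Longrightarrow> \<forall>i<d. int p ^ k dvd c i"
    by fast
  have tf: "\<And>k y. y \<in> K \<Longrightarrow> of_nat p ^ k * y = 0 \<Longrightarrow> y = 0"
    using B unfolding padic_basis_def by blast
  define b' where "b' = b(d := e)"
  have sum: "(\<Sum>i<Suc d. of_int (c i) * b' i) = (\<Sum>i<d. of_int (c i) * b i) + of_int (c d) * e" for c
    by (simp add: b'_def)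
  have sumK: "(\<Sum>i<d. of_int (c i) * b i) \<in> K" for c
    by (intro add_subgroup_sum[OF K(1)] add_subgroup_of_int[OF K(1)] b0) auto
  show ?case unfolding padic_basis_def
  proof (intro exI[of _ b'] conjI allI ballI impI)
    show "b' i \<in> V" if "i < Suc d" for i using that b0[of i] b K by (auto simp: b'_def)
  next
    fix k x assume "x \<in> V"
    then obtain c y where y: "y \<in> V" and z: "x - of_int c * e - of_nat p ^ k * y \<in> K" (is "?z \<in> K")
      using decomp by blast
    obtain c' y' where y': "y' \<in> K" "?z = (\<Sum>i<d. of_int (c' i) * b i) + of_nat p ^ k * y'" using gen[OF z] by blast
    have "(\<Sum>i<d. of_int ((c'(d := c)) i) * b i) = (\<Sum>i<d. of_int (c' i) * b i)" by (rule sum.cong) auto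
    then have "x = (\<Sum>i<Suc d. of_int ((c'(d := c)) i) * b' i) + of_nat p ^ k * (y + y')"
      unfolding sum using y'(2) by (simp add: algebra_simps)
    then show "\<exists>c. \<exists>y\<in>V. x = (\<Sum>i<Suc d. of_int (c i) * b' i) + of_nat p ^ k * y"
      using add_subgroup_add[OF V y] y' K by blast
  next
    fix k c y i assume y: "y \<in> V" and eq: "(\<Sum>i<Suc d. of_int (c i) * b' i) = of_nat p ^ k * y" and i: "i < Suc d"
    have "of_int (c d) * e - of_nat p ^ k * y = - (\<Sum>i<d. of_int (c i) * b i)"
      using eq unfolding sum by (simp add: algebra_simps)
    also have "\<dots> \<in> K" by (intro add_subgroup_minus[OF K(1)] sumK)
    finally have d: "int p ^ k dvd c d" using indep[OF y] by blast
    then obtain c' where c': "c d = int p ^ k * c'" by (auto simp: dvd_def)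
    have eq2: "(\<Sum>i<d. of_int (c i) * b i) = of_nat p ^ k * (y - of_int c' * e)"
      using eq unfolding sum by (simp add: c' algebra_simps)
    have "y - of_int c' * e \<in> K"
      using pure[of "y - of_int c' * e" k] eq2 sumK[of c] add_subgroup_diff[OF V y add_subgroup_of_int[OF V b]] by simp
    from ind[OF this eq2] show "int p ^ k dvd c i" using d i by (cases "i = d") auto
  next
    fix k y assume "y \<in> V" "of_nat p ^ k * y = 0"
    then show "y = 0" using pure[of y k] tf add_subgroup_zero[OF K(1)] by simp
  qed
qed

text \<open>
The componentwise ring structure serves to write integral multiples in products as multiplications by
\<open>of_nat\<close> and \<open>of_int\<close>.
\<close>

instantiation prod :: (comm_ring_1, comm_ring_1) comm_ring_1
begin

definition "x * y = (fst x * fst y, snd x * snd y)"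
definition "1 = (1, 1)"

instance
  by standard (auto simp: times_prod_def one_prod_def zero_prod_def algebra_simps split: prod.splits)

end

lemma of_nat_prod: "of_nat k = (of_nat k, of_nat k)"
  by (induction k) (auto simp: zero_prod_def one_prod_def)

lemma of_int_prod: "of_int k = (of_int k, of_int k)"
  by (cases k) (auto simp: of_nat_prod one_prod_def)

lemma padic_free_Times:
  fixes A :: "'b::comm_ring_1 set" and B :: "'c::comm_ring_1 set"
  assumes "padic_free p A d" "padic_free p B e"
  shows "padic_free p (A \<times> B) (d + e)"
  using assms(1)
proof (induction rule: padic_free.induct)
  case padic_free_0
  show ?case using assms(2)
  proof (induction rule: padic_free.induct)
    case padic_free_0
    show ?case using padic_free.padic_free_0[where 'b = "'b \<times> 'c"] by (simp add: zero_prod_def)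
  next
    case (padic_free_Suc V K b d)
    interpret padic_step p V K b by fact
    have "padic_step p ({0::'b} \<times> V) ({0} \<times> K) (0, b)"
      using prime V K b decomp1 pure1 indep1
      by unfold_locales (auto simp: add_subgroup_Times add_subgroup_singleton times_prod_def of_nat_prod of_int_prod)
    then show ?case using padic_free.padic_free_Suc padic_free_Suc.IH by fastforce
  qed
next
  case (padic_free_Suc V K b d)
  interpret padic_step p V K b by fact
  have B: "add_subgroup B" using assms(2) by (rule padic_free_add_subgroup)
  have "\<exists>c. \<exists>y\<in>V \<times> B. x - of_int c * (b, 0) - of_nat p * y \<in> K \<times> B" if x: "x \<in> V \<times> B" for x
  proof -
    obtain u v where uv: "x = (u, v)" "u \<in> V" "v \<in> B" using x by auto
    obtain c y where "y \<in> V" "u - of_int c * b - of_nat p * y \<in> K" using decomp1[OF uv(2)] by blast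
    then show ?thesis using uv add_subgroup_zero[OF B]
      by (intro exI[of _ c] bexI[of _ "(y, 0)"]) (auto simp: times_prod_def of_nat_prod of_int_prod)
  qed
  then have "padic_step p (V \<times> B) (K \<times> B) (b, 0)"
    using prime V K b pure1 indep1 B add_subgroup_zero[OF B] add_subgroup_minus[OF B add_subgroup_of_nat[OF B]]
    by unfold_locales (auto simp: add_subgroup_Times times_prod_def of_nat_prod)
  then show ?case using padic_free.padic_free_Suc padic_free_Suc.IH by fastforce
qed

section \<open>Regrouping unconditionally convergent sums\<close>

text \<open>
Summability over the dependent sum follows from the absolute summability of the iterated sum, since summable families
of complex numbers are absolutely summable.
\<close>

lemma has_sum_Sigma_complexI:
  fixes F :: "'x \<times> 'y \<Rightarrow> complex"
  assumes 1: "\<And>x. x \<in> A \<Longrightarrow> ((\<lambda>y. F (x, y)) has_sum g x) (B x)"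
    and 2: "(g has_sum S) A"
    and 3: "(\<lambda>x. \<Sum>\<^sub>\<infinity>y\<in>B x. norm (F (x, y))) summable_on A"
  shows "(F has_sum S) (Sigma A B)"
proof (rule has_sum_SigmaI[OF 1 2])
  have "(\<lambda>y. norm (F (x, y))) summable_on B x" if "x \<in> A" for x
    using 1[OF that] by (auto simp flip: summable_on_iff_abs_summable_on_complex intro: has_sum_imp_summable)
  then have "(\<lambda>z. norm (F z)) summable_on Sigma A B"
    using 3 by (subst Infinite_Sum.abs_summable_on_Sigma_iff) (auto simp: infsum_nonneg)
  then show "F summable_on Sigma A B" by (rule abs_summable_summable)
qed

lemma has_sum_product_complex:
  fixes f g :: "_ \<Rightarrow> complex"
  assumes "(f has_sum a) A" "(g has_sum b) B"
  shows "((\<lambda>(x, y). f x * g y) has_sum a * b) (A \<times> B)"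
proof (rule has_sum_Sigma_complexI[where g = "\<lambda>x. f x * b"])
  show "((\<lambda>y. case (x, y) of (x, y) \<Rightarrow> f x * g y) has_sum f x * b) B" for x
    using has_sum_cmult_right[OF assms(2), of "f x"] by simp
  show "((\<lambda>x. f x * b) has_sum a * b) A" using has_sum_cmult_left[OF assms(1), of b] by simp
  have "(\<lambda>x. norm (f x)) summable_on A"
    using assms(1) by (auto simp flip: summable_on_iff_abs_summable_on_complex intro: has_sum_imp_summable)
  then show "(\<lambda>x. \<Sum>\<^sub>\<infinity>y\<in>B. norm (case (x, y) of (x, y) \<Rightarrow> f x * g y)) summable_on A"
    by (simp add: norm_mult infsum_cmult_right' summable_on_cmult_left)
qed

text \<open>
Every count below enters the sums through this lemma: a summand that depends only on \<open>h x\<close> is summed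
over the values of \<open>h\<close>, weighted by the sizes of the fibres.
\<close>

lemma has_sum_fibres:
  fixes g :: "'y \<Rightarrow> complex"
  assumes h: "\<And>x. x \<in> A \<Longrightarrow> h x \<in> B"
    and fin: "\<And>y. y \<in> B \<Longrightarrow> finite {x \<in> A. h x = y}"
  shows "((\<lambda>x. g (h x)) has_sum S) A \<longleftrightarrow> ((\<lambda>y. of_nat (card {x \<in> A. h x = y}) * g y) has_sum S) B"
proof -
  let ?F = "\<lambda>y. {x \<in> A. h x = y}"
  have "((\<lambda>x. g (h x)) has_sum S) A \<longleftrightarrow> ((\<lambda>(y, x). g y) has_sum S) (Sigma B ?F)"
    by (rule has_sum_reindex_bij_witness[of _ snd "\<lambda>x. (h x, x)"]) (auto simp: h)
  also have "\<dots> \<longleftrightarrow> ((\<lambda>y. of_nat (card (?F y)) * g y) has_sum S) B"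
  proof
    assume "((\<lambda>(y, x). g y) has_sum S) (Sigma B ?F)"
    then show "((\<lambda>y. of_nat (card (?F y)) * g y) has_sum S) B"
      by (rule has_sum_SigmaD) (auto intro!: has_sum_finiteI fin)
  next
    assume *: "((\<lambda>y. of_nat (card (?F y)) * g y) has_sum S) B"
    show "((\<lambda>(y, x). g y) has_sum S) (Sigma B ?F)"
    proof (rule has_sum_Sigma_complexI[OF _ *])
      show "((\<lambda>x. case (y, x) of (y, x) \<Rightarrow> g y) has_sum of_nat (card (?F y)) * g y) (?F y)" if "y \<in> B" for y
        using fin[OF that] by (auto intro!: has_sum_finiteI)
      have "(\<lambda>y. norm (of_nat (card (?F y)) * g y)) summable_on B"
        using * by (simp only: summable_on_iff_abs_summable_on_complex[symmetric] has_sum_imp_summable)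
      also have "?this \<longleftrightarrow> (\<lambda>y. \<Sum>\<^sub>\<infinity>x\<in>?F y. norm (case (y, x) of (y, x) \<Rightarrow> g y)) summable_on B"
        by (rule summable_on_cong) (simp add: fin norm_mult)
      finally show "(\<lambda>y. \<Sum>\<^sub>\<infinity>x\<in>?F y. norm (case (y, x) of (y, x) \<Rightarrow> g y)) summable_on B" .
    qed
  qed
  finally show ?thesis .
qed

lemma has_sum_imp_finite_fibre:
  fixes f :: "'x \<Rightarrow> complex"
  assumes "(f has_sum S) A" "F \<subseteq> A" "\<And>x. x \<in> F \<Longrightarrow> f x = c" "c \<noteq> 0"
  shows "finite F"
proof -
  have "f summable_on F" using assms has_sum_imp_summable summable_on_subset_banach by blast
  then have "(\<lambda>_. c) summable_on F" using assms(3) by (simp cong: summable_on_cong)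
  then have "(\<lambda>_. norm c) summable_on F" by (simp only: summable_on_iff_abs_summable_on_complex)
  then show ?thesis using infsum_diverge_constant[of F "norm c"] assms(4) by auto
qed

lemma has_sum_geometric_complex:
  fixes z :: complex
  assumes "norm z < 1"
  shows "((\<lambda>k. z ^ k) has_sum inverse (1 - z)) UNIV"
proof (rule norm_summable_imp_has_sum)
  show "summable (\<lambda>k. norm (z ^ k))" using assms by (simp add: norm_power summable_geometric)
  show "(\<lambda>k. z ^ k) sums inverse (1 - z)" using geometric_sums[OF assms] by (simp add: inverse_eq_divide)
qed

lemma has_sum_prod_geometric:
  fixes z :: "'i \<Rightarrow> complex"
  assumes "finite I" "\<And>i. i \<in> I \<Longrightarrow> norm (z i) < 1"
  shows "((\<lambda>k. \<Prod>i\<in>I. z i ^ k i) has_sum (\<Prod>i\<in>I. inverse (1 - z i))) (I \<rightarrow>\<^sub>E UNIV)"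
  using assms
proof (induction I rule: finite_induct)
  case empty
  then show ?case by (auto intro!: has_sum_finiteI)
next
  case (insert i I)
  have "((\<lambda>(a, k). z i ^ a * (\<Prod>i\<in>I. z i ^ k i)) has_sum inverse (1 - z i) * (\<Prod>i\<in>I. inverse (1 - z i)))
      (UNIV \<times> (I \<rightarrow>\<^sub>E UNIV))"
    using insert by (intro has_sum_product_complex has_sum_geometric_complex insert.IH) auto
  also have "?this \<longleftrightarrow> ((\<lambda>k. \<Prod>i\<in>insert i I. z i ^ k i) has_sum (\<Prod>i\<in>insert i I. inverse (1 - z i)))
      (insert i I \<rightarrow>\<^sub>E UNIV)"
  proof (rule has_sum_reindex_bij_witness[of _ "\<lambda>k. (k i, k(i := undefined))" "\<lambda>(a, k). k(i := a)"])
    fix x :: "nat \<times> ('i \<Rightarrow> nat)" assume x: "x \<in> UNIV \<times> (I \<rightarrow>\<^sub>E UNIV)"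
    have "(\<Prod>j\<in>I. z j ^ ((snd x)(i := fst x)) j) = (\<Prod>j\<in>I. z j ^ snd x j)"
      using insert.hyps by (intro prod.cong) auto
    then show "(\<Prod>j\<in>insert i I. z j ^ (case x of (a, k) \<Rightarrow> k(i := a)) j) = (case x of (a, k) \<Rightarrow> z i ^ a * (\<Prod>i\<in>I. z i ^ k i))"
      using insert.hyps by (simp add: case_prod_unfold)
  qed (use insert.hyps in \<open>auto simp: PiE_def extensional_def\<close>)
  finally show ?case .
qed

section \<open>The zeta function of a p-adic lattice\<close>

lemma of_nat_mult_powr: "of_nat (a * b) powr (s::complex) = of_nat a powr s * of_nat b powr s"
  by (simp add: powr_times_real)

lemma of_nat_power_powr: "of_nat (a ^ k) powr (s::complex) = (of_nat a powr s) ^ k"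
  by (induction k) (simp_all only: power.simps of_nat_mult_powr powr_one_eq_one of_nat_1)

lemma norm_of_nat_powr: "p > 0 \<Longrightarrow> norm (of_nat p powr (s::complex)) = real p powr Re s"
  using norm_powr_real_powr[of "of_nat p" s] by simp

lemma norm_of_nat_powr_less_1: "p > 1 \<Longrightarrow> Re s < 0 \<Longrightarrow> norm (of_nat p powr (s::complex)) < 1"
  by (simp add: norm_of_nat_powr powr_less_one)

text \<open>
A p-open subgroup \<open>L\<close> of \<open>V\<close> has an image \<open>level a / K\<close> of index \<open>p ^ a\<close> and an intersection
\<open>M = L \<inter> K\<close>, and by \<open>card_step_fibre\<close> each pair \<open>(a, M)\<close> occurs \<open>[K : M]\<close> times.  The additional factor
\<open>[K : M]\<close> shifts \<open>s\<close> by one, so the zeta function of \<open>V\<close> at \<open>s\<close> is a geometric series times the zeta function of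
\<open>K\<close> at \<open>s - 1\<close>.
\<close>

theorem zeta_padic_free:
  fixes V :: "'b::comm_ring_1 set"
  assumes "padic_free p V d" "Factorial_Ring.prime p" "Re s \<ge> real d"
  shows "((\<lambda>L. of_nat (add_index V L) powr (- s)) has_sum (\<Prod>i<d. inverse (1 - of_nat p powr (of_nat i - s))))
    (p_open p V)"
  using assms(1,3)
proof (induction arbitrary: s rule: padic_free.induct)
  case padic_free_0
  have "p_open p {0} = {{0::'b}}" using add_subgroup_zero add_subgroup_singleton by (auto simp: p_open_def)
  then show ?case by (simp add: add_index_self add_subgroup_singleton has_sum_finite_iff)
next
  case (padic_free_Suc V K b d)
  interpret padic_step p V K b by fact
  have p1: "p > 1" using prime by (rule prime_gt_1_nat)
  define lev where "lev L = (SOME a. L + K = level a)" for L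
  have lev: "L + K = level (lev L)" if "L \<in> p_open p V" for L
  proof -
    have "add_subgroup L" using that by (simp add: p_open_def)
    then have "\<exists>a. L + K = level a"
      by (intro level_of_p_open p_open_plus[OF that V K] subset_plus_right)
    then show ?thesis unfolding lev_def by (rule someI_ex)
  qed
  define h where "h L = (lev L, L \<inter> K)" for L
  have fib: "{L \<in> p_open p V. h L = (a, M)} = {N. add_subgroup N \<and> N + K = level a \<and> N \<inter> K = M}"
    if M: "M \<in> p_open p K" for a M
  proof (intro equalityI subsetI)
    fix L assume "L \<in> {L \<in> p_open p V. h L = (a, M)}"
    then show "L \<in> {N. add_subgroup N \<and> N + K = level a \<and> N \<inter> K = M}"
      using lev by (auto simp: h_def p_open_def)
  next
    fix N assume N: "N \<in> {N. add_subgroup N \<and> N + K = level a \<and> N \<inter> K = M}"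
    have NV: "N \<subseteq> V" using N subset_plus_left[OF K(1), of N] level_V by auto
    obtain t where t: "\<And>x. x \<in> K \<Longrightarrow> of_nat p ^ t * x \<in> M" using M by (auto simp: p_open_def)
    have "of_nat p ^ (t + a) * x \<in> N" if x: "x \<in> V" for x
    proof -
      have "of_nat p ^ a * x \<in> N + K" using levelI[OF x add_subgroup_zero[OF K(1)], of a] N by simp
      then obtain u z where u: "u \<in> N" "z \<in> K" "of_nat p ^ a * x = u + z" by (rule set_plusE)
      have "of_nat p ^ (t + a) * x = of_nat (p ^ t) * u + of_nat p ^ t * z"
        using u(3) by (simp add: power_add mult.assoc distrib_left)
      also have "\<dots> \<in> N" using N t[OF u(2)] u(1) by (intro add_subgroup_add add_subgroup_of_nat) auto
      finally show ?thesis .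
    qed
    then have "N \<in> p_open p V" using N NV by (auto simp: p_open_def)
    moreover from lev[OF this] have "lev N = a" using N level_inj by auto
    ultimately show "N \<in> {L \<in> p_open p V. h L = (a, M)}" using N by (simp add: h_def)
  qed
  have card_fib: "card {L \<in> p_open p V. h L = y} = add_index K (snd y)" if "y \<in> UNIV \<times> p_open p K" for y
    using that fib[of "snd y" "fst y"] card_step_fibre[of "snd y" "fst y"] by auto
  have add_index_pos: "add_index K M > 0" if "M \<in> p_open p K" for M
    using padic_free_add_index_pow[OF padic_free_Suc.hyps(2) that] p1 by auto
  have add_index: "add_index V L = p ^ fst (h L) * add_index K (snd (h L))" if L: "L \<in> p_open p V" for L
  proof -
    have aL: "add_subgroup L" "L \<subseteq> V" using L by (simp_all add: p_open_def)
    have "add_index V L = add_index V (L + K) * add_index (L + K) L"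
      using aL K V by (intro add_index_mult add_subgroup_plus subset_plus_left plus_subset)
    then show ?thesis using add_index_plus[OF aL(1) K(1)] by (simp add: h_def lev[OF L] add_index_level)
  qed
  define g where "g y = of_nat (p ^ fst y * add_index K (snd y)) powr (- s)" for y :: "nat \<times> 'b set"
  let ?B = "(UNIV :: nat set) \<times> p_open p K"
  have "((\<lambda>(a, M). (of_nat p powr (- s)) ^ a * of_nat (add_index K M) powr (- (s - 1))) has_sum
     inverse (1 - of_nat p powr (- s)) * (\<Prod>i<d. inverse (1 - of_nat p powr (of_nat i - (s - 1))))) ?B"
    using padic_free_Suc.prems
    by (intro has_sum_product_complex has_sum_geometric_complex norm_of_nat_powr_less_1 p1 padic_free_Suc.IH) auto
  also have "inverse (1 - of_nat p powr (- s)) * (\<Prod>i<d. inverse (1 - of_nat p powr (of_nat i - (s - 1))))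
     = (\<Prod>i<Suc d. inverse (1 - of_nat p powr (of_nat i - s)))" (is "_ = ?Z")
    unfolding prod.lessThan_Suc_shift by (simp add: algebra_simps)
  finally have "((\<lambda>(a, M). (of_nat p powr (- s)) ^ a * of_nat (add_index K M) powr (- (s - 1))) has_sum ?Z) ?B" .
  also have "?this \<longleftrightarrow> ((\<lambda>y. of_nat (card {L \<in> p_open p V. h L = y}) * g y) has_sum ?Z) ?B"
  proof (rule has_sum_cong)
    fix y assume y: "y \<in> ?B"
    obtain a M where [simp]: "y = (a, M)" by (cases y)
    have "of_nat (add_index K M) powr (- (s - 1)) = of_nat (add_index K M) * of_nat (add_index K M) powr (- s)"
      using powr_add[of "of_nat (add_index K M)" 1 "- s"] add_index_pos[of M] y by (simp add: powr_to_1)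
    then show "(case y of (a, M) \<Rightarrow> (of_nat p powr (- s)) ^ a * of_nat (add_index K M) powr (- (s - 1)))
       = of_nat (card {L \<in> p_open p V. h L = y}) * g y"
      using card_fib[OF y] by (simp add: g_def of_nat_mult_powr of_nat_power_powr del: of_nat_mult of_nat_power)
  qed
  also have "\<dots> \<longleftrightarrow> ((\<lambda>L. g (h L)) has_sum ?Z) (p_open p V)"
  proof (rule has_sum_fibres[symmetric])
    show "h L \<in> ?B" if "L \<in> p_open p V" for L using p_open_Int[OF that K] by (simp add: h_def)
    show "finite {L \<in> p_open p V. h L = y}" if "y \<in> ?B" for y
      using card_fib[OF that] add_index_pos that by (metis card_gt_0_iff mem_Times_iff)
  qed
  also have "\<dots> \<longleftrightarrow> ((\<lambda>L. of_nat (add_index V L) powr (- s)) has_sum ?Z) (p_open p V)"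
    by (rule has_sum_cong) (simp add: g_def add_index)
  finally show ?case .
qed

section \<open>Gap sets of lattices in a totally ramified ring\<close>

text \<open>
If \<open>G\<close> is the set of gaps of \<open>M\<close>, these are the least valuations of elements of \<open>M\<close> in each
residue class modulo \<open>n\<close>; adding multiples of \<open>n\<close> (multiplication by \<open>p\<close>) yields all other valuations.
\<close>

definition generators :: "nat \<Rightarrow> nat set \<Rightarrow> nat set" where
  "generators n G = {h. h \<notin> G \<and> (h < n \<or> h - n \<in> G)}"

definition conductor :: "nat set \<Rightarrow> nat" where
  "conductor G = (LEAST k. \<forall>g\<in>G. g < k)"

lemma conductor_le_iff: "finite G \<Longrightarrow> conductor G \<le> k \<longleftrightarrow> (\<forall>g\<in>G. g < k)"
proof
  assume "finite G"
  then obtain k where "\<forall>g\<in>G. g < k" using finite_nat_set_iff_bounded by blast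
  then have *: "\<forall>g\<in>G. g < conductor G" unfolding conductor_def by (rule LeastI)
  show "\<forall>g\<in>G. g < k" if "conductor G \<le> k" for k using * that by auto
qed (simp add: conductor_def Least_le)

lemma conductor_eqI: "finite G \<Longrightarrow> (\<And>k. (\<forall>g\<in>G. g < k) \<longleftrightarrow> c \<le> k) \<Longrightarrow> conductor G = c"
  by (metis conductor_le_iff order_refl antisym)

lemma conductor_Suc: "finite G \<Longrightarrow> conductor (insert 0 (Suc ` G)) = Suc (conductor G)"
proof (rule conductor_eqI)
  fix k assume "finite G"
  then show "(\<forall>g\<in>insert 0 (Suc ` G). g < k) \<longleftrightarrow> Suc (conductor G) \<le> k"
    using conductor_le_iff[of G "k - 1"] by (cases k) auto
qed simp

text \<open>
A discrete valuation ring with uniformizer \<open>\<pi>\<close>, residue field with \<open>p\<close> elements and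
ramification index \<open>n\<close>.
\<close>

locale ramified_dvr =
  fixes p n :: nat and \<pi> :: "'a::{idom, ring_char_0}"
  assumes prime: "Factorial_Ring.prime p"
    and n: "n > 0"
    and p_eq: "\<exists>u. u dvd 1 \<and> of_nat p = u * \<pi> ^ n"
    and unif: "x \<noteq> 0 \<Longrightarrow> \<exists>k u. u dvd 1 \<and> x = u * \<pi> ^ k"
    and nonunit: "\<not> \<pi> dvd 1" "\<pi> \<noteq> 0"
    and residue: "\<exists>c::int. \<pi> dvd x - of_int c"
begin

definition pi_ideal :: "nat \<Rightarrow> 'a set" where "pi_ideal g = {x. \<pi> ^ g dvd x}"

text \<open>
A relation instead of a function, so that no value has to be assigned to \<open>0\<close>: the element \<open>0\<close> has no
valuation.
\<close>

definition val :: "'a \<Rightarrow> nat \<Rightarrow> bool" where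
  "val x g \<longleftrightarrow> \<pi> ^ g dvd x \<and> \<not> \<pi> ^ Suc g dvd x"

lemma pi_dvd_p: "\<pi> dvd of_nat p"
  using p_eq n by (metis dvd_power dvd_mult)

lemma add_subgroup_pi_ideal: "add_subgroup (pi_ideal g)"
  by (auto simp: add_subgroup_def pi_ideal_def)

lemma pi_ideal_mono: "g \<le> h \<Longrightarrow> pi_ideal h \<subseteq> pi_ideal g"
  by (auto simp: pi_ideal_def intro: dvd_trans le_imp_power_dvd)

lemma p_dvd_iff: "\<pi> ^ (k + n) dvd of_nat p * x \<longleftrightarrow> \<pi> ^ k dvd x"
proof -
  obtain u w where u: "of_nat p = u * \<pi> ^ n" "1 = u * w" using p_eq by (auto simp: dvd_def)
  have "\<pi> ^ (k + n) dvd of_nat p * x \<longleftrightarrow> \<pi> ^ k * \<pi> ^ n dvd (u * x) * \<pi> ^ n"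
    by (simp add: u power_add mult_ac)
  also have "\<dots> \<longleftrightarrow> \<pi> ^ k dvd u * x" using nonunit by simp
  also have "\<dots> \<longleftrightarrow> \<pi> ^ k dvd x"
  proof
    assume "\<pi> ^ k dvd u * x"
    then have "\<pi> ^ k dvd w * (u * x)" by (rule dvd_mult)
    also have "w * (u * x) = (u * w) * x" by (simp add: mult_ac)
    finally show "\<pi> ^ k dvd x" using u(2) by simp
  qed simp
  finally show ?thesis .
qed

lemma p_pow_dvd_iff: "\<pi> ^ (k + n * t) dvd of_nat p ^ t * x \<longleftrightarrow> \<pi> ^ k dvd x"
proof (induction t)
  case (Suc t)
  have "\<pi> ^ (k + n * Suc t) dvd of_nat p ^ Suc t * x \<longleftrightarrow> \<pi> ^ ((k + n * t) + n) dvd of_nat p * (of_nat p ^ t * x)"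
    by (simp add: algebra_simps)
  then show ?case by (simp add: p_dvd_iff Suc)
qed simp

lemma pi_ideal_eq_p_pow: "pi_ideal (n * t) = range ((*) (of_nat p ^ t))"
proof (intro equalityI subsetI)
  fix x assume "x \<in> pi_ideal (n * t)"
  then obtain y where y: "x = \<pi> ^ (n * t) * y" by (auto simp: pi_ideal_def)
  obtain u w where u: "of_nat p = u * \<pi> ^ n" "1 = u * w" using p_eq by (auto simp: dvd_def)
  have "of_nat p ^ t * (w ^ t * y) = (u * w) ^ t * (\<pi> ^ n) ^ t * y" by (simp add: u(1) power_mult_distrib mult_ac)
  also have "\<dots> = x" using u(2) y by (simp add: power_mult)
  finally show "x \<in> range ((*) (of_nat p ^ t))" by (metis rangeI)
qed (use p_pow_dvd_iff[of 0 t] in \<open>auto simp: pi_ideal_def\<close>)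

lemma pi_dvd_of_int_iff: "\<pi> dvd of_int c \<longleftrightarrow> int p dvd c"
proof
  assume *: "\<pi> dvd of_int c"
  show "int p dvd c"
  proof (rule ccontr)
    assume "\<not> int p dvd c"
    then have "coprime c (int p)" using prime prime_imp_coprime[of "int p" c] by (simp add: ac_simps)
    then obtain u w where uw: "u * c + w * int p = 1" using bezout_int[of c "int p"] by auto
    have "\<pi> dvd of_int u * of_int c + of_int w * of_nat p" using * pi_dvd_p by (intro dvd_add dvd_mult)
    also have "of_int u * of_int c + of_int w * of_nat p = (of_int (u * c + w * int p) :: 'a)" by simp
    finally show False using nonunit uw by simp
  qed
next
  assume "int p dvd c"
  then obtain d where "c = int p * d" by (auto simp: dvd_def)
  then show "\<pi> dvd of_int c" using pi_dvd_p by simp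
qed

lemma val_0_unit: "val y 0 \<Longrightarrow> \<exists>w. y * w = 1"
proof -
  assume y: "val y 0"
  then have "y \<noteq> 0" by (auto simp: val_def)
  then obtain k u where u: "u dvd 1" "y = u * \<pi> ^ k" using unif by blast
  have "k = 0" using y u(2) by (cases k) (auto simp: val_def)
  then show ?thesis using u by (auto simp: dvd_def)
qed

lemma val_shift: "val (\<pi> ^ g * y) (g + h) \<longleftrightarrow> val y h"
proof -
  have "\<pi> ^ (g + k) dvd \<pi> ^ g * y \<longleftrightarrow> \<pi> ^ k dvd y" for k using nonunit by (simp add: power_add)
  from this[of h] this[of "Suc h"] show ?thesis by (simp add: val_def)
qed

lemma valE: assumes "val x g" obtains y where "x = \<pi> ^ g * y" "val y 0"
proof -
  obtain y where y: "x = \<pi> ^ g * y" using assms by (auto simp: val_def)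
  then have "val y 0" using assms val_shift[of g y 0] by simp
  with y show ?thesis by (rule that)
qed

lemma val_pi: "val (\<pi> ^ g) g"
  using val_shift[of g 1 0] nonunit by (simp add: val_def)

text \<open>
Integers represent the residue field, so an integral multiple of \<open>y\<close> cancels the leading
coefficient of \<open>x\<close>.
\<close>

lemma val_reduce: assumes "val y g" "\<pi> ^ g dvd x" shows "\<exists>c::int. \<pi> ^ Suc g dvd x - of_int c * y"
proof -
  obtain y' where y': "y = \<pi> ^ g * y'" "val y' 0" using assms(1) by (rule valE)
  obtain x' where x': "x = \<pi> ^ g * x'" using assms(2) by (auto simp: dvd_def)
  obtain w where w: "y' * w = 1" using val_0_unit[OF y'(2)] by blast
  obtain c :: int where c: "\<pi> dvd x' * w - of_int c" using residue by blast
  have "\<pi> dvd (x' * w - of_int c) * y'" using c by simp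
  also have "(x' * w - of_int c) * y' = x' * (y' * w) - of_int c * y'" by (simp add: algebra_simps)
  finally have "\<pi> dvd x' - of_int c * y'" by (simp add: w)
  then have "\<pi> ^ g * \<pi> dvd \<pi> ^ g * (x' - of_int c * y')" by (rule mult_dvd_mono[OF dvd_refl])
  then have "\<pi> ^ Suc g dvd x - of_int c * y" by (simp add: x' y' algebra_simps)
  then show ?thesis ..
qed

lemma val_p: "val (of_nat p * x) (g + n) \<longleftrightarrow> val x g"
  using p_dvd_iff[of g x] p_dvd_iff[of "Suc g" x] by (simp add: val_def)

lemma val_p_ge: "val (of_nat p * x) g \<Longrightarrow> n \<le> g \<and> val x (g - n)"
proof -
  assume *: "val (of_nat p * x) g"
  have "n \<le> g"
  proof (rule ccontr)
    assume "\<not> n \<le> g"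
    then have "\<pi> ^ Suc g dvd \<pi> ^ n" by (intro le_imp_power_dvd) simp
    also have "\<pi> ^ n dvd of_nat p * x" using p_dvd_iff[of 0 x] by simp
    finally show False using * by (simp add: val_def)
  qed
  then show ?thesis using * val_p[of x "g - n"] by simp
qed

lemma val_add: assumes "val x g" "\<pi> ^ Suc g dvd y" shows "val (x + y) g"
proof -
  have "\<pi> ^ g dvd y" using assms(2) by (metis dvd_trans le_imp_power_dvd le_SucI le_refl)
  then show ?thesis using assms by (auto simp: val_def dvd_add_left_iff)
qed

lemma val_of_int: assumes "val x g" "\<not> int p dvd c" shows "val (of_int c * x) g"
proof -
  obtain y where y: "x = \<pi> ^ g * y" "val y 0" using assms(1) by (rule valE)
  have "\<not> \<pi> dvd of_int c * y"
  proof
    obtain w where w: "y * w = 1" using val_0_unit[OF y(2)] by blast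
    assume "\<pi> dvd of_int c * y"
    then have "\<pi> dvd (of_int c * y) * w" by (rule dvd_mult2)
    then show False using assms(2) w pi_dvd_of_int_iff by (simp add: mult.assoc)
  qed
  then have "val (of_int c * y) 0" by (simp add: val_def)
  then show ?thesis using val_shift[of g "of_int c * y" 0] by (simp add: y mult_ac)
qed

lemma add_index_pi_ideal_1: "add_index UNIV (pi_ideal 1) = p"
proof -
  let ?f = "\<lambda>c::int. (+) (of_int c) ` pi_ideal 1"
  have p0: "p > 0" using prime prime_gt_0_nat by blast
  have mem: "of_int c \<in> pi_ideal 1 \<longleftrightarrow> int p dvd c" for c by (simp add: pi_ideal_def pi_dvd_of_int_iff)
  have "range (\<lambda>x. (+) x ` pi_ideal 1) = ?f ` {0..<int p}"
  proof (intro equalityI subsetI)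
    fix C assume "C \<in> range (\<lambda>x. (+) x ` pi_ideal 1)"
    then obtain x where x: "C = (+) x ` pi_ideal 1" by auto
    obtain c :: int where c: "\<pi> dvd x - of_int c" using residue by blast
    have "\<pi> dvd of_int (c - c mod int p)" by (simp only: pi_dvd_of_int_iff) (simp add: minus_mod_eq_mult_div)
    then have "\<pi> dvd (x - of_int c) + of_int (c - c mod int p)" using c by (rule dvd_add[rotated])
    then have "x - of_int (c mod int p) \<in> pi_ideal 1" by (simp add: pi_ideal_def)
    then have "C = ?f (c mod int p)" by (simp add: x coset_eq_iff[OF add_subgroup_pi_ideal])
    then show "C \<in> ?f ` {0..<int p}" using p0 by simp
  qed auto
  moreover have "inj_on ?f {0..<int p}"
  proof (rule inj_onI)
    fix c d assume *: "c \<in> {0..<int p}" "d \<in> {0..<int p}" "?f c = ?f d"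
    then have "of_int (c - d) \<in> pi_ideal 1" by (simp add: coset_eq_iff[OF add_subgroup_pi_ideal])
    then have "int p dvd c - d" by (simp only: mem)
    then have "c mod int p = d mod int p" by (simp add: mod_eq_dvd_iff)
    then show "c = d" using * by simp
  qed
  ultimately have "add_index UNIV (pi_ideal 1) = card {0..<int p}" by (simp add: add_index_def card_image)
  then show ?thesis by simp
qed

lemma pi_ideal_image: "pi_ideal (g + k) = (*) (\<pi> ^ g) ` pi_ideal k"
  by (auto simp: pi_ideal_def power_add dvd_def mult.assoc)

lemma add_index_pi_ideal: "add_index (pi_ideal g) (pi_ideal (Suc g)) = p"
proof -
  have "add_index ((*) (\<pi> ^ g) ` UNIV) ((*) (\<pi> ^ g) ` pi_ideal 1) = add_index UNIV (pi_ideal 1)"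
    by (rule add_index_image) (use nonunit in \<open>auto simp: right_diff_distrib add_subgroup_pi_ideal inj_def\<close>)
  moreover have "(*) (\<pi> ^ g) ` UNIV = pi_ideal g" by (auto simp: pi_ideal_def dvd_def)
  moreover have "(*) (\<pi> ^ g) ` pi_ideal 1 = pi_ideal (Suc g)" using pi_ideal_image[of g 1] by simp
  ultimately show ?thesis using add_index_pi_ideal_1 by simp
qed

lemma add_index_pi_ideal_pow: "add_index UNIV (pi_ideal g) = p ^ g"
proof (induction g)
  case 0 then show ?case by (simp add: pi_ideal_def add_index_self add_subgroup_UNIV)
next
  case (Suc g)
  then show ?case using add_index_mult[OF add_subgroup_UNIV add_subgroup_pi_ideal add_subgroup_pi_ideal pi_ideal_mono[of g "Suc g"]] by (simp add: add_index_pi_ideal)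
qed

definition gaps :: "'a set \<Rightarrow> nat set" where
  "gaps M = {g. \<forall>x\<in>M. \<not> val x g}"

abbreviation lattices :: "'a set set" where "lattices \<equiv> p_open p UNIV"

lemma lattice_pi_ideal: assumes "M \<in> lattices" shows "\<exists>k. pi_ideal k \<subseteq> M"
proof -
  obtain t where "\<And>x. of_nat p ^ t * x \<in> M" using assms by (auto simp: p_open_def)
  then have "pi_ideal (n * t) \<subseteq> M" by (auto simp: pi_ideal_eq_p_pow)
  then show ?thesis ..
qed

lemma latticeI: assumes "add_subgroup M" "pi_ideal k \<subseteq> M" shows "M \<in> lattices"
proof -
  have "of_nat p ^ k * x \<in> M" for x
  proof -
    have "\<pi> ^ k dvd of_nat p ^ k * x" by (rule dvd_mult2[OF dvd_power_same[OF pi_dvd_p]])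
    then show ?thesis using assms(2) by (auto simp: pi_ideal_def)
  qed
  then show ?thesis using assms by (auto simp: p_open_def)
qed

lemma gaps_pi_ideal: "pi_ideal k \<subseteq> M \<Longrightarrow> g \<in> gaps M \<Longrightarrow> g < k"
proof (rule ccontr)
  assume *: "pi_ideal k \<subseteq> M" "g \<in> gaps M" "\<not> g < k"
  then have "\<pi> ^ k dvd \<pi> ^ g" by (intro le_imp_power_dvd) simp
  then have "\<pi> ^ g \<in> M" using *(1) by (auto simp: pi_ideal_def)
  then show False using *(2) val_pi[of g] by (auto simp: gaps_def)
qed

lemma finite_gaps: "M \<in> lattices \<Longrightarrow> finite (gaps M)"
  using lattice_pi_ideal gaps_pi_ideal by (meson bounded_nat_set_is_finite)

text \<open>
Modulo an ideal contained in \<open>M\<close>, every element of \<open>\<pi> ^ k R\<close> is approximated by elements of \<open>M\<close> of the same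
valuation, one step at a time.
\<close>

lemma pi_ideal_subset_iff: assumes "M \<in> lattices"
  shows "pi_ideal k \<subseteq> M \<longleftrightarrow> (\<forall>g\<in>gaps M. g < k)"
proof
  assume *: "\<forall>g\<in>gaps M. g < k"
  have M: "add_subgroup M" using assms by (simp add: p_open_def)
  obtain t where t: "pi_ideal t \<subseteq> M" using lattice_pi_ideal[OF assms] by blast
  have "\<exists>m\<in>M. \<pi> ^ (k + j) dvd x - m" if x: "x \<in> pi_ideal k" for x j
  proof (induction j)
    case 0 then show ?case using x add_subgroup_zero[OF M] by (intro bexI[of _ 0]) (auto simp: pi_ideal_def)
  next
    case (Suc j)
    then obtain m where m: "m \<in> M" "\<pi> ^ (k + j) dvd x - m" by blast
    obtain y where y: "y \<in> M" "val y (k + j)" using * by (force simp: gaps_def)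
    obtain c :: int where c: "\<pi> ^ Suc (k + j) dvd (x - m) - of_int c * y" using val_reduce[OF y(2) m(2)] by blast
    have "m + of_int c * y \<in> M" by (intro add_subgroup_add[OF M] add_subgroup_of_int[OF M] m y)
    moreover have "\<pi> ^ (k + Suc j) dvd x - (m + of_int c * y)" using c by (simp add: diff_diff_eq)
    ultimately show ?case by blast
  qed
  note approx = this
  show "pi_ideal k \<subseteq> M"
  proof
    fix x assume "x \<in> pi_ideal k"
    from approx[OF this, of t] obtain m where m: "m \<in> M" "\<pi> ^ (k + t) dvd x - m" by blast
    have "x - m \<in> pi_ideal (k + t)" using m by (simp add: pi_ideal_def)
    then have "x - m \<in> M" using t pi_ideal_mono[of t "k + t"] by auto
    then show "x \<in> M" using add_subgroup_add[OF M _ m(1)] by fastforce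
  qed
qed (use gaps_pi_ideal in blast)

lemma gaps_closed: "M \<in> lattices \<Longrightarrow> g \<in> gaps M \<Longrightarrow> n \<le> g \<Longrightarrow> g - n \<in> gaps M"
proof (rule ccontr)
  assume *: "M \<in> lattices" "g \<in> gaps M" "n \<le> g" "g - n \<notin> gaps M"
  then obtain x where x: "x \<in> M" "val x (g - n)" by (auto simp: gaps_def)
  have "val (of_nat p * x) g" using val_p[of x "g - n"] x *(3) by simp
  moreover have "of_nat p * x \<in> M" using *(1) x by (intro add_subgroup_of_nat) (auto simp: p_open_def)
  ultimately show False using *(2) by (auto simp: gaps_def)
qed

lemma gaps_plus_pi_ideal: assumes "h < g" shows "h \<in> gaps (M + pi_ideal g) \<longleftrightarrow> h \<in> gaps M"
proof -
  have "M \<subseteq> M + pi_ideal g" by (rule subset_plus_left[OF add_subgroup_pi_ideal])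
  moreover have "\<exists>m\<in>M. val m h" if "x \<in> M + pi_ideal g" "val x h" for x
  proof -
    from \<open>x \<in> M + pi_ideal g\<close> obtain m z where m: "m \<in> M" "z \<in> pi_ideal g" "x = m + z" by (rule set_plusE)
    have "z \<in> pi_ideal (Suc h)" using m(2) pi_ideal_mono[of "Suc h" g] assms by auto
    then have "\<pi> ^ Suc h dvd - z" by (simp add: pi_ideal_def)
    from val_add[OF that(2) this] have "val m h" by (simp add: m)
    then show ?thesis using m by blast
  qed
  ultimately show ?thesis unfolding gaps_def by blast
qed

lemma gaps_empty: "M \<in> lattices \<Longrightarrow> gaps M = {} \<longleftrightarrow> M = UNIV"
proof
  assume "M \<in> lattices" "gaps M = {}"
  then show "M = UNIV" using pi_ideal_subset_iff[of M 0] by (auto simp: pi_ideal_def)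
next
  assume "M = UNIV"
  then show "gaps M = {}" using gaps_pi_ideal[of 0 M] by blast
qed

text \<open>
Adding \<open>\<pi> ^ g R\<close> for the largest gap \<open>g\<close> fills this gap and no other.
\<close>

lemma top_gap:
  assumes M: "M \<in> lattices" and g: "g \<in> gaps M" "\<And>h. h \<in> gaps M \<Longrightarrow> h \<le> g"
  shows "M + pi_ideal g \<in> lattices" "gaps (M + pi_ideal g) = gaps M - {g}" "M \<inter> pi_ideal g = pi_ideal (Suc g)"
proof -
  have aM: "add_subgroup M" using M by (simp add: p_open_def)
  show L: "M + pi_ideal g \<in> lattices"
    by (intro latticeI[of _ g] add_subgroup_plus aM add_subgroup_pi_ideal subset_plus_right)
  have *: "\<forall>h\<in>gaps (M + pi_ideal g). h < g" using pi_ideal_subset_iff[OF L, of g] subset_plus_right[OF aM] by blast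
  show "gaps (M + pi_ideal g) = gaps M - {g}"
  proof (intro equalityI subsetI)
    fix h assume h: "h \<in> gaps (M + pi_ideal g)"
    then show "h \<in> gaps M - {g}" using * gaps_plus_pi_ideal[of h g M] by blast
  next
    fix h assume "h \<in> gaps M - {g}"
    then show "h \<in> gaps (M + pi_ideal g)" using g(2)[of h] gaps_plus_pi_ideal[of h g M] by force
  qed
  have "pi_ideal (Suc g) \<subseteq> M" using pi_ideal_subset_iff[OF M, of "Suc g"] g(2) by (auto simp: less_Suc_eq_le)
  moreover have "x \<in> pi_ideal (Suc g)" if "x \<in> M" "x \<in> pi_ideal g" for x
    using that g(1) by (auto simp: gaps_def pi_ideal_def val_def)
  ultimately show "M \<inter> pi_ideal g = pi_ideal (Suc g)" using pi_ideal_mono[of g "Suc g"] by auto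
qed

text \<open>
Filling the largest gap divides the index by \<open>p\<close>.
\<close>

lemma add_index_gaps: "M \<in> lattices \<Longrightarrow> add_index UNIV M = p ^ card (gaps M)"
proof (induction "card (gaps M)" arbitrary: M)
  case 0
  then have "M = UNIV" using gaps_empty finite_gaps by simp
  then show ?case using 0 by (simp add: add_index_self add_subgroup_UNIV)
next
  case (Suc k)
  have fin: "finite (gaps M)" "gaps M \<noteq> {}" using Suc finite_gaps by auto
  define g where "g = Max (gaps M)"
  have g: "g \<in> gaps M" "\<And>h. h \<in> gaps M \<Longrightarrow> h \<le> g" using fin by (auto simp: g_def)
  note top = top_gap[OF Suc.prems g]
  have c: "card (gaps (M + pi_ideal g)) = k" using Suc.hyps(2) fin(1) g(1) by (simp add: top)
  have M: "add_subgroup M" using Suc.prems by (simp add: p_open_def)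
  have "add_index UNIV M = add_index UNIV (M + pi_ideal g) * add_index (M + pi_ideal g) M"
    by (intro add_index_mult add_subgroup_UNIV add_subgroup_plus M add_subgroup_pi_ideal subset_plus_left) auto
  also have "\<dots> = p ^ k * p" using Suc.hyps(1)[of "M + pi_ideal g"] top c
    by (simp add: add_index_plus[OF M add_subgroup_pi_ideal] add_index_pi_ideal)
  finally show ?case by (simp flip: Suc.hyps(2))
qed

text \<open>
The lattices \<open>N\<close> that arise from \<open>M'\<close> by reopening the gap \<open>g\<close> are counted with
\<open>card_relative_complements\<close> for \<open>q = p\<close> and \<open>K = \<pi> ^ g R\<close>.  As a basis serve elements of \<open>M'\<close> whose valuations
are the generators below \<open>g\<close>.  They span modulo \<open>p M'\<close> because every other valuation below \<open>g\<close> is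
attained in \<open>p M'\<close>; they are independent because distinct generators cannot cancel and no
generator is a valuation in \<open>p M'\<close>.
\<close>

lemma card_top_gap_fibre:
  assumes M': "M' \<in> lattices" "gaps M' = G - {g}" and G: "finite G" "g \<in> G" "\<And>h. h \<in> G \<Longrightarrow> h \<le> g"
    and closed: "\<And>h. h \<in> G \<Longrightarrow> n \<le> h \<Longrightarrow> h - n \<in> G"
  shows "card {N. add_subgroup N \<and> N + pi_ideal g = M' \<and> N \<inter> pi_ideal g = pi_ideal (Suc g)} = p ^ card {h \<in> generators n G. h < g}"
proof -
  define I where "I = {h \<in> generators n G. h < g}"
  have finI: "finite I" by (simp add: I_def)
  have aM: "add_subgroup M'" using M' by (simp add: p_open_def)
  have FM: "pi_ideal g \<subseteq> M'" using pi_ideal_subset_iff[OF M'(1), of g] M'(2) G(3) by force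
  have ex: "\<exists>x\<in>M'. val x h" if "h \<notin> G" for h using that M'(2) by (auto simp: gaps_def)
  define b where "b h = (SOME x. x \<in> M' \<and> val x h)" for h
  have b: "b h \<in> M'" "val (b h) h" if "h \<in> I" for h
    using someI_ex[of "\<lambda>x. x \<in> M' \<and> val x h"] ex[of h] that by (auto simp: b_def I_def generators_def)
  have p1: "\<pi> ^ Suc k dvd of_nat p * x" if "\<pi> ^ k dvd x" for k x
    using mult_dvd_mono[OF pi_dvd_p that] by simp
  have "card {N. add_subgroup N \<and> N + pi_ideal g = M' \<and> N \<inter> pi_ideal g = pi_ideal (Suc g)} = add_index (pi_ideal g) (pi_ideal (Suc g)) ^ card I"
  proof (rule card_relative_complements[where q = "int p" and b = b])
    fix x assume x: "x \<in> M'"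
    have "\<exists>c. \<exists>y\<in>M'. \<pi> ^ j dvd x - (\<Sum>i\<in>I. of_int (c i) * b i) - of_int (int p) * y" if "j \<le> g" for j
      using that
    proof (induction j)
      case 0 then show ?case using aM add_subgroup_zero by auto
    next
      case (Suc j)
      then obtain c y where y: "y \<in> M'" and d: "\<pi> ^ j dvd x - (\<Sum>i\<in>I. of_int (c i) * b i) - of_int (int p) * y"
        (is "_ dvd ?w") by auto
      consider "\<pi> ^ Suc j dvd ?w" | "j \<in> I" | "val ?w j" "j \<notin> I" using d by (auto simp: val_def)
      then show ?case
      proof cases
        case 1 then show ?thesis using y by blast
      next
        case 2
        obtain e :: int where e: "\<pi> ^ Suc j dvd ?w - of_int e * b j" using val_reduce[OF b(2)[OF 2] d] by blast
        have "(\<Sum>i\<in>I. of_int ((c(j := c j + e)) i) * b i) = (\<Sum>i\<in>I. of_int (c i) * b i + (if i = j then of_int e * b j else 0))"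
          by (rule sum.cong) (auto simp: algebra_simps)
        also have "\<dots> = (\<Sum>i\<in>I. of_int (c i) * b i) + of_int e * b j" using 2 finI by (simp add: sum.distrib)
        finally have "x - (\<Sum>i\<in>I. of_int ((c(j := c j + e)) i) * b i) - of_int (int p) * y = ?w - of_int e * b j"
          by (simp add: algebra_simps)
        then show ?thesis using e y by metis
      next
        case 3
        have "?w \<in> M'" using x y b by (intro add_subgroup_diff[OF aM] add_subgroup_sum[OF aM] add_subgroup_of_int[OF aM]) auto
        then have "j \<notin> gaps M'" using 3 by (auto simp: gaps_def)
        then have "j \<notin> G" using M'(2) Suc.prems by auto
        then have "n \<le> j" "j - n \<notin> G" using 3 Suc.prems by (auto simp: I_def generators_def)
        then obtain y' where y': "y' \<in> M'" "val y' (j - n)" using ex by blast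
        then have "val (of_nat p * y') j" using val_p[of y' "j - n"] \<open>n \<le> j\<close> by simp
        then obtain e :: int where "\<pi> ^ Suc j dvd ?w - of_int e * (of_nat p * y')" using val_reduce d by blast
        also have "?w - of_int e * (of_nat p * y') = x - (\<Sum>i\<in>I. of_int (c i) * b i) - of_int (int p) * (y + of_int e * y')"
          by (simp add: algebra_simps)
        finally show ?thesis using add_subgroup_add[OF aM y add_subgroup_of_int[OF aM y'(1)]] by blast
      qed
    qed
    from this[of g] show "\<exists>c. \<exists>y\<in>M'. x - (\<Sum>i\<in>I. of_int (c i) * b i) - of_int (int p) * y \<in> pi_ideal g"
      by (simp add: pi_ideal_def)
  next
    fix c y assume y: "y \<in> M'" and k: "(\<Sum>i\<in>I. of_int (c i) * b i) - of_int (int p) * y \<in> pi_ideal g"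
    show "\<forall>i\<in>I. int p dvd c i"
    proof (rule ccontr)
      \<comment> \<open>The terms with coefficients divisible by \<open>p\<close> are moved to \<open>p M'\<close>; among the others, the one of
        least valuation \<open>h\<close> determines the valuation of the sum.\<close>
      define B where "B = {i \<in> I. \<not> int p dvd c i}"
      assume "\<not> (\<forall>i\<in>I. int p dvd c i)"
      then have B: "B \<noteq> {}" "finite B" "B \<subseteq> I" using finI by (auto simp: B_def)
      define h where "h = Min B"
      have h: "h \<in> B" "\<And>i. i \<in> B \<Longrightarrow> h \<le> i" using B by (auto simp: h_def)
      have hI: "h \<in> I" "h < g" using h B by (auto simp: I_def)
      define y1 where "y1 = (\<Sum>i\<in>I - B. of_int (c i div int p) * b i)"
      have y1: "y1 \<in> M'" unfolding y1_def using b by (intro add_subgroup_sum[OF aM] add_subgroup_of_int[OF aM]) auto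
      have "of_nat p * y1 = (\<Sum>i\<in>I - B. of_int (c i) * b i)"
        unfolding y1_def sum_distrib_left
      proof (rule sum.cong[OF refl])
        fix i assume "i \<in> I - B"
        then obtain d where "c i = int p * d" by (auto simp: B_def dvd_def)
        then show "of_nat p * (of_int (c i div int p) * b i) = of_int (c i) * b i"
          using prime_gt_0_nat[OF prime] by (simp add: mult.assoc)
      qed
      then have "(\<Sum>i\<in>I. of_int (c i) * b i) = (\<Sum>i\<in>B. of_int (c i) * b i) + of_nat p * y1"
        using sum.subset_diff[OF B(3) finI, of "\<lambda>i. of_int (c i) * b i"] by (simp add: add.commute)
      also have "(\<Sum>i\<in>B. of_int (c i) * b i) = of_int (c h) * b h + (\<Sum>i\<in>B - {h}. of_int (c i) * b i)"
        using h B by (simp add: sum.remove)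
      finally have eq: "of_nat p * (y - y1) = of_int (c h) * b h + ((\<Sum>i\<in>B - {h}. of_int (c i) * b i)
          - ((\<Sum>i\<in>I. of_int (c i) * b i) - of_int (int p) * y))"
        by (simp add: algebra_simps)
      have "val (of_nat p * (y - y1)) h"
        unfolding eq
      proof (rule val_add)
        show "val (of_int (c h) * b h) h" using b(2)[OF hI(1)] h(1) by (intro val_of_int) (auto simp: B_def)
        have 1: "\<pi> ^ Suc h dvd (\<Sum>i\<in>B - {h}. of_int (c i) * b i)"
        proof (intro dvd_sum dvd_mult)
          fix i assume i: "i \<in> B - {h}"
          then have "Suc h \<le> i" using h(2)[of i] by auto
          then have "\<pi> ^ Suc h dvd \<pi> ^ i" by (rule le_imp_power_dvd)
          also have "\<pi> ^ i dvd b i" using b(2)[of i] i B by (auto simp: val_def)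
          finally show "\<pi> ^ Suc h dvd b i" .
        qed
        have 2: "\<pi> ^ Suc h dvd (\<Sum>i\<in>I. of_int (c i) * b i) - of_int (int p) * y"
          using k pi_ideal_mono[of "Suc h" g] hI(2) by (auto simp: pi_ideal_def)
        show "\<pi> ^ Suc h dvd (\<Sum>i\<in>B - {h}. of_int (c i) * b i)
          - ((\<Sum>i\<in>I. of_int (c i) * b i) - of_int (int p) * y)" by (rule dvd_diff[OF 1 2])
      qed
      then have "n \<le> h" "val (y - y1) (h - n)" using val_p_ge by auto
      moreover have "y - y1 \<in> M'" by (rule add_subgroup_diff[OF aM y y1])
      ultimately have gap: "h - n \<notin> gaps M'" unfolding gaps_def by blast
      have "h - n \<noteq> g" using hI(2) by simp
      then have "h - n \<notin> G" using gap unfolding M'(2) by blast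
      then show False using hI \<open>n \<le> h\<close> by (auto simp: I_def generators_def)
    qed
  next
    fix y assume y: "y \<in> M'" and "of_int (int p) * y \<in> pi_ideal g"
    moreover have "\<not> val (of_nat p * y) g"
    proof
      assume "val (of_nat p * y) g"
      then have *: "n \<le> g" "val y (g - n)" using val_p_ge by auto
      then have "g - n \<notin> gaps M'" using y by (auto simp: gaps_def)
      then show False using M'(2) closed[OF G(2) *(1)] * n by auto
    qed
    ultimately show "of_int (int p) * y \<in> pi_ideal (Suc g)" by (auto simp: pi_ideal_def val_def)
  next
    show "of_int (int p) * x \<in> pi_ideal (Suc g)" if "x \<in> pi_ideal g" for x using p1[of g x] that by (simp add: pi_ideal_def)
  qed (use b FM pi_ideal_mono[of g "Suc g"] in \<open>simp_all add: aM add_subgroup_pi_ideal finI\<close>)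
  then show ?thesis by (simp add: I_def add_index_pi_ideal)
qed

text \<open>
Induction on the number of gaps, by removing the largest one; the generators below the remaining gaps do not change.
\<close>

lemma card_lattices_gaps:
  assumes "finite G" "\<And>h. h \<in> G \<Longrightarrow> n \<le> h \<Longrightarrow> h - n \<in> G"
  shows "card {M \<in> lattices. gaps M = G} = p ^ (\<Sum>g\<in>G. card {h \<in> generators n G. h < g})"
  using assms
proof (induction "card G" arbitrary: G)
  case 0
  have "UNIV \<in> lattices" by (simp add: p_open_def add_subgroup_UNIV)
  then have "{M \<in> lattices. gaps M = {}} = {UNIV}" using gaps_empty by auto
  then show ?case using 0 by simp
next
  case (Suc k)
  have ne: "G \<noteq> {}" using Suc.hyps(2) by auto
  define g where "g = Max G"
  have g: "g \<in> G" "\<And>h. h \<in> G \<Longrightarrow> h \<le> g" using ne Suc.prems by (auto simp: g_def)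
  define G' where "G' = G - {g}"
  have closed': "h - n \<in> G'" if "h \<in> G'" "n \<le> h" for h
    using Suc.prems(2)[of h] that g(2)[of h] n by (auto simp: G'_def)
  have IH: "card {M \<in> lattices. gaps M = G'} = p ^ (\<Sum>g\<in>G'. card {h \<in> generators n G'. h < g})"
    using Suc.prems g Suc.hyps(2) by (intro Suc.hyps(1) closed') (auto simp: G'_def)
  have p0: "p > 0" using prime prime_gt_0_nat by blast
  define \<F> where "\<F> M' = {N. add_subgroup N \<and> N + pi_ideal g = M' \<and> N \<inter> pi_ideal g = pi_ideal (Suc g)}" for M'
  have cF: "card (\<F> M') = p ^ card {h \<in> generators n G. h < g}" if "M' \<in> {M \<in> lattices. gaps M = G'}" for M'
    unfolding \<F>_def using that Suc.prems g by (intro card_top_gap_fibre) (auto simp: G'_def)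
  have "{M \<in> lattices. gaps M = G} = (\<Union>M'\<in>{M \<in> lattices. gaps M = G'}. \<F> M')"
  proof (intro equalityI subsetI)
    fix M assume "M \<in> {M \<in> lattices. gaps M = G}"
    then have M: "M \<in> lattices" "gaps M = G" by auto
    note top = top_gap[OF M(1), of g, unfolded M(2), OF g]
    have "M + pi_ideal g \<in> {M \<in> lattices. gaps M = G'}" using top by (auto simp: G'_def)
    moreover have "M \<in> \<F> (M + pi_ideal g)" using top M by (simp add: \<F>_def p_open_def)
    ultimately show "M \<in> (\<Union>M'\<in>{M \<in> lattices. gaps M = G'}. \<F> M')" by blast
  next
    fix N assume "N \<in> (\<Union>M'\<in>{M \<in> lattices. gaps M = G'}. \<F> M')"
    then have N: "add_subgroup N" "gaps (N + pi_ideal g) = G'" "N \<inter> pi_ideal g = pi_ideal (Suc g)" by (auto simp: \<F>_def)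
    have L: "N \<in> lattices" using latticeI[OF N(1), of "Suc g"] N(3) by blast
    have "h \<in> gaps N \<longleftrightarrow> h \<in> G" for h
    proof (cases h g rule: linorder_cases)
      case less then show ?thesis using gaps_plus_pi_ideal[OF less, of N] N(2) by (simp add: G'_def)
    next
      case equal
      have "\<not> val x g" if "x \<in> N" for x using N(3) that by (auto simp: pi_ideal_def val_def)
      then show ?thesis using equal g by (auto simp: gaps_def)
    next
      case greater
      have "h \<notin> gaps N" using gaps_pi_ideal[of "Suc g" N h] N(3) greater by auto
      moreover have "h \<notin> G" using g(2)[of h] greater by auto
      ultimately show ?thesis by simp
    qed
    then show "N \<in> {M \<in> lattices. gaps M = G}" using L by blast
  qed
  also have "card \<dots> = (\<Sum>M'\<in>{M \<in> lattices. gaps M = G'}. card (\<F> M'))"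
  proof (rule card_UN_disjoint)
    show "finite {M \<in> lattices. gaps M = G'}" using IH p0 by (intro card_ge_0_finite) simp
    show "\<forall>i\<in>{M \<in> lattices. gaps M = G'}. finite (\<F> i)"
    proof
      fix i assume "i \<in> {M \<in> lattices. gaps M = G'}"
      from cF[OF this] show "finite (\<F> i)" using p0 by (intro card_ge_0_finite) simp
    qed
  qed (auto simp: \<F>_def)
  also have "\<dots> = p ^ (\<Sum>g\<in>G'. card {h \<in> generators n G'. h < g}) * p ^ card {h \<in> generators n G. h < g}"
    by (simp add: cF IH)
  also have "(\<Sum>g\<in>G'. card {h \<in> generators n G'. h < g}) = (\<Sum>g\<in>G'. card {h \<in> generators n G. h < g})"
  proof (rule sum.cong[OF refl])
    fix g' assume "g' \<in> G'"
    then have "g' < g" using g(2)[of g'] by (auto simp: G'_def)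
    then have "{h \<in> generators n G'. h < g'} = {h \<in> generators n G. h < g'}"
      by (auto simp: generators_def G'_def)
    then show "card {h \<in> generators n G'. h < g'} = card {h \<in> generators n G. h < g'}" by simp
  qed
  also have "p ^ (\<Sum>g\<in>G'. card {h \<in> generators n G. h < g}) * p ^ card {h \<in> generators n G. h < g}
      = p ^ (\<Sum>g\<in>G. card {h \<in> generators n G. h < g})"
    using Suc.prems(1) g(1) by (simp add: G'_def sum.remove power_add)
  finally show ?case .
qed

lemma gaps_times_pi: assumes "M \<in> lattices" shows "gaps ((*) \<pi> ` M) = insert 0 (Suc ` gaps M)"
proof (rule Set.set_eqI)
  fix g show "g \<in> gaps ((*) \<pi> ` M) \<longleftrightarrow> g \<in> insert 0 (Suc ` gaps M)"
  proof (cases g)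
    case 0 then show ?thesis by (auto simp: gaps_def val_def)
  next
    case (Suc h)
    then show ?thesis using val_shift[of 1 _ h] by (auto simp: gaps_def)
  qed
qed

text \<open>
The number \<open>0\<close> is a gap of \<open>M\<close> exactly if every element of \<open>M\<close> is divisible by \<open>\<pi>\<close>.
\<close>

lemma bij_times_pi: "bij_betw ((`) ((*) \<pi>)) lattices {M \<in> lattices. 0 \<in> gaps M}"
proof (rule bij_betw_byWitness[where f' = "\<lambda>M. {x. \<pi> * x \<in> M}"])
  show "\<forall>M\<in>lattices. {x. \<pi> * x \<in> (*) \<pi> ` M} = M" using nonunit by auto
  show "\<forall>M\<in>{M \<in> lattices. 0 \<in> gaps M}. (*) \<pi> ` {x. \<pi> * x \<in> M} = M"
  proof safe
    fix M x assume "M \<in> lattices" "0 \<in> gaps M" "x \<in> M"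
    then have "\<pi> dvd x" by (auto simp: gaps_def val_def)
    then obtain y where "x = \<pi> * y" by (auto simp: dvd_def)
    then show "x \<in> (*) \<pi> ` {x. \<pi> * x \<in> M}" using \<open>x \<in> M\<close> by auto
  qed
  show "(`) ((*) \<pi>) ` lattices \<subseteq> {M \<in> lattices. 0 \<in> gaps M}"
  proof safe
    fix M assume M: "M \<in> lattices"
    obtain k where "pi_ideal k \<subseteq> M" using lattice_pi_ideal[OF M] by blast
    then have "pi_ideal (Suc k) \<subseteq> (*) \<pi> ` M" using pi_ideal_image[of 1 k] by auto
    then show "(*) \<pi> ` M \<in> lattices" using M add_subgroup_times_image by (intro latticeI) (auto simp: p_open_def)
    show "0 \<in> gaps ((*) \<pi> ` M)" by (simp add: gaps_times_pi[OF M])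
  qed
  show "(\<lambda>M. {x. \<pi> * x \<in> M}) ` {M \<in> lattices. 0 \<in> gaps M} \<subseteq> lattices"
  proof safe
    fix M assume M: "M \<in> lattices"
    obtain k where k: "pi_ideal k \<subseteq> M" using lattice_pi_ideal[OF M] by blast
    have "add_subgroup M" using M by (simp add: p_open_def)
    then have "add_subgroup {x. \<pi> * x \<in> M}" by (auto simp: add_subgroup_def right_diff_distrib)
    moreover have "pi_ideal k \<subseteq> {x. \<pi> * x \<in> M}" using k by (auto simp: pi_ideal_def)
    ultimately show "{x. \<pi> * x \<in> M} \<in> lattices" by (rule latticeI)
  qed
qed

end

section \<open>Gap sets and permutations\<close>

text \<open>
The set with \<open>a j\<close> elements in the residue class of \<open>j\<close>, namely \<open>j\<close>, \<open>j + n\<close>, and so on.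
\<close>

definition staircase :: "nat \<Rightarrow> (nat \<Rightarrow> nat) \<Rightarrow> nat set" where
  "staircase n a = {g. g div n < a (g mod n)}"

lemma staircase_mem: "j < n \<Longrightarrow> j + n * t \<in> staircase n a \<longleftrightarrow> t < a j"
  by (simp add: staircase_def)

lemma staircase_eq: "n > 0 \<Longrightarrow> staircase n a = (\<lambda>(j, t). j + n * t) ` (SIGMA j:{..<n}. {..<a j})"
proof (intro equalityI subsetI)
  fix g assume n: "n > 0" and "g \<in> staircase n a"
  then have "(g mod n, g div n) \<in> (SIGMA j:{..<n}. {..<a j})" by (auto simp: staircase_def)
  moreover have "g = (\<lambda>(j, t). j + n * t) (g mod n, g div n)" by simp
  ultimately show "g \<in> (\<lambda>(j, t). j + n * t) ` (SIGMA j:{..<n}. {..<a j})" by (rule rev_image_eqI)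
qed (auto simp: staircase_mem)

lemma staircase_inj: "inj_on (\<lambda>(j, t). j + n * t) ({..<n} \<times> UNIV)" for n :: nat
proof (rule inj_onI)
  fix x y :: "nat \<times> nat" assume *: "x \<in> {..<n} \<times> UNIV" "y \<in> {..<n} \<times> UNIV"
    "(\<lambda>(j, t). j + n * t) x = (\<lambda>(j, t). j + n * t) y"
  obtain j t j' t' where xy: "x = (j, t)" "y = (j', t')" by (cases x, cases y)
  have "(j + n * t) mod n = (j' + n * t') mod n" "(j + n * t) div n = (j' + n * t') div n"
    using *(3) by (simp_all add: xy)
  with *(1,2) show "x = y" by (simp add: xy)
qed

lemma staircase_inj': "inj_on (\<lambda>(j, t). j + n * t) (SIGMA j:{..<n}. {..<a j})" for n :: nat
  by (rule inj_on_subset[OF staircase_inj]) auto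

lemma finite_staircase: "n > 0 \<Longrightarrow> finite (staircase n a)"
  by (simp add: staircase_eq)

lemma card_staircase: "n > 0 \<Longrightarrow> card (staircase n a) = (\<Sum>j<n. a j)"
  by (simp add: staircase_eq card_image[OF staircase_inj'])

lemma generators_staircase: assumes "n > 0"
  shows "generators n (staircase n a) = (\<lambda>i. i + n * a i) ` {..<n}"
proof (intro equalityI subsetI)
  fix h assume h: "h \<in> generators n (staircase n a)"
  have "h div n = a (h mod n)"
  proof (cases "h < n")
    case True then show ?thesis using h by (auto simp: generators_def staircase_def)
  next
    case False
    then have "(h - n) mod n = h mod n" "(h - n) div n = h div n - 1" "h div n \<ge> 1"
      using assms by (auto simp: le_mod_geq le_div_geq)
    then show ?thesis using h False by (auto simp: generators_def staircase_def)
  qed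
  then have "h = h mod n + n * a (h mod n)" by (metis mod_mult_div_eq)
  then show "h \<in> (\<lambda>i. i + n * a i) ` {..<n}" using assms by auto
next
  fix h assume "h \<in> (\<lambda>i. i + n * a i) ` {..<n}"
  then obtain i where i: "i < n" "h = i + n * a i" by auto
  show "h \<in> generators n (staircase n a)"
  proof (cases "a i")
    case 0 then show ?thesis using i by (auto simp: generators_def staircase_def)
  next
    case (Suc t)
    then have "h - n = i + n * t" using i by simp
    moreover have "h \<notin> staircase n a" using staircase_mem[OF i(1), of "a i" a] i(2) by simp
    moreover have "i + n * t \<in> staircase n a" using staircase_mem[OF i(1), of t a] Suc by simp
    ultimately show ?thesis by (simp add: generators_def)
  qed
qed

lemma generator_count_staircase: assumes "n > 0"
  shows "(\<Sum>g\<in>staircase n a. card {h \<in> generators n (staircase n a). h < g})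
    = (\<Sum>j<n. \<Sum>i<n. card {t. t < a j \<and> i + n * a i < j + n * t})"
proof -
  have inj: "inj_on (\<lambda>i. i + n * a i) {..<n}"
  proof (rule inj_onI)
    fix i j assume *: "i \<in> {..<n}" "j \<in> {..<n}" "i + n * a i = j + n * a j"
    then have "(i + n * a i) mod n = (j + n * a j) mod n" by simp
    with *(1,2) show "i = j" by simp
  qed
  have 1: "card {h \<in> generators n (staircase n a). h < g} = (\<Sum>i<n. if i + n * a i < g then 1 else 0)" for g
  proof -
    have "{h \<in> generators n (staircase n a). h < g} = (\<lambda>i. i + n * a i) ` {i \<in> {..<n}. i + n * a i < g}"
      using generators_staircase[OF assms, of a] by auto
    also have "card \<dots> = card {i \<in> {..<n}. i + n * a i < g}"
      by (rule card_image) (rule inj_on_subset[OF inj], auto)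
    also have "\<dots> = (\<Sum>i<n. if i + n * a i < g then 1 else 0)"
      by (subst sum.inter_filter[symmetric]) auto
    finally show ?thesis .
  qed
  have "(\<Sum>g\<in>staircase n a. card {h \<in> generators n (staircase n a). h < g})
     = (\<Sum>(j, t)\<in>(SIGMA j:{..<n}. {..<a j}). \<Sum>i<n. if i + n * a i < j + n * t then 1 else 0)"
    unfolding 1
    unfolding staircase_eq[OF assms] by (subst sum.reindex[OF staircase_inj']) (auto intro!: sum.cong)
  also have "\<dots> = (\<Sum>j<n. \<Sum>t<a j. \<Sum>i<n. if i + n * a i < j + n * t then 1 else 0)"
    by (subst sum.Sigma) auto
  also have "\<dots> = (\<Sum>j<n. \<Sum>i<n. \<Sum>t<a j. if i + n * a i < j + n * t then 1 else 0)"
    by (intro sum.cong refl sum.swap)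
  also have "\<dots> = (\<Sum>j<n. \<Sum>i<n. card {t. t < a j \<and> i + n * a i < j + n * t})"
    by (intro sum.cong refl, subst sum.inter_filter[symmetric]) (auto intro!: arg_cong[of _ _ card])
  finally show ?thesis .
qed

definition inversions :: "nat \<Rightarrow> (nat \<Rightarrow> nat) \<Rightarrow> nat" where
  "inversions N w = card {(i, j). i \<in> {1..N} \<and> j \<in> {1..N} \<and> i < j \<and> w j < w i}"

text \<open>
The increment between consecutive positions of the sorted sequence: \<open>\<delta> m\<close>, and one more at a descent of
\<open>w\<close>.  At \<open>m = 1\<close> the value \<open>w 0 = 0\<close> of a permutation of \<open>{1..N}\<close> is used, so there is no descent.
\<close>

definition jump :: "(nat \<Rightarrow> nat) \<Rightarrow> (nat \<Rightarrow> nat) \<Rightarrow> nat \<Rightarrow> nat" where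
  "jump w \<delta> m = \<delta> m + (if w m < w (m - 1) then 1 else 0)"

text \<open>
The heights of the staircase in terms of the sorting permutation \<open>w\<close> and the increments: the residue class
of \<open>w j\<close> has as height the sum of the first \<open>j\<close> jumps.
\<close>

definition heights :: "(nat \<Rightarrow> nat) \<Rightarrow> (nat \<Rightarrow> nat) \<Rightarrow> nat \<Rightarrow> nat" where
  "heights w \<delta> i = (\<Sum>m\<in>{1..Hilbert_Choice.inv w i}. jump w \<delta> m)"

lemma sum_partial_sums: "(\<Sum>j\<le>N. \<Sum>m\<in>{1..j}. f m) = (\<Sum>m\<in>{1..N}. (Suc N - m) * f m)" for f :: "nat \<Rightarrow> nat"
proof (induction N)
  case (Suc N)
  have "(\<Sum>m\<in>{1..Suc N}. (Suc (Suc N) - m) * f m) = (\<Sum>m\<in>{1..N}. (Suc (Suc N) - m) * f m) + f (Suc N)"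
    by simp
  also have "(\<Sum>m\<in>{1..N}. (Suc (Suc N) - m) * f m) = (\<Sum>m\<in>{1..N}. (Suc N - m) * f m + f m)"
    by (rule sum.cong) (auto simp: Suc_diff_le)
  finally show ?case using Suc by (simp add: sum.distrib)
qed simp

lemma sum_prefix: "(\<Sum>i<M. \<Sum>m\<in>{1..i}. f m) + (\<Sum>m\<in>{1..M}. m * f m) = M * (\<Sum>m\<in>{1..M}. f m)" for f :: "nat \<Rightarrow> nat"
proof (induction M)
  case (Suc M)
  then show ?case by (simp add: algebra_simps)
qed simp

text \<open>
Below, \<open>B j\<close> is the height of the class of \<open>w j\<close> and \<open>v j\<close> the least number of this class that lies outside the
staircase.  The jumps are chosen so that \<open>v\<close> is strictly increasing.
\<close>

locale sorted_heights =
  fixes N :: nat and w \<delta> :: "nat \<Rightarrow> nat"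
  assumes w: "w permutes {1..N}"
begin

definition B :: "nat \<Rightarrow> nat" where "B j = (\<Sum>m\<in>{1..j}. jump w \<delta> m)"

abbreviation "a \<equiv> heights w \<delta>"
abbreviation "n \<equiv> Suc N"

definition v :: "nat \<Rightarrow> nat" where "v j = w j + n * B j"

lemma w0: "w 0 = 0" using permutes_not_in[OF w, of 0] by simp

lemma w_le: "j \<le> N \<Longrightarrow> w j \<le> N"
  using permutes_in_image[OF w, of j] w0 by (cases "j = 0") auto

lemma a_w: "a (w j) = B j"
  using permutes_inverses[OF w] by (simp add: heights_def B_def)

lemma a_0: "a 0 = 0"
  using a_w[of 0] w0 by (simp add: B_def)

lemma bij_w: "bij_betw w {..<n} {..<n}"
proof -
  have "w permutes {..<n}" using w by (rule permutes_subset) auto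
  then show ?thesis by (rule permutes_imp_bij)
qed

lemma v_Suc: "Suc j \<le> N \<Longrightarrow> v j < v (Suc j)"
proof -
  assume j: "Suc j \<le> N"
  have B: "B (Suc j) = B j + jump w \<delta> (Suc j)" by (simp add: B_def)
  have "w j \<noteq> w (Suc j)" using permutes_inj[OF w] by (metis inj_eq n_not_Suc_n)
  moreover have "w j \<le> N" using w_le j by simp
  ultimately consider "w j < w (Suc j)" | "jump w \<delta> (Suc j) \<ge> 1" by (force simp: jump_def)
  then show ?thesis
  proof cases
    case 1 then show ?thesis by (simp add: v_def B algebra_simps add_less_le_mono)
  next
    case 2
    then have "n \<le> n * jump w \<delta> (Suc j)" by (metis mult.right_neutral mult_le_mono2)
    then show ?thesis using \<open>w j \<le> N\<close> unfolding v_def B distrib_left by linarith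
  qed
qed

lemma v_mono: "i < j \<Longrightarrow> j \<le> N \<Longrightarrow> v i < v j"
proof (induction j)
  case (Suc j)
  then show ?case using v_Suc[of j] by (cases "i = j") auto
qed simp

lemma v_mono_le: "i \<le> j \<Longrightarrow> j \<le> N \<Longrightarrow> v i \<le> v j"
  using v_mono[of i j] by (cases "i = j") auto

lemma v_ge: "j \<le> N \<Longrightarrow> j \<le> v j"
proof (induction j)
  case (Suc j)
  then show ?case using v_Suc[of j] by simp
qed simp

lemma sum_heights: "(\<Sum>i<n. a i) = (\<Sum>m\<in>{1..N}. (n - m) * jump w \<delta> m)"
proof -
  have "(\<Sum>i<n. a i) = (\<Sum>j<n. a (w j))" by (rule sum.reindex_bij_betw[OF bij_w, symmetric])
  also have "\<dots> = (\<Sum>j\<le>N. B j)" by (simp only: a_w lessThan_Suc_atMost)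
  finally show ?thesis by (simp only: B_def sum_partial_sums)
qed

text \<open>
The largest element of the staircase is \<open>v N - n\<close>, where \<open>n = N + 1\<close>; for the empty staircase \<open>v N = N\<close>.
\<close>

lemma conductor_heights: "conductor (staircase n a) + N = v N"
proof -
  have "conductor (staircase n a) = v N - N"
  proof (rule conductor_eqI[OF finite_staircase])
    fix k
    show "(\<forall>g\<in>staircase n a. g < k) \<longleftrightarrow> v N - N \<le> k"
    proof
      assume *: "v N - N \<le> k"
      show "\<forall>g\<in>staircase n a. g < k"
      proof
        fix g assume g: "g \<in> staircase n a"
        obtain j where j: "j \<le> N" "w j = g mod n"
          using bij_betw_imp_surj_on[OF bij_w] by (metis imageE lessThan_iff less_Suc_eq_le mod_less_divisor zero_less_Suc)
        have "g div n < B j" using g by (simp add: staircase_def a_w flip: j(2))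
        then have "n * Suc (g div n) \<le> n * B j" by (intro mult_le_mono2) simp
        moreover have "g = g mod n + n * (g div n)" by (simp only: mod_mult_div_eq)
        ultimately have "g + n \<le> v j" unfolding v_def j(2) by (simp only: mult_Suc_right)
        then show "g < k" using v_mono_le[OF j(1)] * by simp
      qed
    next
      assume *: "\<forall>g\<in>staircase n a. g < k"
      show "v N - N \<le> k"
      proof (cases "B N")
        case 0 then show ?thesis using w_le[of N] by (simp add: v_def)
      next
        case (Suc t)
        have "w N + n * t \<in> staircase n a" using staircase_mem[of "w N" n t a] w_le[of N] Suc by (simp add: a_w)
        then have "w N + n * t < k" using * by blast
        then show ?thesis by (simp add: v_def Suc)
      qed
    qed
  qed simp
  then show ?thesis using v_ge[of N] by simp
qed

lemma conductor_sum: "conductor (staircase n a) + (N - w N) = n * (\<Sum>m\<in>{1..N}. jump w \<delta> m)"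
  using conductor_heights w_le[of N] by (simp add: v_def B_def)

lemma inversions_sum: "inversions N w = (\<Sum>j\<le>N. \<Sum>i<j. if w j < w i then 1 else 0)"
proof -
  have "{(i, j). i \<in> {1..N} \<and> j \<in> {1..N} \<and> i < j \<and> w j < w i}
      = prod.swap ` (SIGMA j:{..N}. {i. i < j \<and> w j < w i})"
  proof (intro equalityI subsetI)
    fix z assume "z \<in> {(i, j). i \<in> {1..N} \<and> j \<in> {1..N} \<and> i < j \<and> w j < w i}"
    then show "z \<in> prod.swap ` (SIGMA j:{..N}. {i. i < j \<and> w j < w i})"
      by (intro image_eqI[of _ _ "prod.swap z"]) auto
  next
    fix z assume "z \<in> prod.swap ` (SIGMA j:{..N}. {i. i < j \<and> w j < w i})"
    then obtain i j where ij: "z = (i, j)" "j \<le> N" "i < j" "w j < w i" by auto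
    then have "i \<noteq> 0" using w0 by (metis less_nat_zero_code)
    then show "z \<in> {(i, j). i \<in> {1..N} \<and> j \<in> {1..N} \<and> i < j \<and> w j < w i}" using ij by auto
  qed
  then have "inversions N w = card (SIGMA j:{..N}. {i. i < j \<and> w j < w i})"
    by (simp add: inversions_def card_image)
  also have "\<dots> = (\<Sum>j\<le>N. card {i. i < j \<and> w j < w i})" by simp
  also have "\<dots> = (\<Sum>j\<le>N. \<Sum>i<j. if w j < w i then 1 else 0)"
    by (intro sum.cong refl, subst sum.inter_filter[symmetric]) (auto intro!: arg_cong[of _ _ card])
  finally show ?thesis .
qed

text \<open>
For \<open>i < j\<close>, the elements of the staircase in the class of \<open>w j\<close> above the generator \<open>v i\<close> number
\<open>B j - B i\<close>, or one less if \<open>w j < w i\<close>; for \<open>i \<ge> j\<close> there are none.  Summed over all pairs, the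
corrections add up to the number of inversions, and the jump at \<open>m\<close> contributes to the \<open>m (n - m)\<close> pairs with
\<open>i < m \<le> j\<close>.
\<close>

lemma generator_count_heights:
  "(\<Sum>g\<in>staircase n a. card {h \<in> generators n (staircase n a). h < g}) + inversions N w
    = (\<Sum>m\<in>{1..N}. (n - m) * (m * jump w \<delta> m))"
proof -
  define C where "C i j = card {t. t < B j \<and> w i + n * B i < w j + n * t}" for i j
  have C0: "C i j = 0" if "j \<le> i" "i \<le> N" for i j
  proof -
    have "\<not> (t < B j \<and> w i + n * B i < w j + n * t)" for t
    proof
      assume *: "t < B j \<and> w i + n * B i < w j + n * t"
      then have "n * t \<le> n * B j" by (intro mult_le_mono2) simp
      then show False using v_mono_le[OF that] * unfolding v_def by linarith
    qed
    then show ?thesis by (simp add: C_def)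
  qed
  have C1: "C i j + (if w j < w i then 1 else 0) + B i = B j" if "i < j" "j \<le> N" for i j
  proof -
    have ne: "w i \<noteq> w j" using that permutes_inj[OF w] by (auto simp: inj_def)
    have wle: "w i \<le> N" "w j \<le> N" using w_le that by auto
    have lt: "w i + n * B i < w j + n * t \<longleftrightarrow> (if w j < w i then Suc (B i) \<le> t else B i \<le> t)" for t
    proof (cases t "B i" rule: linorder_cases)
      case less
      then have "n * Suc t \<le> n * B i" by (intro mult_le_mono2) simp
      then show ?thesis using less wle by (simp del: mult_Suc)
    next
      case equal then show ?thesis using ne by auto
    next
      case greater
      then have "n * Suc (B i) \<le> n * t" by (intro mult_le_mono2) simp
      then show ?thesis using greater wle by (simp del: mult_Suc)
    qed
    have le: "(if w j < w i then Suc (B i) else B i) \<le> B j"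
      using v_mono[OF that] lt[of "B j"] unfolding v_def by (auto split: if_splits)
    have "{t. t < B j \<and> w i + n * B i < w j + n * t} = {(if w j < w i then Suc (B i) else B i)..<B j}"
      unfolding lt by auto
    then have "C i j = B j - (if w j < w i then Suc (B i) else B i)" by (simp add: C_def)
    then show ?thesis using le by (auto split: if_splits)
  qed
  have "(\<Sum>g\<in>staircase n a. card {h \<in> generators n (staircase n a). h < g})
     = (\<Sum>j<n. \<Sum>i<n. card {t. t < a j \<and> i + n * a i < j + n * t})"
    by (rule generator_count_staircase) simp
  also have "\<dots> = (\<Sum>j<n. \<Sum>i<n. card {t. t < a (w j) \<and> i + n * a i < w j + n * t})"
    by (rule sum.reindex_bij_betw[OF bij_w, symmetric])
  also have "\<dots> = (\<Sum>j<n. \<Sum>i<n. C i j)"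
  proof (rule sum.cong[OF refl])
    fix j
    have "(\<Sum>i<n. card {t. t < a (w j) \<and> i + n * a i < w j + n * t})
        = (\<Sum>i<n. card {t. t < a (w j) \<and> w i + n * a (w i) < w j + n * t})"
      by (rule sum.reindex_bij_betw[OF bij_w, symmetric])
    then show "(\<Sum>i<n. card {t. t < a (w j) \<and> i + n * a i < w j + n * t}) = (\<Sum>i<n. C i j)"
      by (simp only: C_def a_w)
  qed
  also have "\<dots> = (\<Sum>j\<le>N. \<Sum>i<j. C i j)"
    unfolding lessThan_Suc_atMost
  proof (rule sum.cong[OF refl], rule sum.mono_neutral_right)
    fix j show "\<forall>i\<in>{..N} - {..<j}. C i j = 0" using C0 by auto
  qed auto
  finally have d: "(\<Sum>g\<in>staircase n a. card {h \<in> generators n (staircase n a). h < g}) = (\<Sum>j\<le>N. \<Sum>i<j. C i j)" .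
  have "(\<Sum>i<j. C i j) + (\<Sum>i<j. if w j < w i then 1 else 0) = (\<Sum>m\<in>{1..j}. m * jump w \<delta> m)" if "j \<le> N" for j
  proof -
    have "(\<Sum>i<j. C i j) + (\<Sum>i<j. if w j < w i then 1 else 0) + (\<Sum>i<j. B i) = (\<Sum>i<j. B j)"
      unfolding sum.distrib[symmetric] using that by (intro sum.cong refl C1) auto
    then show ?thesis using sum_prefix[of "jump w \<delta>" j] by (simp add: B_def)
  qed
  then have "(\<Sum>j\<le>N. (\<Sum>i<j. C i j) + (\<Sum>i<j. if w j < w i then 1 else 0)) = (\<Sum>j\<le>N. \<Sum>m\<in>{1..j}. m * jump w \<delta> m)"
    by (intro sum.cong refl) auto
  then show ?thesis unfolding d inversions_sum sum_partial_sums sum.distrib .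
qed

end

text \<open>
The possible gap sets of lattices that are not contained in the maximal ideal.
\<close>

definition gap_sets :: "nat \<Rightarrow> nat set set" where
  "gap_sets n = {G. finite G \<and> 0 \<notin> G \<and> (\<forall>g\<in>G. n \<le> g \<longrightarrow> g - n \<in> G)}"

lemma sorting_unique:
  fixes v :: "nat \<Rightarrow> nat"
  assumes v: "inj_on v {1..N}" and w: "w permutes {1..N}" "w' permutes {1..N}"
    and "\<And>i j. 1 \<le> i \<Longrightarrow> i < j \<Longrightarrow> j \<le> N \<Longrightarrow> v (w i) < v (w j)"
    and "\<And>i j. 1 \<le> i \<Longrightarrow> i < j \<Longrightarrow> j \<le> N \<Longrightarrow> v (w' i) < v (w' j)"
  shows "w = w'"
proof
  have *: "sorted_wrt (<) (map (\<lambda>j. v (u j)) [1..<Suc N])"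
    if "\<And>i j. 1 \<le> i \<Longrightarrow> i < j \<Longrightarrow> j \<le> N \<Longrightarrow> v (u i) < v (u j)" for u
    by (auto simp: sorted_wrt_iff_nth_less that simp del: upt_Suc)
  have set: "set (map (\<lambda>j. v (u j)) [1..<Suc N]) = v ` {1..N}" if "u permutes {1..N}" for u
    using permutes_image[OF that] by (simp add: image_image[symmetric] atLeastLessThanSuc_atLeastAtMost del: upt_Suc)
  have "map (\<lambda>j. v (w j)) [1..<Suc N] = map (\<lambda>j. v (w' j)) [1..<Suc N]"
    using *[OF assms(4)] *[OF assms(5)] set[OF w(1)] set[OF w(2)] by (intro strict_sorted_equal) auto
  then have eq: "v (w j) = v (w' j)" if "j \<in> {1..N}" for j
    using that by (auto simp del: upt_Suc)
  fix j show "w j = w' j"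
  proof (cases "j \<in> {1..N}")
    case True
    then show ?thesis using eq[OF True] v permutes_in_image[OF w(1)] permutes_in_image[OF w(2)]
      by (meson inj_onD)
  next
    case False then show ?thesis using w by (simp add: permutes_not_in)
  qed
qed

lemma exists_sorting:
  fixes v :: "nat \<Rightarrow> nat"
  assumes v: "inj_on v {1..N}"
  shows "\<exists>w. w permutes {1..N} \<and> (\<forall>i j. 1 \<le> i \<longrightarrow> i < j \<longrightarrow> j \<le> N \<longrightarrow> v (w i) < v (w j))"
proof -
  define xs where "xs = sorted_list_of_set (v ` {1..N})"
  have len: "length xs = N" using v by (simp add: xs_def card_image)
  have set: "set xs = v ` {1..N}" by (simp add: xs_def)
  define w where "w j = (if j \<in> {1..N} then inv_into {1..N} v (xs ! (j - 1)) else j)" for j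
  have mem: "xs ! (j - 1) \<in> v ` {1..N}" if "j \<in> {1..N}" for j
    using that len nth_mem[of "j - 1" xs] set by auto
  have vw: "v (w j) = xs ! (j - 1)" if "j \<in> {1..N}" for j
    using mem[OF that] that by (simp add: w_def f_inv_into_f)
  have mono: "v (w i) < v (w j)" if "1 \<le> i" "i < j" "j \<le> N" for i j
  proof -
    have "xs ! (i - 1) < xs ! (j - 1)"
      using that len strict_sorted_list_of_set[of "v ` {1..N}"] by (intro sorted_wrt_nth_less[of "(<)"]) (auto simp: xs_def)
    then show ?thesis using that by (simp add: vw)
  qed
  have "inj_on w {1..N}"
  proof (rule inj_onI)
    fix i j assume *: "i \<in> {1..N}" "j \<in> {1..N}" "w i = w j"
    then show "i = j" using mono[of i j] mono[of j i] by (metis atLeastAtMost_iff less_irrefl linorder_neqE_nat)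
  qed
  moreover have "w ` {1..N} \<subseteq> {1..N}"
  proof
    fix y assume "y \<in> w ` {1..N}"
    then obtain j where j: "j \<in> {1..N}" "y = w j" by blast
    show "y \<in> {1..N}" using inv_into_into[OF mem[OF j(1)]] j by (simp add: w_def)
  qed
  ultimately have "bij_betw w {1..N} {1..N}" by (simp add: bij_betw_def endo_inj_surj)
  then have "w permutes {1..N}" by (rule bij_imp_permutes) (auto simp: w_def)
  then show ?thesis using mono by blast
qed

text \<open>
Given a gap set, sort the least non-gaps \<open>v i = i + n a i\<close> of the residue classes by size.  As these numbers are
pairwise distinct, \<open>w\<close> is unique; and \<open>v (w (m - 1)) < v (w m)\<close> means that the heights increase weakly, and strictly where \<open>w\<close> descends.
\<close>

lemma bij_gap_sets:
  "bij_betw (\<lambda>(w, \<delta>). staircase (Suc N) (heights w \<delta>))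
     ({w. w permutes {1..N}} \<times> ({1..N} \<rightarrow>\<^sub>E UNIV)) (gap_sets (Suc N))"
  unfolding bij_betw_def
proof
  let ?n = "Suc N"
  show "inj_on (\<lambda>(w, \<delta>). staircase ?n (heights w \<delta>)) ({w. w permutes {1..N}} \<times> ({1..N} \<rightarrow>\<^sub>E UNIV))"
  proof (rule inj_onI, clarify)
    fix w \<delta> w' \<delta>' assume w: "w permutes {1..N}" "w' permutes {1..N}"
      and \<delta>: "\<delta> \<in> {1..N} \<rightarrow>\<^sub>E (UNIV :: nat set)" "\<delta>' \<in> {1..N} \<rightarrow>\<^sub>E (UNIV :: nat set)"
      and eq: "staircase ?n (heights w \<delta>) = staircase ?n (heights w' \<delta>')"
    interpret s: sorted_heights N w \<delta> by standard (rule w)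
    interpret s': sorted_heights N w' \<delta>' by standard (rule w)
    have h: "heights w \<delta> i = heights w' \<delta>' i" if "i \<le> N" for i
    proof -
      have "t < heights w \<delta> i \<longleftrightarrow> t < heights w' \<delta>' i" for t
        using that staircase_mem[of i ?n t] eq by (metis less_Suc_eq_le)
      then show ?thesis by (meson linorder_neqE_nat less_irrefl)
    qed
    define v where "v i = i + ?n * heights w \<delta> i" for i
    have v: "v (w j) = s.v j" for j by (simp add: v_def s.v_def s.a_w)
    have v': "v (w' j) = s'.v j" if "j \<le> N" for j
      using h[OF s'.w_le[OF that]] s'.a_w[of j] by (simp add: v_def s'.v_def)
    have "inj_on v {1..N}"
    proof (rule inj_onI)
      fix i j assume *: "i \<in> {1..N}" "j \<in> {1..N}" "v i = v j"
      then have "v i mod ?n = v j mod ?n" by simp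
      with *(1,2) show "i = j" by (simp add: v_def del: mult_Suc)
    qed
    then have ww: "w = w'"
      using w by (rule sorting_unique) (use s.v_mono s'.v_mono v v' in auto)
    have B: "s.B j = s'.B j" if "j \<le> N" for j
      using s.a_w[of j] s'.a_w[of j] h[OF s.w_le[OF that]] ww by simp
    have "\<delta> m = \<delta>' m" for m
    proof (cases "m \<in> {1..N}")
      case True
      then obtain k where k: "m = Suc k" "Suc k \<le> N" by (cases m) auto
      then have "jump w \<delta> m = jump w' \<delta>' m" using B[of k] B[of "Suc k"] by (simp add: s.B_def s'.B_def)
      then show ?thesis by (simp add: jump_def ww)
    next
      case False then show ?thesis using PiE_arb[OF \<delta>(1) False] PiE_arb[OF \<delta>(2) False] by simp
    qed
    then show "w = w' \<and> \<delta> = \<delta>'" using ww by auto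
  qed
  show "(\<lambda>(w, \<delta>). staircase ?n (heights w \<delta>)) ` ({w. w permutes {1..N}} \<times> ({1..N} \<rightarrow>\<^sub>E UNIV)) = gap_sets ?n"
  proof (intro equalityI subsetI)
    fix G assume "G \<in> (\<lambda>(w, \<delta>). staircase ?n (heights w \<delta>)) ` ({w. w permutes {1..N}} \<times> ({1..N} \<rightarrow>\<^sub>E UNIV))"
    then obtain w \<delta> where w: "w permutes {1..N}" and G: "G = staircase ?n (heights w \<delta>)" by auto
    interpret s: sorted_heights N w \<delta> by standard (rule w)
    have "finite G" "0 \<notin> G" using s.a_0 by (simp_all only: G finite_staircase) (simp add: staircase_def)
    moreover have "g - ?n \<in> G" if "g \<in> G" "?n \<le> g" for g
    proof -
      have "(g - ?n) mod ?n = g mod ?n" "(g - ?n) div ?n = g div ?n - 1"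
        using that by (auto simp: le_mod_geq le_div_geq)
      then show ?thesis using that by (auto simp: G staircase_def)
    qed
    ultimately show "G \<in> gap_sets ?n" by (simp add: gap_sets_def)
  next
    fix G assume "G \<in> gap_sets ?n"
    then have G: "finite G" "0 \<notin> G" "\<And>g. g \<in> G \<Longrightarrow> ?n \<le> g \<Longrightarrow> g - ?n \<in> G" by (auto simp: gap_sets_def)
    have ex: "\<exists>t. i + ?n * t \<notin> G" for i
    proof -
      obtain k where k: "\<forall>g\<in>G. g < k" using G(1) finite_nat_set_iff_bounded by blast
      then have "i + ?n * k \<notin> G" by auto
      then show ?thesis ..
    qed
    \<comment> \<open>By closure under subtraction of \<open>n\<close>, the elements of \<open>G\<close> in a residue class form an initial segment.\<close>
    define a where "a i = (LEAST t. i + ?n * t \<notin> G)" for i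
    have a1: "i + ?n * a i \<notin> G" for i unfolding a_def by (rule LeastI_ex[OF ex])
    have a2: "i + ?n * t \<in> G \<longleftrightarrow> t < a i" for i t
    proof
      show "t < a i \<Longrightarrow> i + ?n * t \<in> G" unfolding a_def using not_less_Least by blast
      assume t: "i + ?n * t \<in> G"
      show "t < a i"
      proof (rule ccontr)
        assume "\<not> t < a i"
        then have "i + ?n * (t - k) \<in> G" if "k \<le> t - a i" for k
          using that
        proof (induction k)
          case 0 then show ?case using t by simp
        next
          case (Suc k)
          then have "i + ?n * (t - k) \<in> G" by simp
          moreover have "t - k = Suc (t - Suc k)" using Suc.prems by simp
          ultimately show ?case using G(3)[of "i + ?n * (t - k)"] by simp
        qed
        from this[of "t - a i"] show False using a1[of i] \<open>\<not> t < a i\<close> by simp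
      qed
    qed
    have a0: "a 0 = 0" using a2[of 0 0] G(2) by simp
    have Ga: "g \<in> G \<longleftrightarrow> g div ?n < a (g mod ?n)" for g
      using a2[of "g mod ?n" "g div ?n"] by (simp only: mod_mult_div_eq)
    define v where "v i = i + ?n * a i" for i
    have "inj_on v {1..N}"
    proof (rule inj_onI)
      fix i j assume *: "i \<in> {1..N}" "j \<in> {1..N}" "v i = v j"
      then have "v i mod ?n = v j mod ?n" by simp
      with *(1,2) show "i = j" by (simp add: v_def del: mult_Suc)
    qed
    then obtain w where w: "w permutes {1..N}"
      and mono: "\<And>i j. 1 \<le> i \<Longrightarrow> i < j \<Longrightarrow> j \<le> N \<Longrightarrow> v (w i) < v (w j)" using exists_sorting by blast
    have w0: "w 0 = 0" using permutes_not_in[OF w, of 0] by simp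
    define D where "D m = (if w m < w (m - 1) then 1 else 0 :: nat)" for m
    have step: "a (w (m - 1)) + D m \<le> a (w m)" if m: "m \<in> {1..N}" for m
    proof (cases "m = 1")
      case True then show ?thesis using w0 a0 by (simp add: D_def)
    next
      case False
      have wle: "w (m - 1) \<le> N" "w m \<le> N"
        using permutes_in_image[OF w, of m] permutes_in_image[OF w, of "m - 1"] m False by auto
      have lt: "w (m - 1) + ?n * a (w (m - 1)) < w m + ?n * a (w m)"
        using mono[of "m - 1" m] m False unfolding v_def by force
      show ?thesis
      proof (rule ccontr)
        assume "\<not> a (w (m - 1)) + D m \<le> a (w m)"
        moreover have "D m = 0 \<or> D m = 1" by (simp add: D_def)
        ultimately have "Suc (a (w m)) \<le> a (w (m - 1)) \<or> a (w m) = a (w (m - 1)) \<and> D m = 1" by linarith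
        then consider "Suc (a (w m)) \<le> a (w (m - 1))" | "a (w m) = a (w (m - 1))" "D m = 1" by blast
        then show False
        proof cases
          case 1
          then have "?n * Suc (a (w m)) \<le> ?n * a (w (m - 1))" by (rule mult_le_mono2)
          then show False using lt wle by (simp del: mult_Suc)
        next
          case 2 then show False using lt by (auto simp: D_def split: if_splits)
        qed
      qed
    qed
    define \<delta> where "\<delta> = restrict (\<lambda>m. a (w m) - a (w (m - 1)) - D m) {1..N}"
    have jump: "jump w \<delta> m = a (w m) - a (w (m - 1))" if "m \<in> {1..N}" for m
    proof -
      have "jump w \<delta> m = \<delta> m + D m" by (simp add: jump_def D_def)
      then show ?thesis using step[OF that] that by (simp add: \<delta>_def)
    qed
    interpret s: sorted_heights N w \<delta> by standard (rule w)
    have Bj: "s.B j = a (w j)" if "j \<le> N" for j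
      using that
    proof (induction j)
      case 0 then show ?case using w0 a0 by (simp add: s.B_def)
    next
      case (Suc j)
      have "s.B (Suc j) = s.B j + jump w \<delta> (Suc j)" by (simp add: s.B_def)
      then show ?case using Suc jump[of "Suc j"] step[of "Suc j"] by simp
    qed
    have hts: "heights w \<delta> i = a i" if "i \<le> N" for i
    proof -
      have "i \<in> w ` {..<?n}" using bij_betw_imp_surj_on[OF s.bij_w] that by simp
      then obtain j where j: "j \<le> N" "w j = i" by (auto simp: less_Suc_eq_le)
      then show ?thesis using s.a_w[of j] Bj[of j] by simp
    qed
    have "heights w \<delta> (g mod ?n) = a (g mod ?n)" for g
      by (rule hts) (use mod_less_divisor[of ?n g] in linarith)
    then have "staircase ?n (heights w \<delta>) = G" using Ga by (auto simp: staircase_def)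
    moreover have "\<delta> \<in> {1..N} \<rightarrow>\<^sub>E UNIV" by (simp add: \<delta>_def)
    ultimately show "G \<in> (\<lambda>(w, \<delta>). staircase ?n (heights w \<delta>)) ` ({w. w permutes {1..N}} \<times> ({1..N} \<rightarrow>\<^sub>E UNIV))"
      using w by (intro image_eqI[of _ _ "(w, \<delta>)"]) auto
  qed
qed

section \<open>Coxeter length and inversions\<close>

lemma adjacent_permutes: "i \<in> {1..N - 1} \<Longrightarrow> adjacent_transposition i permutes {1..N}"
  unfolding adjacent_transposition_def by (rule permutes_swap_id) auto

lemma adjacent_invol: "adjacent_transposition i \<circ> adjacent_transposition i = id"
  by (simp add: adjacent_transposition_def)

lemma adjacent_simps:
  "adjacent_transposition i i = Suc i" "adjacent_transposition i (Suc i) = i"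
  "j \<noteq> i \<Longrightarrow> j \<noteq> Suc i \<Longrightarrow> adjacent_transposition i j = j"
  by (auto simp: adjacent_transposition_def)

definition inversion_set :: "nat \<Rightarrow> (nat \<Rightarrow> nat) \<Rightarrow> (nat \<times> nat) set" where
  "inversion_set N w = {(i, j). i \<in> {1..N} \<and> j \<in> {1..N} \<and> i < j \<and> w j < w i}"

lemma inversions_card: "inversions N w = card (inversion_set N w)"
  by (simp add: inversions_def inversion_set_def)

lemma finite_inversion_set: "finite (inversion_set N w)"
  by (rule finite_subset[of _ "{1..N} \<times> {1..N}"]) (auto simp: inversion_set_def)

text \<open>
The transposition of the positions \<open>i\<close> and \<open>i + 1\<close> preserves the order of every other pair of positions, so it
maps the remaining inversions bijectively.
\<close>

lemma inversions_ascent: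
  assumes i: "i \<in> {1..N - 1}" and asc: "w i < w (Suc i)"
  shows "inversions N (w \<circ> adjacent_transposition i) = Suc (inversions N w)"
proof -
  let ?s = "adjacent_transposition i"
  have ss: "?s (?s x) = x" for x using fun_cong[OF adjacent_invol] by simp
  have lt: "?s a < ?s b" if "a < b" "(a, b) \<noteq> (i, Suc i)" for a b
    using that unfolding adjacent_transposition_def Transposition.transpose_def by (auto split: if_splits)
  have mem: "?s a \<in> {1..N} \<longleftrightarrow> a \<in> {1..N}" for a
    using permutes_in_image[OF adjacent_permutes[OF i]] .
  let ?A = "inversion_set N (w \<circ> ?s) - {(i, Suc i)}"
  have "bij_betw (map_prod ?s ?s) ?A (inversion_set N w)"
  proof (rule bij_betw_byWitness[where f' = "map_prod ?s ?s"])
    show "map_prod ?s ?s ` ?A \<subseteq> inversion_set N w"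
      using lt mem by (auto simp: inversion_set_def)
    show "map_prod ?s ?s ` inversion_set N w \<subseteq> ?A"
    proof
      fix z assume "z \<in> map_prod ?s ?s ` inversion_set N w"
      then obtain a b where ab: "z = (?s a, ?s b)" "a \<in> {1..N}" "b \<in> {1..N}" "a < b" "w b < w a"
        by (auto simp: inversion_set_def)
      have ne: "(a, b) \<noteq> (i, Suc i)" using ab asc by auto
      have "(?s a, ?s b) \<noteq> (i, Suc i)"
      proof
        assume "(?s a, ?s b) = (i, Suc i)"
        then have "?s (?s a) = Suc i" "?s (?s b) = i" by (simp_all add: adjacent_simps)
        then show False using ab ss by simp
      qed
      moreover have "?s a \<in> {1..N}" "?s b \<in> {1..N}" using ab mem by blast+
      ultimately show "z \<in> ?A" using ab(1,5) lt[OF ab(4) ne] ss by (simp add: inversion_set_def)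
    qed
  qed (auto simp: ss)
  then have eq: "card ?A = card (inversion_set N w)" by (rule bij_betw_same_card)
  have "(i, Suc i) \<in> inversion_set N (w \<circ> ?s)"
    using i asc by (auto simp: inversion_set_def adjacent_simps)
  from card.remove[OF finite_inversion_set this] show ?thesis
    by (simp only: inversions_card eq)
qed

lemma inversions_descent:
  assumes i: "i \<in> {1..N - 1}" and desc: "w (Suc i) < w i"
  shows "inversions N w = Suc (inversions N (w \<circ> adjacent_transposition i))"
proof -
  have "(w \<circ> adjacent_transposition i) \<circ> adjacent_transposition i = w"
    by (simp add: comp_assoc adjacent_invol)
  then show ?thesis
    using inversions_ascent[OF i, of "w \<circ> adjacent_transposition i"] desc by (simp add: adjacent_simps)
qed

lemma inversions_adjacent_le:
  assumes "i \<in> {1..N - 1}" "w permutes {1..N}"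
  shows "inversions N (w \<circ> adjacent_transposition i) \<le> Suc (inversions N w)"
proof -
  have "w i \<noteq> w (Suc i)" using permutes_inj[OF assms(2)] by (metis inj_eq n_not_Suc_n)
  then consider "w i < w (Suc i)" | "w (Suc i) < w i" by linarith
  then show ?thesis
    using inversions_ascent[of i N w] inversions_descent[of i N w] assms(1) by cases auto
qed

lemma increasing_of_no_descent:
  assumes "\<And>i. 1 \<le> i \<Longrightarrow> Suc i \<le> M \<Longrightarrow> w i < w (Suc i)"
  shows "1 \<le> i \<Longrightarrow> i < j \<Longrightarrow> j \<le> M \<Longrightarrow> w i < (w j :: nat)"
proof (induction j)
  case (Suc j)
  then show ?case using assms[of j] by (cases "i = j") auto
qed simp

lemma exists_descent_or_id:
  assumes "w permutes {1..N}"
  shows "w = id \<or> (\<exists>i\<in>{1..N - 1}. w (Suc i) < w i)"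
proof (rule disjCI)
  assume *: "\<not> (\<exists>i\<in>{1..N - 1}. w (Suc i) < w i)"
  have "w i < w (Suc i)" if "1 \<le> i" "Suc i \<le> N" for i
  proof -
    have "w i \<noteq> w (Suc i)" using permutes_inj[OF assms] by (metis inj_eq n_not_Suc_n)
    then show ?thesis using * that by (metis Suc_eq_plus1 add_le_imp_le_diff atLeastAtMost_iff linorder_neqE_nat)
  qed
  then have mono: "w i < w j" if "1 \<le> i" "i < j" "j \<le> N" for i j
    using increasing_of_no_descent[of N w i j] that by blast
  show "w = id"
    by (rule sorting_unique[of "\<lambda>x. x" N]) (use assms permutes_id mono in auto)
qed

definition word_perm :: "nat list \<Rightarrow> nat \<Rightarrow> nat" where
  "word_perm is = foldr (\<circ>) (map adjacent_transposition is) id"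

lemma word_perm_Nil: "word_perm [] = id"
  by (simp add: word_perm_def)

lemma word_perm_snoc: "word_perm (is @ [i]) = word_perm is \<circ> adjacent_transposition i"
proof -
  have "foldr (\<circ>) fs f = foldr (\<circ>) fs id \<circ> f" for fs and f :: "nat \<Rightarrow> nat"
    by (induction fs) (auto simp: comp_assoc)
  from this[of _ "adjacent_transposition i"] show ?thesis by (simp add: word_perm_def)
qed

lemma word_perm_inversions:
  "set is \<subseteq> {1..N - 1} \<Longrightarrow> word_perm is permutes {1..N} \<and> inversions N (word_perm is) \<le> length is"
proof (induction "is" rule: rev_induct)
  case Nil
  have e: "inversion_set N id = {}" by (auto simp: inversion_set_def)
  show ?case unfolding word_perm_Nil inversions_card e by (intro conjI permutes_id) simp
next
  case (snoc i "is")
  then have i: "i \<in> {1..N - 1}" and IH: "word_perm is permutes {1..N}" "inversions N (word_perm is) \<le> length is"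
    by auto
  have 1: "word_perm (is @ [i]) permutes {1..N}"
    by (subst word_perm_snoc) (rule permutes_compose[OF adjacent_permutes[OF i] IH(1)])
  have "inversions N (word_perm (is @ [i])) \<le> Suc (length is)"
    by (subst word_perm_snoc) (use inversions_adjacent_le[OF i IH(1)] IH(2) in linarith)
  with 1 show ?case by simp
qed

lemma reduced_word:
  "w permutes {1..N} \<Longrightarrow> \<exists>is. set is \<subseteq> {1..N - 1} \<and> length is = inversions N w \<and> word_perm is = w"
proof (induction "inversions N w" arbitrary: w rule: less_induct)
  case less
  consider "w = id" | i where "i \<in> {1..N - 1}" "w (Suc i) < w i"
    using exists_descent_or_id[OF less.prems] by blast
  then show ?case
  proof cases
    case 1
    then show ?thesis using word_perm_inversions[of "[]" N] by (intro exI[of _ "[]"]) (auto simp: word_perm_Nil)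
  next
    case 2
    let ?u = "w \<circ> adjacent_transposition i"
    have "inversions N w = Suc (inversions N ?u)" by (rule inversions_descent[OF 2])
    moreover have "?u permutes {1..N}" by (rule permutes_compose[OF adjacent_permutes[OF 2(1)] less.prems])
    ultimately obtain "is" where "set is \<subseteq> {1..N - 1}" "length is = inversions N ?u" "word_perm is = ?u"
      using less.hyps[of ?u] by auto
    then show ?thesis using 2 \<open>inversions N w = Suc (inversions N ?u)\<close>
      by (intro exI[of _ "is @ [i]"]) (auto simp: word_perm_snoc comp_assoc adjacent_invol)
  qed
qed

theorem coxeter_length_inversions:
  assumes "w permutes {1..N}" shows "coxeter_length N w = inversions N w"
  unfolding coxeter_length_def word_perm_def[symmetric]
proof (rule Least_equality)
  show "\<exists>is. set is \<subseteq> {1..N - 1} \<and> length is = inversions N w \<and> word_perm is = w"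
    by (rule reduced_word[OF assms])
  show "inversions N w \<le> k" if "\<exists>is. set is \<subseteq> {1..N - 1} \<and> length is = k \<and> word_perm is = w" for k
    using that word_perm_inversions by blast
qed

text \<open>
The inversions that involve the last position correspond to the values above \<open>w N\<close>; if \<open>w\<close> increases on the
other positions, there are no further ones.
\<close>

lemma inversions_last:
  assumes w: "w permutes {1..N}"
  shows "N - w N \<le> inversions N w"
    and "(\<And>i. i \<in> {1..N - 2} \<Longrightarrow> w i < w (Suc i)) \<Longrightarrow> inversions N w = N - w N"
proof -
  define A where "A = (\<lambda>y. (Hilbert_Choice.inv w y, N)) ` {w N<..N}"
  have inj: "inj_on (\<lambda>y. (Hilbert_Choice.inv w y, N)) {w N<..N}"
    using permutes_inj[OF permutes_inv[OF w]] by (auto simp: inj_on_def inj_def)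
  have cA: "card A = N - w N" by (simp add: A_def card_image[OF inj])
  have A: "A \<subseteq> inversion_set N w"
  proof
    fix z assume "z \<in> A"
    then obtain y where y: "z = (Hilbert_Choice.inv w y, N)" "w N < y" "y \<le> N" by (auto simp: A_def)
    define i where "i = Hilbert_Choice.inv w y"
    have wi: "w i = y" using permutes_inverses[OF w] by (simp add: i_def)
    have "i \<in> {1..N}" using permutes_in_image[OF w, of i] wi y by auto
    moreover have "i \<noteq> N" using wi y by auto
    ultimately show "z \<in> inversion_set N w" using y wi by (auto simp: inversion_set_def i_def[symmetric])
  qed
  then show "N - w N \<le> inversions N w"
    unfolding inversions_card cA[symmetric] by (rule card_mono[OF finite_inversion_set])
  assume asc: "\<And>i. i \<in> {1..N - 2} \<Longrightarrow> w i < w (Suc i)"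
  have mono: "w i < w j" if "1 \<le> i" "i < j" "j \<le> N - 1" for i j
    by (rule increasing_of_no_descent[of "N - 1" w]) (use asc that in auto)
  have "inversion_set N w \<subseteq> A"
  proof
    fix z assume "z \<in> inversion_set N w"
    then obtain i j where z: "z = (i, j)" "1 \<le> i" "i < j" "j \<le> N" "w j < w i" by (auto simp: inversion_set_def)
    have "\<not> j \<le> N - 1" using mono[of i j] z by auto
    then have j: "j = N" using z by linarith
    have "w i \<in> {w N<..N}" using z j permutes_in_image[OF w, of i] by auto
    moreover have "Hilbert_Choice.inv w (w i) = i" using permutes_inverses[OF w] by simp
    ultimately show "z \<in> A" unfolding A_def z(1) j by (intro image_eqI[of _ _ "w i"]) auto
  qed
  with A have "inversion_set N w = A" by blast
  then show "inversions N w = N - w N" by (simp add: inversions_card cA)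
qed

text \<open>
The parabolic subgroup fixes \<open>N\<close>, so all elements of the coset have the same last value and at least
\<open>N - w N\<close> inversions.  An element of the coset with the fewest inversions has no descent at a position below \<open>N - 1\<close>, since
otherwise a generator would reduce the number; hence it attains the bound.
\<close>

theorem parabolic_length_last:
  assumes w: "w permutes {1..N}"
  shows "parabolic_length N {1..N - 2} w = N - w N"
proof -
  define W where "W = generate (sym_group N) (adjacent_transposition ` {1..N - 2})"
  have gen: "adjacent_transposition i \<in> W" if "i \<in> {1..N - 2}" for i
    unfolding W_def using that by (intro generate.incl) auto
  have adj: "adjacent_transposition i permutes {1..N}" if "i \<in> {1..N - 2}" for i
    using adjacent_permutes[of i N] that by auto
  have closed: "u \<circ> adjacent_transposition i \<in> W" if "u \<in> W" "i \<in> {1..N - 2}" for u i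
    using generate.eng[of u "sym_group N" _ "adjacent_transposition i"] gen[OF that(2)] that(1)
    by (auto simp: W_def sym_group_mult)
  have id: "id \<in> W" using generate.one[of "sym_group N"] by (simp add: W_def sym_group_one)
  have W: "u permutes {1..N} \<and> u N = N" if "u \<in> W" for u
    using that unfolding W_def
  proof (induction u rule: generate.induct)
    case one then show ?case using permutes_id by (simp add: sym_group_one id_def)
  next
    case (incl h)
    then show ?case using adj by (auto simp: adjacent_simps)
  next
    case (inv h)
    then obtain i where i: "h = adjacent_transposition i" "i \<in> {1..N - 2}" by auto
    have "inv\<^bsub>sym_group N\<^esub> h = h"
      using adj[OF i(2)] adjacent_invol[of i]
      by (intro group.inv_equality[OF sym_group_is_group])
         (simp_all add: i(1) sym_group_carrier sym_group_mult sym_group_one)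
    then show ?case using adj[OF i(2)] i by (auto simp: adjacent_simps)
  next
    case (eng h1 h2)
    then have "h1 \<circ> h2 permutes {1..N}" "(h1 \<circ> h2) N = N" using permutes_compose[of h2 "{1..N}" h1] by auto
    then show ?case unfolding sym_group_mult by blast
  qed
  have coset: "w <#\<^bsub>sym_group N\<^esub> W = (\<lambda>u. w \<circ> u) ` W"
    by (auto simp: l_coset_def sym_group_mult)
  have perm: "w \<circ> u permutes {1..N}" if "u \<in> W" for u using W[OF that] permutes_compose[of u "{1..N}" w] w by blast
  obtain u where u: "u \<in> W" "\<And>u'. u' \<in> W \<Longrightarrow> inversions N (w \<circ> u) \<le> inversions N (w \<circ> u')"
    using exists_least_iff[of "\<lambda>k. \<exists>u\<in>W. inversions N (w \<circ> u) = k"] id by (metis linorder_not_le)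
  have "inversions N (w \<circ> u) = N - (w \<circ> u) N"
  proof (rule inversions_last(2)[OF perm[OF u(1)]])
    fix i assume i: "i \<in> {1..N - 2}"
    then have i': "i \<in> {1..N - 1}" by auto
    have "(w \<circ> u) i \<noteq> (w \<circ> u) (Suc i)"
      using permutes_inj[OF perm[OF u(1)]] by (metis inj_eq n_not_Suc_n)
    moreover have "\<not> (w \<circ> u) (Suc i) < (w \<circ> u) i"
    proof
      assume "(w \<circ> u) (Suc i) < (w \<circ> u) i"
      moreover have "inversions N (w \<circ> u) \<le> inversions N ((w \<circ> u) \<circ> adjacent_transposition i)"
        using u(2)[OF closed[OF u(1) i]] by (simp only: comp_assoc)
      ultimately show False using inversions_descent[OF i', of "w \<circ> u"] by linarith
    qed
    ultimately show "(w \<circ> u) i < (w \<circ> u) (Suc i)" by linarith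
  qed
  then have min: "coxeter_length N (w \<circ> u) = N - w N"
    using W[OF u(1)] by (simp add: coxeter_length_inversions[OF perm[OF u(1)]])
  have "parabolic_length N {1..N - 2} w = Min (coxeter_length N ` (\<lambda>u. w \<circ> u) ` W)"
    unfolding parabolic_length_def W_def[symmetric] coset by (rule refl)
  also have "\<dots> = N - w N"
  proof (rule Min_eqI)
    have "(\<lambda>u. w \<circ> u) ` W \<subseteq> {w. w permutes {1..N}}" using perm by auto
    from finite_imageI[OF finite_subset[OF this finite_permutations[OF finite_atLeastAtMost]]]
    show "finite (coxeter_length N ` (\<lambda>u. w \<circ> u) ` W)" .
    fix k assume "k \<in> coxeter_length N ` (\<lambda>u. w \<circ> u) ` W"
    then obtain u' where u': "u' \<in> W" "k = inversions N (w \<circ> u')"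
      using coxeter_length_inversions[OF perm] by auto
    then show "N - w N \<le> k" using inversions_last(1)[OF perm[OF u'(1)]] W[OF u'(1)] by simp
  next
    show "N - w N \<in> coxeter_length N ` (\<lambda>u. w \<circ> u) ` W" using u(1) min by (metis image_eqI)
  qed
  finally show ?thesis .
qed

section \<open>The generating function of gap sets\<close>

text \<open>
In the coordinates \<open>(w, \<delta>)\<close> of \<open>bij_gap_sets\<close>, the summand is a constant depending on \<open>w\<close> times the product of
the \<open>q m ^ jump w \<delta> m\<close>.
\<close>

lemma has_sum_gap_sets:
  fixes P T :: complex and N :: nat
  defines "n \<equiv> Suc N"
  defines "q \<equiv> \<lambda>m. P ^ ((2 * n + m) * (n - m)) * T ^ (3 * n - m)"
  assumes P: "P \<noteq> 0" and T: "T \<noteq> 0" and q: "\<And>m. m \<in> {1..N} \<Longrightarrow> norm (q m) < 1"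
  shows "((\<lambda>G. P ^ (\<Sum>g\<in>G. card {h \<in> generators n G. h < g}) * (P ^ (2 * n) * T) ^ card G * T ^ (2 * conductor G))
     has_sum ((\<Sum>w | w permutes {1..N}. inverse (P ^ inversions N w) * inverse (T ^ (2 * (N - w N)))
          * (\<Prod>j\<in>right_descents N w. q (j + 1))) / (\<Prod>m = 1..N. (1 - q m)))) (gap_sets n)"
    (is "(?f has_sum ?S) _")
proof -
  define c where "c w = inverse (P ^ inversions N w) * inverse (T ^ (2 * (N - w N)))
          * (\<Prod>j\<in>right_descents N w. q (j + 1))" for w
  define F where "F = (\<lambda>(w, \<delta>). c w * (\<Prod>m\<in>{1..N}. q m ^ \<delta> m))"
  have "(F has_sum ?S) ({w. w permutes {1..N}} \<times> ({1..N} \<rightarrow>\<^sub>E UNIV))"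
  proof (rule has_sum_Sigma_complexI)
    show "((\<lambda>\<delta>. F (w, \<delta>)) has_sum c w * (\<Prod>m\<in>{1..N}. inverse (1 - q m))) ({1..N} \<rightarrow>\<^sub>E UNIV)" for w
      unfolding F_def using q by (auto intro!: has_sum_cmult_right has_sum_prod_geometric)
    show "((\<lambda>w. c w * (\<Prod>m\<in>{1..N}. inverse (1 - q m))) has_sum ?S) {w. w permutes {1..N}}"
      by (rule has_sum_finiteI)
        (simp_all add: finite_permutations c_def sum_distrib_right[symmetric] divide_inverse prod_inversef[symmetric] o_def)
  qed (simp add: finite_permutations)
  also have "?this \<longleftrightarrow> ((\<lambda>(w, \<delta>). ?f (staircase n (heights w \<delta>))) has_sum ?S)
      ({w. w permutes {1..N}} \<times> ({1..N} \<rightarrow>\<^sub>E UNIV))"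
  proof (rule has_sum_cong, clarify)
    fix w \<delta> assume w: "w permutes {1..N}"
    interpret s: sorted_heights N w \<delta> by standard (rule w)
    let ?G = "staircase n (heights w \<delta>)" and ?e = "jump w \<delta>"
    have q_eq: "q m = P ^ ((n - m) * m) * (P ^ (2 * n) * T) ^ (n - m) * T ^ (2 * n)" if "m \<in> {1..N}" for m
    proof -
      have 1: "(2 * n + m) * (n - m) = (n - m) * m + 2 * n * (n - m)" by (simp add: algebra_simps)
      have 2: "3 * n - m = (n - m) + 2 * n" using that by (auto simp: n_def)
      show ?thesis unfolding q_def 1 2 power_add power_mult_distrib power_mult[symmetric]
        by (simp only: mult_ac)
    qed
    have "?f ?G * (P ^ inversions N w * T ^ (2 * (N - w N)))
       = P ^ ((\<Sum>g\<in>?G. card {h \<in> generators n ?G. h < g}) + inversions N w)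
         * (P ^ (2 * n) * T) ^ card ?G * (T ^ 2) ^ (conductor ?G + (N - w N))"
      by (simp add: power_add power_mult mult_ac)
    also have "\<dots> = P ^ (\<Sum>m\<in>{1..N}. (n - m) * (m * ?e m)) * (P ^ (2 * n) * T) ^ (\<Sum>m\<in>{1..N}. (n - m) * ?e m)
         * (T ^ 2) ^ (\<Sum>m\<in>{1..N}. n * ?e m)"
      unfolding n_def by (simp only: s.generator_count_heights s.conductor_sum s.sum_heights card_staircase[OF zero_less_Suc] sum_distrib_left)
    also have "\<dots> = (\<Prod>m\<in>{1..N}. q m ^ ?e m)"
      unfolding power_sum prod.distrib[symmetric]
    proof (rule prod.cong[OF refl])
      fix m assume m: "m \<in> {1..N}"
      have "(P ^ ((n - m) * m) * (P ^ (2 * n) * T) ^ (n - m) * T ^ (2 * n)) ^ ?e m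
        = P ^ ((n - m) * m * ?e m) * (P ^ (2 * n) * T) ^ ((n - m) * ?e m) * T ^ (2 * n * ?e m)"
        by (simp only: power_mult_distrib mult.assoc flip: power_mult)
      then show "P ^ ((n - m) * (m * ?e m)) * (P ^ (2 * n) * T) ^ ((n - m) * ?e m) * (T ^ 2) ^ (n * ?e m) = q m ^ ?e m"
        by (simp add: q_eq[OF m] mult.assoc flip: power_mult)
    qed
    also have "\<dots> = (\<Prod>m\<in>{1..N}. q m ^ \<delta> m) * (\<Prod>m\<in>{1..N}. if w m < w (m - 1) then q m else 1)"
      unfolding prod.distrib[symmetric] by (rule prod.cong) (auto simp: jump_def)
    also have "(\<Prod>m\<in>{1..N}. if w m < w (m - 1) then q m else 1) = (\<Prod>m\<in>{m \<in> {1..N}. w m < w (m - 1)}. q m)"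
      by (rule prod.inter_filter[symmetric]) simp
    also have "\<dots> = (\<Prod>j\<in>right_descents N w. q (j + 1))"
    proof (rule prod.reindex_bij_witness[of _ "\<lambda>j. j + 1" "\<lambda>m. m - 1"])
      fix m assume m: "m \<in> {m \<in> {1..N}. w m < w (m - 1)}"
      then have "m \<noteq> 1" using s.w0 by (intro notI) simp
      then show "m - 1 + 1 = m" "m - 1 \<in> right_descents N w" "q (m - 1 + 1) = q m"
        using m by (auto simp: right_descents_def)
    qed (auto simp: right_descents_def)
    finally have "?f ?G * (P ^ inversions N w * T ^ (2 * (N - w N)))
       = (\<Prod>m\<in>{1..N}. q m ^ \<delta> m) * (\<Prod>j\<in>right_descents N w. q (j + 1))" .
    then show "F (w, \<delta>) = ?f ?G" using P T by (simp add: F_def c_def field_simps)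
  qed
  also have "\<dots> \<longleftrightarrow> (?f has_sum ?S) (gap_sets n)"
    using has_sum_reindex_bij_betw[OF bij_gap_sets[of N], of ?f ?S]
    by (simp add: n_def case_prod_unfold)
  finally show ?thesis .
qed

section \<open>Uniformizers and residue fields\<close>

lemma type_ring_simps:
  fixes x y :: "'a::comm_ring_1"
  shows "carrier (ring_of_type_algebra :: 'a ring) = UNIV"
  "x \<otimes>\<^bsub>ring_of_type_algebra\<^esub> y = x * y"
  "x \<oplus>\<^bsub>ring_of_type_algebra\<^esub> y = x + y"
  "\<one>\<^bsub>ring_of_type_algebra\<^esub> = (1 :: 'a)"
  "\<zero>\<^bsub>ring_of_type_algebra\<^esub> = (0 :: 'a)"
  by (simp_all add: ring_of_type_algebra_def)

lemma type_ring_divides: "x divides\<^bsub>ring_of_type_algebra\<^esub> y \<longleftrightarrow> x dvd y" for x y :: "'a::comm_ring_1"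
  by (simp add: factor_def dvd_def type_ring_simps)

lemma type_ring_Units: "x \<in> Units (ring_of_type_algebra) \<longleftrightarrow> x dvd 1" for x :: "'a::comm_ring_1"
  by (auto simp: Units_def dvd_def type_ring_simps mult.commute)

lemma type_ring_PIdl: "PIdl\<^bsub>ring_of_type_algebra\<^esub> x = {y. x dvd y}" for x :: "'a::comm_ring_1"
  by (auto simp: cgenideal_def dvd_def type_ring_simps mult.commute)

text \<open>
The uniformizer generates the unique maximal ideal.  A nonzero non-unit has an irreducible divisor, which generates a
maximal ideal and is therefore associated to \<open>\<pi>\<close>.  A nonzero element divisible by all powers of \<open>\<pi>\<close> would give a strictly
ascending chain of principal ideals, contrary to the noetherian property.
\<close>

lemma dvr_uniformizer:
  assumes "discrete_valuation_ring (ring_of_type_algebra :: 'a::idom ring)"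
  shows "\<exists>\<pi>::'a::idom. \<pi> \<noteq> 0 \<and> \<not> \<pi> dvd 1
    \<and> (THE M. maximalideal M (ring_of_type_algebra :: 'a::idom ring)) = {x. \<pi> dvd x}
    \<and> maximalideal {x. \<pi> dvd x} (ring_of_type_algebra :: 'a::idom ring)
    \<and> (\<forall>x. x \<noteq> 0 \<longrightarrow> (\<exists>k u. u dvd 1 \<and> x = u * \<pi> ^ k))"
proof -
  let ?R = "ring_of_type_algebra :: 'a ring"
  have pd: "principal_domain ?R" and uniq: "\<exists>!M. maximalideal M ?R" and nf: "\<not> field ?R"
    using assms by (auto simp: discrete_valuation_ring_def)
  interpret principal_domain ?R by (rule pd)
  obtain M where M: "maximalideal M ?R" and Mu: "\<And>M'. maximalideal M' ?R \<Longrightarrow> M' = M" using uniq by blast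
  interpret M: maximalideal M ?R by (rule M)
  obtain \<pi> where \<pi>: "M = PIdl\<^bsub>?R\<^esub> \<pi>" using exists_gen[OF M.is_ideal] by blast
  have Meq: "M = {x. \<pi> dvd x}" unfolding \<pi> by (rule type_ring_PIdl)
  have the: "(THE M. maximalideal M ?R) = {x. \<pi> dvd x}"
    using M Mu unfolding Meq[symmetric] by (rule the_equality)
  have n0: "\<pi> \<noteq> 0"
  proof
    assume "\<pi> = 0"
    then have "M = {\<zero>\<^bsub>?R\<^esub>}" by (simp add: Meq type_ring_simps)
    then show False using M nf zeromaximalideal_fieldI by simp
  qed
  have n1: "\<not> \<pi> dvd 1"
  proof
    assume "\<pi> dvd 1"
    then have "M = carrier ?R" by (auto simp: Meq type_ring_simps intro: dvd_trans)
    then show False using M.I_notcarr by simp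
  qed
  have unit: "y dvd 1" if "\<not> \<pi> dvd y" for y
  proof (rule ccontr)
    assume *: "\<not> y dvd 1"
    have "y \<noteq> 0" using that by auto
    then have "y \<in> carrier ?R - {\<zero>\<^bsub>?R\<^esub>}" "y \<notin> Units ?R"
      using * by (auto simp: type_ring_Units type_ring_simps)
    then obtain b where b: "b \<in> carrier ?R" "ring_irreducible\<^bsub>?R\<^esub> b" "b divides\<^bsub>?R\<^esub> y"
      by (rule exists_irreducible_divisor)
    have "PIdl\<^bsub>?R\<^esub> b = M" by (rule Mu[OF irreducible_imp_maximalideal[OF b(1,2)]])
    moreover have "b \<in> PIdl\<^bsub>?R\<^esub> b" by (simp only: type_ring_PIdl mem_Collect_eq dvd_refl)
    ultimately have "b \<in> M" by (simp only:)
    then have "\<pi> dvd b" by (simp only: Meq mem_Collect_eq)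
    moreover have "b dvd y" using b(3) by (simp only: type_ring_divides)
    ultimately show False using that dvd_trans by blast
  qed
  have val: "\<exists>k u. u dvd 1 \<and> x = u * \<pi> ^ k" if x: "x \<noteq> 0" for x
  proof -
    have "\<exists>k. \<not> \<pi> ^ k dvd x"
    proof (rule ccontr)
      assume "\<nexists>k. \<not> \<pi> ^ k dvd x"
      then have "\<forall>k. \<exists>y. x = \<pi> ^ k * y" by (auto simp: dvd_def)
      then obtain y where y: "\<And>k. x = \<pi> ^ k * y k" by metis
      have step: "y k = \<pi> * y (Suc k)" for k
      proof -
        have "\<pi> ^ k * y k = \<pi> ^ k * (\<pi> * y (Suc k))" by (metis mult.assoc power_Suc2 y)
        then show ?thesis using n0 by (metis mult_left_cancel power_not_zero)
      qed
      have chain: "y l dvd y k" if "k \<le> l" for k l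
        using that
      proof (induction rule: dec_induct)
        case (step m)
        have "y (Suc m) dvd y m" using \<open>\<And>k. y k = \<pi> * y (Suc k)\<close>[of m] by (metis dvd_triv_right)
        then show ?case using step.IH by (rule dvd_trans)
      qed simp
      define C where "C = range (\<lambda>k. PIdl\<^bsub>?R\<^esub> (y k))"
      have "subset.chain {I. ideal I ?R} C"
      proof (rule subset.chainI)
        show "C \<subseteq> {I. ideal I ?R}" using cgenideal_ideal by (auto simp: C_def type_ring_simps)
        fix I J assume "I \<in> C" "J \<in> C"
        then obtain k l where I: "I = {z. y k dvd z}" and J: "J = {z. y l dvd z}"
          by (auto simp: C_def type_ring_PIdl)
        have "I \<subseteq> J \<or> J \<subseteq> I"
        proof (cases "k \<le> l")
          case True
          from chain[OF this] show ?thesis unfolding I J by (auto intro: dvd_trans)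
        next
          case False
          then have "l \<le> k" by simp
          from chain[OF this] show ?thesis unfolding I J by (auto intro: dvd_trans)
        qed
        then show "(\<subset>)\<^sup>=\<^sup>= I J \<or> (\<subset>)\<^sup>=\<^sup>= J I"
          by auto
      qed
      then have "\<Union> C \<in> C" by (intro ideal_chain_is_trivial) (auto simp: C_def)
      then obtain k where k: "\<Union> C = {z. y k dvd z}" by (auto simp: C_def type_ring_PIdl)
      have "y (Suc k) \<in> \<Union> C" by (auto simp: C_def type_ring_PIdl intro!: exI[of _ "Suc k"])
      then have "y k dvd y (Suc k)" using k by simp
      then obtain c where "y (Suc k) = y k * c" by (auto simp: dvd_def)
      then have "y (Suc k) * 1 = y (Suc k) * (\<pi> * c)" using step[of k] by (simp add: mult_ac)
      moreover have "y (Suc k) \<noteq> 0" using y[of "Suc k"] x by auto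
      ultimately have "1 = \<pi> * c" using mult_left_cancel by blast
      then show False using n1 by (auto simp: dvd_def)
    qed
    define k where "k = (LEAST k. \<not> \<pi> ^ k dvd x)"
    have k: "\<not> \<pi> ^ k dvd x" unfolding k_def using \<open>\<exists>k. \<not> \<pi> ^ k dvd x\<close> by (rule LeastI_ex)
    then obtain j where j: "k = Suc j" by (cases k) auto
    have "\<pi> ^ j dvd x" using not_less_Least[of j "\<lambda>k. \<not> \<pi> ^ k dvd x"] j k_def by auto
    then obtain y where y: "x = \<pi> ^ j * y" by (auto simp: dvd_def)
    have "\<not> \<pi> dvd y" using k unfolding j y by (auto simp: power_Suc2 intro: mult_dvd_mono simp del: power_Suc)
    then show ?thesis using unit y by (intro exI[of _ j] exI[of _ y]) (simp add: mult.commute)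
  qed
  show ?thesis using n0 n1 the M val unfolding Meq by blast
qed

lemma type_ring_coset: "I +>\<^bsub>ring_of_type_algebra\<^esub> x = (+) x ` I" for I :: "'a::comm_ring_1 set"
  by (auto simp: a_r_coset_def' type_ring_simps add.commute)

lemma carrier_Quot: "carrier (ring_of_type_algebra Quot I) = range (\<lambda>x. (+) x ` I)" for I :: "'a::comm_ring_1 set"
  by (auto simp: FactRing_def A_RCOSETS_def' type_ring_simps type_ring_coset)

lemma card_ZFact_le: assumes "p > 0" shows "finite (carrier (ZFact (int p)))" "card (carrier (ZFact (int p))) \<le> p"
proof -
  let ?J = "{x * int p | x. True}"
  have "carrier (ZFact (int p)) = range (\<lambda>x. (+) x ` ?J)"
  proof -
    have "?J +>\<^bsub>\<Z>\<^esub> x = (+) x ` ?J" for x by (auto simp: a_r_coset_def' add.commute)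
    then show ?thesis by (auto simp: ZFact_def FactRing_def A_RCOSETS_def' int_Idl)
  qed
  also have "\<dots> \<subseteq> (\<lambda>x. (+) x ` ?J) ` {0..<int p}"
  proof
    fix C assume "C \<in> range (\<lambda>x. (+) x ` ?J)"
    then obtain x where x: "C = (+) x ` ?J" by blast
    have sub: "add_subgroup ?J" by (rule add_subgroupI) (auto simp: left_diff_distrib[symmetric])
    have "x - x mod int p = (x div int p) * int p" by (simp add: minus_mod_eq_div_mult)
    then have "x - x mod int p \<in> ?J" by blast
    then have "C = (+) (x mod int p) ` ?J" by (simp only: x coset_eq_iff[OF sub])
    then show "C \<in> (\<lambda>x. (+) x ` ?J) ` {0..<int p}" using assms by (intro image_eqI[of _ _ "x mod int p"]) auto
  qed
  finally have *: "carrier (ZFact (int p)) \<subseteq> (\<lambda>x. (+) x ` ?J) ` {0..<int p}" .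
  show "finite (carrier (ZFact (int p)))" by (rule finite_subset[OF *]) simp
  have "card (carrier (ZFact (int p))) \<le> card ((\<lambda>x. (+) x ` ?J) ` {0..<int p})" by (rule card_mono[OF _ *]) simp
  also have "\<dots> \<le> card {0..<int p}" by (rule card_image_le) simp
  finally show "card (carrier (ZFact (int p))) \<le> p" by simp
qed

text \<open>
The characteristic makes \<open>0, ..., p - 1\<close> pairwise incongruent; as the residue field has at most \<open>p\<close> elements, they
represent all of it.
\<close>

lemma residues_of_residue_field:
  fixes \<pi> :: "'a::idom"
  assumes M: "maximalideal {x. \<pi> dvd x} (ring_of_type_algebra :: 'a ring)"
    and the: "(THE M. maximalideal M (ring_of_type_algebra :: 'a ring)) = {x. \<pi> dvd x}"
    and char: "has_characteristic (residue_field (ring_of_type_algebra :: 'a ring)) p"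
    and iso: "residue_field (ring_of_type_algebra :: 'a ring) \<simeq> ZFact (int p)"
    and p: "p > 0"
  shows "\<pi> dvd of_nat m \<longleftrightarrow> p dvd m" and "\<exists>c::int. \<pi> dvd x - of_int c"
proof -
  let ?R = "ring_of_type_algebra :: 'a ring" and ?M = "{x. \<pi> dvd x}"
  interpret M: maximalideal ?M ?R by (rule M)
  have res: "residue_field ?R = ?R Quot ?M" by (simp add: residue_field_def the)
  interpret Q: ring "?R Quot ?M" by (rule M.quotient_is_ring)
  have hom: "(+>\<^bsub>?R\<^esub>) ?M \<in> ring_hom ?R (?R Quot ?M)" by (rule M.rcos_ring_hom)
  have sub: "add_subgroup ?M" by (auto simp: add_subgroup_def)
  note cos = type_ring_coset[of ?M]
  have pw: "[m] \<cdot>\<^bsub>?R Quot ?M\<^esub> \<one>\<^bsub>?R Quot ?M\<^esub> = (+) (of_nat m) ` ?M" for m :: nat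
  proof (induction m)
    case 0
    have "\<zero>\<^bsub>?R Quot ?M\<^esub> = ?M" by (simp add: FactRing_def)
    then show ?case by simp
  next
    case (Suc m)
    have "[Suc m] \<cdot>\<^bsub>?R Quot ?M\<^esub> \<one>\<^bsub>?R Quot ?M\<^esub>
       = (?M +>\<^bsub>?R\<^esub> of_nat m) \<oplus>\<^bsub>?R Quot ?M\<^esub> (?M +>\<^bsub>?R\<^esub> \<one>\<^bsub>?R\<^esub>)"
      using Suc ring_hom_one[OF hom] by (simp add: cos)
    also have "\<dots> = ?M +>\<^bsub>?R\<^esub> (of_nat m + 1)"
      using ring_hom_add[OF hom, of "of_nat m" 1] by (simp add: type_ring_simps)
    finally show ?case by (simp add: cos add.commute)
  qed
  have dvd: "\<pi> dvd of_nat m \<longleftrightarrow> p dvd m" for m :: nat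
  proof -
    have z: "\<zero>\<^bsub>?R Quot ?M\<^esub> = (+) 0 ` ?M" by (simp add: FactRing_def)
    have "[m] \<cdot>\<^bsub>?R Quot ?M\<^esub> \<one>\<^bsub>?R Quot ?M\<^esub> = \<zero>\<^bsub>?R Quot ?M\<^esub> \<longleftrightarrow> p dvd m"
      using char unfolding has_characteristic_def res by blast
    then have "p dvd m \<longleftrightarrow> (+) (of_nat m) ` ?M = (+) 0 ` ?M" unfolding pw z by blast
    then show ?thesis by (simp only: coset_eq_iff[OF sub]) simp
  qed
  then show "\<pi> dvd of_nat m \<longleftrightarrow> p dvd m" .
  let ?f = "\<lambda>c::nat. (+) (of_nat c) ` ?M"
  obtain h where "h \<in> ring_iso (?R Quot ?M) (ZFact (int p))"
    using iso res by (auto simp: is_ring_iso_def)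
  then have bij: "bij_betw h (carrier (?R Quot ?M)) (carrier (ZFact (int p)))" by (simp add: ring_iso_def)
  have fin: "finite (carrier (?R Quot ?M))" "card (carrier (?R Quot ?M)) \<le> p"
    using bij_betw_finite[OF bij] bij_betw_same_card[OF bij] card_ZFact_le[OF p] by auto
  have inj: "inj_on ?f {..<p}"
  proof -
    have "c = d" if cd: "c \<le> d" "d < p" and eq: "?f c = ?f d" for c d
    proof -
      have "\<pi> dvd of_nat d - of_nat c" using eq[symmetric] by (simp add: coset_eq_iff[OF sub])
      then have "p dvd d - c" using dvd[of "d - c"] cd(1) by (simp add: of_nat_diff)
      then show "c = d" using cd by (auto dest: dvd_imp_le)
    qed
    then show ?thesis by (intro inj_onI) (metis lessThan_iff nat_le_linear)
  qed
  have "?f ` {..<p} \<subseteq> carrier (?R Quot ?M)" unfolding carrier_Quot by auto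
  moreover have "card (?f ` {..<p}) = p" using card_image[OF inj] by simp
  ultimately have "?f ` {..<p} = carrier (?R Quot ?M)"
    using fin by (intro card_seteq) auto
  then have "(+) x ` ?M \<in> ?f ` {..<p}" unfolding carrier_Quot by auto
  then obtain c where "\<pi> dvd x - of_nat c" by (auto simp: coset_eq_iff[OF sub])
  then show "\<exists>c::int. \<pi> dvd x - of_int c" by (intro exI[of _ "int c"]) simp
qed

section \<open>The module structure over the p-adic integers\<close>

lemma finsum_type_ring: "finite A \<Longrightarrow> finsum (ring_of_type_algebra) f A = sum f A" for f :: "'i \<Rightarrow> 'a::comm_ring_1"
proof -
  interpret cring "ring_of_type_algebra :: 'a ring" by (rule cring_from_type_algebra)
  show "finite A \<Longrightarrow> ?thesis"
    by (induction A rule: finite_induct) (auto simp: type_ring_simps)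
qed

abbreviation (input) Zp where "Zp p \<equiv> carrier (padic_int_ring p)"

lemma Zp_iff: "x \<in> Zp p \<longleftrightarrow> (\<forall>k. 0 \<le> x k \<and> x k < int p ^ k \<and> x (Suc k) mod int p ^ k = x k)"
  by (simp add: padic_int_ring_def)

lemma Zp_ops:
  "(x \<otimes>\<^bsub>padic_int_ring p\<^esub> y) k = (x k * y k) mod int p ^ k"
  "(x \<oplus>\<^bsub>padic_int_ring p\<^esub> y) k = (x k + y k) mod int p ^ k"
  "\<one>\<^bsub>padic_int_ring p\<^esub> k = 1 mod int p ^ k"
  "\<zero>\<^bsub>padic_int_ring p\<^esub> k = 0"
  by (simp_all add: padic_int_ring_def)

text \<open>
The image of an integer in the inverse limit.
\<close>

definition Zp_int :: "nat \<Rightarrow> int \<Rightarrow> nat \<Rightarrow> int" where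
  "Zp_int p m = (\<lambda>k. m mod int p ^ k)"

definition Zp_diff :: "nat \<Rightarrow> (nat \<Rightarrow> int) \<Rightarrow> (nat \<Rightarrow> int) \<Rightarrow> nat \<Rightarrow> int" where
  "Zp_diff p x y = (\<lambda>k. (x k - y k) mod int p ^ k)"

lemma ZpI:
  assumes "p > 0" "\<And>k. x k = f k mod int p ^ k" "\<And>k. [f (Suc k) = f k] (mod int p ^ k)"
  shows "x \<in> Zp p"
  unfolding Zp_iff
proof (intro allI conjI)
  fix k
  show "0 \<le> x k" "x k < int p ^ k" using assms(1) by (simp_all add: assms(2))
  show "x (Suc k) mod int p ^ k = x k"
    using assms(3)[of k] by (simp add: assms(2) mod_mod_cancel cong_def)
qed

lemma Zp_cong: "x \<in> Zp p \<Longrightarrow> [x (Suc k) = x k] (mod int p ^ k)"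
  by (metis Zp_iff cong_def mod_mod_trivial)

lemma Zp_mod: "x \<in> Zp p \<Longrightarrow> x k mod int p ^ k = x k"
  by (metis Zp_iff mod_pos_pos_trivial)

lemma Zp_int_in: "p > 0 \<Longrightarrow> Zp_int p m \<in> Zp p"
  by (rule ZpI[of _ _ "\<lambda>_. m"]) (auto simp: Zp_int_def)

lemma Zp_diff_in: "p > 0 \<Longrightarrow> x \<in> Zp p \<Longrightarrow> y \<in> Zp p \<Longrightarrow> Zp_diff p x y \<in> Zp p"
  by (rule ZpI[of _ _ "\<lambda>k. x k - y k"]) (auto simp: Zp_diff_def intro: cong_diff Zp_cong)

lemma Zp_mult_in: "p > 0 \<Longrightarrow> x \<in> Zp p \<Longrightarrow> y \<in> Zp p \<Longrightarrow> x \<otimes>\<^bsub>padic_int_ring p\<^esub> y \<in> Zp p"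
  by (rule ZpI[of _ _ "\<lambda>k. x k * y k"]) (auto simp: Zp_ops intro: cong_mult Zp_cong)

lemma Zp_zero_in: "p > 0 \<Longrightarrow> \<zero>\<^bsub>padic_int_ring p\<^esub> \<in> Zp p"
  by (simp add: Zp_iff Zp_ops)

lemma Zp_one_in: "p > 0 \<Longrightarrow> \<one>\<^bsub>padic_int_ring p\<^esub> \<in> Zp p"
  by (rule ZpI[of _ _ "\<lambda>_. 1"]) (auto simp: Zp_ops)

lemma Zp_diff_add: "p > 0 \<Longrightarrow> x \<in> Zp p \<Longrightarrow> Zp_diff p x y \<oplus>\<^bsub>padic_int_ring p\<^esub> y = x"
proof
  fix k assume x: "x \<in> Zp p"
  have "(Zp_diff p x y \<oplus>\<^bsub>padic_int_ring p\<^esub> y) k = x k mod int p ^ k"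
    unfolding Zp_ops Zp_diff_def by (simp add: mod_simps)
  then show "(Zp_diff p x y \<oplus>\<^bsub>padic_int_ring p\<^esub> y) k = x k" by (simp only: Zp_mod[OF x])
qed

text \<open>
The first component is the leading digit, and dividing the rest by \<open>p\<close> shifts the components by one.
\<close>

lemma Zp_decomp: assumes p: "p > 0" and x: "x \<in> Zp p"
  shows "\<exists>y\<in>Zp p. Zp_diff p x (Zp_int p (x 1)) = Zp_int p (int p) \<otimes>\<^bsub>padic_int_ring p\<^esub> y"
proof -
  have dvd: "int p dvd x (Suc k) - x 1" for k
  proof (induction k)
    case (Suc k)
    have "int p ^ Suc k dvd x (Suc (Suc k)) - x (Suc k)" using Zp_cong[OF x, of "Suc k"] by (simp add: cong_iff_dvd_diff)
    then have "int p dvd x (Suc (Suc k)) - x (Suc k)" by (rule dvd_trans[rotated]) simp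
    then show ?case using Suc dvd_add[of "int p" "x (Suc (Suc k)) - x (Suc k)" "x (Suc k) - x 1"] by simp
  qed simp
  define f where "f k = (x (Suc k) - x 1) div int p" for k
  have f: "int p * f k = x (Suc k) - x 1" for k using dvd[of k] by (simp add: f_def)
  define y where "y k = f k mod int p ^ k" for k
  have "y \<in> Zp p"
  proof (rule ZpI[OF p, of _ f])
    fix k
    have "int p ^ Suc k dvd x (Suc (Suc k)) - x (Suc k)" using Zp_cong[OF x, of "Suc k"] by (simp add: cong_iff_dvd_diff)
    also have "x (Suc (Suc k)) - x (Suc k) = int p * (f (Suc k) - f k)" by (simp add: f right_diff_distrib)
    finally show "[f (Suc k) = f k] (mod int p ^ k)" using p by (simp add: cong_iff_dvd_diff)
  qed (simp add: y_def)
  moreover have "Zp_diff p x (Zp_int p (x 1)) = Zp_int p (int p) \<otimes>\<^bsub>padic_int_ring p\<^esub> y"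
  proof
    fix k
    have "(Zp_int p (int p) \<otimes>\<^bsub>padic_int_ring p\<^esub> y) k = (int p * f k) mod int p ^ k"
      unfolding Zp_ops Zp_int_def y_def by (simp add: mod_simps)
    also have "\<dots> = (x (Suc k) mod int p ^ k - x 1 mod int p ^ k) mod int p ^ k" by (simp add: f mod_simps)
    also have "x (Suc k) mod int p ^ k = x k" using x by (simp add: Zp_iff)
    finally show "Zp_diff p x (Zp_int p (x 1)) k = (Zp_int p (int p) \<otimes>\<^bsub>padic_int_ring p\<^esub> y) k"
      by (simp add: Zp_diff_def Zp_int_def)
  qed
  ultimately show ?thesis by blast
qed

lemma Zp_torsion_free: assumes p: "p > 0" and x: "x \<in> Zp p"
    and 0: "Zp_int p (int p) \<otimes>\<^bsub>padic_int_ring p\<^esub> x = \<zero>\<^bsub>padic_int_ring p\<^esub>"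
  shows "x = \<zero>\<^bsub>padic_int_ring p\<^esub>"
proof
  fix k
  have "(Zp_int p (int p) \<otimes>\<^bsub>padic_int_ring p\<^esub> x) (Suc k) = 0" by (simp add: 0 Zp_ops)
  then have "(int p * x (Suc k)) mod int p ^ Suc k = 0" unfolding Zp_ops Zp_int_def by (simp add: mod_simps)
  then have "int p * int p ^ k dvd int p * x (Suc k)" by (simp add: mod_eq_0_iff_dvd)
  then have "x (Suc k) mod int p ^ k = 0" using p by simp
  then show "x k = \<zero>\<^bsub>padic_int_ring p\<^esub> k" using x by (simp add: Zp_iff Zp_ops)
qed

text \<open>
Let \<open>K i\<close> consist of the combinations of the basis whose first \<open>i\<close> coefficients vanish.  The quotient of \<open>K i\<close>
by \<open>K (Suc i)\<close> is a copy of the p-adic integers, by uniqueness of the coefficients.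
\<close>

lemma padic_free_of_padic_rank:
  assumes prime: "Factorial_Ring.prime p" and rank: "padic_rank p (ring_of_type_algebra :: 'a::comm_ring_1 ring) n"
  shows "padic_free p (UNIV :: 'a::comm_ring_1 set) n"
proof -
  let ?Z = "padic_int_ring p"
  have p: "p > 0" "p > 1" using prime prime_gt_0_nat prime_gt_1_nat by auto
  obtain \<phi> b where hom: "\<phi> \<in> ring_hom ?Z (ring_of_type_algebra :: 'a ring)"
    and bij: "bij_betw (\<lambda>c. \<Oplus>\<^bsub>ring_of_type_algebra\<^esub>i\<in>{..<n}. \<phi> (c i) \<otimes>\<^bsub>ring_of_type_algebra\<^esub> b i)
          ({..<n} \<rightarrow>\<^sub>E Zp p) (carrier (ring_of_type_algebra :: 'a ring))"
    using rank unfolding padic_rank_def by blast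
  define L where "L c = (\<Sum>i<n. \<phi> (c i) * b i)" for c
  let ?D = "{..<n} \<rightarrow>\<^sub>E Zp p"
  have bijL: "bij_betw L ?D UNIV"
    using bij unfolding L_def by (simp add: finsum_type_ring type_ring_simps)
  have \<phi>_add: "\<phi> (x \<oplus>\<^bsub>?Z\<^esub> y) = \<phi> x + \<phi> y" and \<phi>_mult: "\<phi> (x \<otimes>\<^bsub>?Z\<^esub> y) = \<phi> x * \<phi> y"
    if "x \<in> Zp p" "y \<in> Zp p" for x y
    using ring_hom_add[OF hom that] ring_hom_mult[OF hom that] by (simp_all add: type_ring_simps)
  have \<phi>_1: "\<phi> \<one>\<^bsub>?Z\<^esub> = 1" using ring_hom_one[OF hom] by (simp add: type_ring_simps)
  have \<phi>_diff: "\<phi> (Zp_diff p x y) = \<phi> x - \<phi> y" if "x \<in> Zp p" "y \<in> Zp p" for x y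
    using \<phi>_add[OF Zp_diff_in[OF p(1) that] that(2)] Zp_diff_add[OF p(1) that(1), of y] by simp
  have zero: "Zp_diff p x x = \<zero>\<^bsub>?Z\<^esub>" for x by (simp add: Zp_diff_def fun_eq_iff Zp_ops)
  have \<phi>_0: "\<phi> \<zero>\<^bsub>?Z\<^esub> = 0"
    using \<phi>_diff[OF Zp_one_in[OF p(1)] Zp_one_in[OF p(1)]] by (simp add: zero)
  have \<phi>_nat: "\<phi> (Zp_int p (int m)) = of_nat m" for m
  proof (induction m)
    case 0
    have "Zp_int p (int 0) = \<zero>\<^bsub>?Z\<^esub>" by (simp add: Zp_int_def fun_eq_iff Zp_ops)
    then show ?case by (simp add: \<phi>_0)
  next
    case (Suc m)
    have "Zp_int p (int (Suc m)) = Zp_int p (int m) \<oplus>\<^bsub>?Z\<^esub> \<one>\<^bsub>?Z\<^esub>"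
      by (auto simp: Zp_int_def fun_eq_iff Zp_ops mod_simps add.commute)
    then show ?case using \<phi>_add[OF Zp_int_in[OF p(1)] Zp_one_in[OF p(1)], of "int m"] Suc \<phi>_1 by (simp add: add.commute)
  qed
  define dif where "dif c c' = restrict (\<lambda>i. Zp_diff p (c i) (c' i)) {..<n}" for c c'
  define pm where "pm c = restrict (\<lambda>i. Zp_int p (int p) \<otimes>\<^bsub>?Z\<^esub> c i) {..<n}" for c
  define sing where "sing i y = restrict (\<lambda>j. if j = i then y else \<zero>\<^bsub>?Z\<^esub>) {..<n}" for i y
  have mem: "c i \<in> Zp p" if "c \<in> ?D" "i < n" for c i using that by (auto simp: PiE_iff)
  have dif: "dif c c' \<in> ?D" "L (dif c c') = L c - L c'" if "c \<in> ?D" "c' \<in> ?D" for c c'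
    using mem[OF that(1)] mem[OF that(2)]
    by (auto simp: dif_def L_def \<phi>_diff left_diff_distrib Zp_diff_in[OF p(1)] simp flip: sum_subtractf intro!: sum.cong)
  have pm: "pm c \<in> ?D" "L (pm c) = of_nat p * L c" if "c \<in> ?D" for c
    using mem[OF that] Zp_int_in[OF p(1)]
    by (auto simp: pm_def L_def \<phi>_mult \<phi>_nat sum_distrib_left mult.assoc Zp_mult_in[OF p(1)] intro!: sum.cong)
  have sing: "sing i y \<in> ?D" "L (sing i y) = \<phi> y * b i" if "i < n" "y \<in> Zp p" for i y
  proof -
    show "sing i y \<in> ?D" using that Zp_zero_in[OF p(1)] by (auto simp: sing_def)
    have "L (sing i y) = (\<Sum>j<n. if j = i then \<phi> y * b j else 0)"
      unfolding L_def by (rule sum.cong) (auto simp: sing_def \<phi>_0)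
    then show "L (sing i y) = \<phi> y * b i" using that by simp
  qed
  have injL: "c = c'" if "c \<in> ?D" "c' \<in> ?D" "L c = L c'" for c c'
    using bij_betw_imp_inj_on[OF bijL] that by (auto dest: inj_onD)
  define K where "K i = L ` {c \<in> ?D. \<forall>j<i. j < n \<longrightarrow> c j = \<zero>\<^bsub>?Z\<^esub>}" for i
  have KI: "L c \<in> K i" if "c \<in> ?D" "\<And>j. j < i \<Longrightarrow> j < n \<Longrightarrow> c j = \<zero>\<^bsub>?Z\<^esub>" for c i
    using that by (auto simp: K_def)
  have dz: "dif c c' j = \<zero>\<^bsub>?Z\<^esub>" if "c j = c' j" "j < n" for c c' j
    using that by (simp add: dif_def zero)
  have Ksub: "add_subgroup (K i)" for i
  proof (rule add_subgroupI)
    have "restrict (\<lambda>_. \<zero>\<^bsub>?Z\<^esub>) {..<n} \<in> ?D" using Zp_zero_in[OF p(1)] by auto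
    moreover have "L (restrict (\<lambda>_. \<zero>\<^bsub>?Z\<^esub>) {..<n}) = 0" by (simp add: L_def \<phi>_0)
    ultimately show "0 \<in> K i" using KI[of "restrict (\<lambda>_. \<zero>\<^bsub>?Z\<^esub>) {..<n}" i] by simp
    fix x y assume "x \<in> K i" "y \<in> K i"
    then obtain c c' where c: "c \<in> ?D" "\<forall>j<i. j < n \<longrightarrow> c j = \<zero>\<^bsub>?Z\<^esub>" "x = L c"
      and c': "c' \<in> ?D" "\<forall>j<i. j < n \<longrightarrow> c' j = \<zero>\<^bsub>?Z\<^esub>" "y = L c'" by (auto simp: K_def)
    have "L (dif c c') \<in> K i" using c c' by (intro KI dif dz) auto
    then show "x - y \<in> K i" using dif(2)[OF c(1) c'(1)] c(3) c'(3) by simp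
  qed
  have "padic_step p (K i) (K (Suc i)) (b i)" if i: "i < n" for i
  proof
    show "Factorial_Ring.prime p" "add_subgroup (K i)" "add_subgroup (K (Suc i))" by (fact prime Ksub)+
    show "K (Suc i) \<subseteq> K i" by (auto simp: K_def)
    have b1: "L (sing i \<one>\<^bsub>?Z\<^esub>) = b i" using sing(2)[OF i Zp_one_in[OF p(1)]] by (simp add: \<phi>_1)
    have singK: "L (sing i y) \<in> K i" if "y \<in> Zp p" for y
      using sing(1)[OF i that] by (intro KI) (auto simp: sing_def)
    show "b i \<in> K i" using singK[OF Zp_one_in[OF p(1)]] b1 by simp
    fix x assume "x \<in> K i"
    then obtain c where c: "c \<in> ?D" "\<And>j. j < i \<Longrightarrow> j < n \<Longrightarrow> c j = \<zero>\<^bsub>?Z\<^esub>" "x = L c" by (auto simp: K_def)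
    show "\<exists>m. \<exists>y\<in>K i. x - of_int m * b i - of_nat p * y \<in> K (Suc i)"
    proof -
      have ci: "c i \<in> Zp p" using mem[OF c(1) i] .
      obtain y where y: "y \<in> Zp p" "Zp_diff p (c i) (Zp_int p (c i 1)) = Zp_int p (int p) \<otimes>\<^bsub>?Z\<^esub> y"
        using Zp_decomp[OF p(1) ci] by blast
      have nn: "c i 1 \<ge> 0" using ci by (simp add: Zp_iff)
      have "\<phi> (c i) - of_int (c i 1) = of_nat p * \<phi> y"
        using arg_cong[OF y(2), of \<phi>] \<phi>_diff[OF ci Zp_int_in[OF p(1)], of "c i 1"]
          \<phi>_mult[OF Zp_int_in[OF p(1)] y(1), of "int p"] \<phi>_nat[of p] \<phi>_nat[of "nat (c i 1)"] nn by simp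
      then have "x - of_int (c i 1) * b i - of_nat p * L (sing i y) = L (dif c (sing i (c i)))"
        using dif(2)[OF c(1) sing(1)[OF i ci]] sing(2)[OF i ci] sing(2)[OF i y(1)] c(3)
        by (simp add: algebra_simps)
      also have "\<dots> \<in> K (Suc i)"
        using c(2) i by (intro KI dif(1)[OF c(1) sing(1)[OF i ci]] dz) (auto simp: sing_def less_Suc_eq)
      finally show ?thesis using singK[OF y(1)] by blast
    qed
    show "x \<in> K (Suc i)" if px: "of_nat p * x \<in> K (Suc i)"
    proof -
      obtain c' where c': "c' \<in> ?D" "\<forall>j<Suc i. j < n \<longrightarrow> c' j = \<zero>\<^bsub>?Z\<^esub>" "of_nat p * x = L c'"
        using px unfolding K_def by blast
      have "pm c = c'" using injL[OF pm(1)[OF c(1)] c'(1)] pm(2)[OF c(1)] c(3) c'(3) by simp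
      then have "Zp_int p (int p) \<otimes>\<^bsub>?Z\<^esub> c i = \<zero>\<^bsub>?Z\<^esub>" using c'(2) i by (auto simp: pm_def)
      then have "c i = \<zero>\<^bsub>?Z\<^esub>" by (rule Zp_torsion_free[OF p(1) mem[OF c(1) i]])
      then show ?thesis unfolding c(3) using c by (intro KI) (auto simp: less_Suc_eq)
    qed
    show "b i - of_nat p * x \<notin> K (Suc i)"
    proof
      assume "b i - of_nat p * x \<in> K (Suc i)"
      then obtain c' where c': "c' \<in> ?D" "\<forall>j<Suc i. j < n \<longrightarrow> c' j = \<zero>\<^bsub>?Z\<^esub>" "b i - of_nat p * x = L c'"
        by (auto simp: K_def)
      have s1: "sing i \<one>\<^bsub>?Z\<^esub> \<in> ?D" by (rule sing(1)[OF i Zp_one_in[OF p(1)]])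
      have "L (dif (sing i \<one>\<^bsub>?Z\<^esub>) (pm c)) = L c'"
        using dif(2)[OF s1 pm(1)[OF c(1)]] pm(2)[OF c(1)] b1 c(3) c'(3) by simp
      then have "dif (sing i \<one>\<^bsub>?Z\<^esub>) (pm c) = c'"
        by (rule injL[OF dif(1)[OF s1 pm(1)[OF c(1)]] c'(1)])
      then have "Zp_diff p \<one>\<^bsub>?Z\<^esub> (Zp_int p (int p) \<otimes>\<^bsub>?Z\<^esub> c i) 1 = 0"
        using c'(2) i by (auto simp: dif_def sing_def pm_def Zp_ops)
      then show False using p(2) unfolding Zp_diff_def Zp_ops Zp_int_def by simp
    qed
  qed
  note step = this
  have "padic_free p (K (n - d)) d" if "d \<le> n" for d
    using that
  proof (induction d)
    case 0
    have "K n = {0}"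
    proof
      show "K n \<subseteq> {0}" by (auto simp: K_def L_def \<phi>_0 intro!: sum.neutral)
      show "{0} \<subseteq> K n" using add_subgroup_zero[OF Ksub] by simp
    qed
    then show ?case by (simp add: padic_free_0)
  next
    case (Suc d)
    have "Suc (n - Suc d) = n - d" using Suc.prems by simp
    then show ?case using padic_free_Suc[OF step[of "n - Suc d"]] Suc by simp
  qed
  from this[of n] have "padic_free p (K 0) n" by simp
  moreover have "K 0 = UNIV" using bij_betw_imp_surj_on[OF bijL] by (auto simp: K_def)
  ultimately show ?thesis by simp
qed

section \<open>The degree as ramification index\<close>

text \<open>
If \<open>p\<close> is a unit times \<open>\<pi> ^ e\<close>, then the index of \<open>p R\<close> is \<open>p ^ e\<close> by the filtration by powers of \<open>\<pi>\<close>, and \<open>p ^ n\<close> by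
the rank.
\<close>

theorem totally_ramified_dvr:
  fixes T :: "'a::{idom, ring_char_0, topological_group_add, topological_semigroup_mult, t2_space} itself"
  assumes prime: "Factorial_Ring.prime p" and R: "totally_ramified_extension p n T"
  shows "padic_free p (UNIV :: 'a set) n \<and> (\<exists>\<pi>::'a. ramified_dvr p n \<pi>)"
proof
  let ?R = "ring_of_type_algebra :: 'a ring"
  have dvr: "discrete_valuation_ring ?R" and char: "has_characteristic (residue_field ?R) p"
    and iso: "residue_field ?R \<simeq> ZFact (int p)" and rank: "padic_rank p ?R n"
    using R by (auto simp: totally_ramified_extension_def finite_padic_extension_def)
  have p: "p > 0" "p > 1" using prime prime_gt_0_nat prime_gt_1_nat by auto
  show free: "padic_free p (UNIV :: 'a set) n" by (rule padic_free_of_padic_rank[OF prime rank])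
  from dvr_uniformizer[OF dvr] obtain \<pi> :: 'a where "\<pi> \<noteq> 0 \<and> \<not> \<pi> dvd 1
    \<and> (THE M. maximalideal M ?R) = {x. \<pi> dvd x} \<and> maximalideal {x. \<pi> dvd x} ?R
    \<and> (\<forall>x. x \<noteq> 0 \<longrightarrow> (\<exists>k u. u dvd 1 \<and> x = u * \<pi> ^ k))" ..
  then have \<pi>: "\<pi> \<noteq> 0" "\<not> \<pi> dvd 1" "(THE M. maximalideal M ?R) = {x. \<pi> dvd x}"
    "maximalideal {x. \<pi> dvd x} ?R" "\<forall>x. x \<noteq> 0 \<longrightarrow> (\<exists>k u. u dvd 1 \<and> x = u * \<pi> ^ k)"
    by - (elim conjE, assumption)+
  note res = residues_of_residue_field[OF \<pi>(4,3) char iso p(1)]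
  have "(of_nat p :: 'a) \<noteq> 0" using p by simp
  then obtain e u where e: "u dvd 1" "of_nat p = u * \<pi> ^ e" using \<pi>(5) by blast
  have "e > 0"
  proof (rule ccontr)
    assume "\<not> e > 0"
    then have "\<pi> dvd u" using res(1)[of p] e(2) by simp
    then show False using \<pi>(2) e(1) dvd_trans by blast
  qed
  interpret ramified_dvr p e \<pi>
    by unfold_locales (use prime \<open>e > 0\<close> e \<pi> res in auto)
  have "p ^ e = p ^ n" using padic_free_add_index_p[OF free] add_index_pi_ideal_pow[of e] pi_ideal_eq_p_pow[of 1] by simp
  then have "e = n" using p(2) by simp
  then show "\<exists>\<pi>::'a. ramified_dvr p n \<pi>" using ramified_dvr_axioms by blast
qed

section \<open>Normal subgroups of the Heisenberg group\<close>

type_synonym 'a triple = "('a \<times> 'a) \<times> 'a"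

text \<open>
The triple \<open>((a, b), c)\<close> holds the entries at the positions (1, 2), (2, 3) and (1, 3).  The first component is the image in the
abelianization; the elements \<open>(0, c)\<close> form the centre.
\<close>

definition hmat :: "'a::comm_ring_1 triple \<Rightarrow> 'a ^ 3 ^ 3" where
  "hmat x = (\<chi> i j. if i = j then 1 else if i = 1 \<and> j = 2 then fst (fst x)
     else if i = 2 \<and> j = 3 then snd (fst x) else if i = 1 \<and> j = 3 then snd x else 0)"

definition hmul :: "'a::comm_ring_1 triple \<Rightarrow> 'a triple \<Rightarrow> 'a triple" where
  "hmul x y = x + y + (0, fst (fst x) * snd (fst y))"

definition hinv :: "'a::comm_ring_1 triple \<Rightarrow> 'a triple" where
  "hinv x = - x + (0, fst (fst x) * snd (fst x))"

lemma hmat_nth: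
  "hmat x $ 1 $ 1 = 1" "hmat x $ 1 $ 2 = fst (fst x)" "hmat x $ 1 $ 3 = snd x"
  "hmat x $ 2 $ 1 = 0" "hmat x $ 2 $ 2 = 1" "hmat x $ 2 $ 3 = snd (fst x)"
  "hmat x $ 3 $ 1 = 0" "hmat x $ 3 $ 2 = 0" "hmat x $ 3 $ 3 = 1"
  by (simp_all add: hmat_def)

lemma hmat_inj: "inj hmat"
proof (rule injI)
  fix x y :: "'a triple" assume eq: "hmat x = hmat y"
  have nth: "hmat x $ i $ j = hmat y $ i $ j" for i j by (simp add: eq)
  have "fst (fst x) = fst (fst y)" "snd (fst x) = snd (fst y)" "snd x = snd y"
    using nth[of 1 2] nth[of 2 3] nth[of 1 3] by (simp_all add: hmat_nth)
  then show "x = y" by (simp add: prod_eq_iff)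
qed

lemma hmat_carrier: "carrier heisenberg_group = range hmat"
proof (intro equalityI subsetI)
  fix A :: "'a ^ 3 ^ 3" assume "A \<in> carrier heisenberg_group"
  then have "A = hmat ((A $ 1 $ 2, A $ 2 $ 3), A $ 1 $ 3)"
    by (simp add: heisenberg_group_def vec_eq_iff forall_3 hmat_nth)
  then show "A \<in> range hmat" by blast
qed (auto simp: heisenberg_group_def hmat_nth)

lemma hmat_mult: "hmat x ** hmat y = hmat (hmul x y)"
  by (simp add: vec_eq_iff forall_3 matrix_matrix_mult_def sum_3 hmat_nth hmul_def algebra_simps)

lemma hmat_one: "mat 1 = hmat 0"
  by (simp add: vec_eq_iff forall_3 hmat_nth mat_def)

lemma heis_ops: "A \<otimes>\<^bsub>heisenberg_group\<^esub> B = A ** B" "\<one>\<^bsub>heisenberg_group\<^esub> = mat 1"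
  by (simp_all add: heisenberg_group_def)

lemma hmul_hinv: "hmul (hinv x) x = 0" "hmul x (hinv x) = 0"
  by (simp_all add: hmul_def hinv_def prod_eq_iff algebra_simps)

lemma group_heisenberg: "group heisenberg_group"
proof (rule groupI)
  fix x :: "'a ^ 3 ^ 3" assume "x \<in> carrier heisenberg_group"
  then obtain a where a: "x = hmat a" by (auto simp: hmat_carrier)
  show "\<exists>y\<in>carrier heisenberg_group. y \<otimes>\<^bsub>heisenberg_group\<^esub> x = \<one>\<^bsub>heisenberg_group\<^esub>"
    by (rule bexI[of _ "hmat (hinv a)"]) (simp_all add: heis_ops hmat_mult hmul_hinv hmat_one hmat_carrier a)
qed (auto simp: heis_ops hmat_carrier hmat_mult hmat_one matrix_mul_assoc hmul_def)

lemma heis_inv: "inv\<^bsub>heisenberg_group\<^esub> (hmat x) = hmat (hinv x)"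
  by (rule group.inv_equality[OF group_heisenberg])
    (simp_all add: heis_ops hmat_mult hmul_hinv hmat_one hmat_carrier)

text \<open>
These are the ideals of the Heisenberg Lie ring, whose brackets are the central elements \<open>a b' - a' b\<close>.
\<close>

definition heis_ideal :: "'a::comm_ring_1 triple set \<Rightarrow> bool" where
  "heis_ideal Y \<longleftrightarrow> add_subgroup Y \<and> (\<forall>x\<in>Y. \<forall>r. (0, r * fst (fst x)) \<in> Y \<and> (0, r * snd (fst x)) \<in> Y)"

text \<open>
Commutators with \<open>((0, - r), 0)\<close> and \<open>((r, 0), 0)\<close> put \<open>(0, r a)\<close> and \<open>(0, r b)\<close> into a normal subgroup.  After that, products and sums, inverses and negatives, and elements and their conjugates differ by central
elements of the subgroup only.
\<close>

lemma normal_hmat_iff: "hmat ` Y \<lhd> heisenberg_group \<longleftrightarrow> heis_ideal Y"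
proof
  assume N: "hmat ` Y \<lhd> heisenberg_group"
  then have sg: "subgroup (hmat ` Y) heisenberg_group"
    and conj: "\<And>g h. g \<in> carrier heisenberg_group \<Longrightarrow> h \<in> hmat ` Y \<Longrightarrow>
      g \<otimes>\<^bsub>heisenberg_group\<^esub> h \<otimes>\<^bsub>heisenberg_group\<^esub> inv\<^bsub>heisenberg_group\<^esub> g \<in> hmat ` Y"
    unfolding group.normal_inv_iff[OF group_heisenberg] by blast+
  have mem: "hmat x \<in> hmat ` Y \<longleftrightarrow> x \<in> Y" for x by (rule inj_image_mem_iff[OF hmat_inj])
  have mul: "hmul x y \<in> Y" if "x \<in> Y" "y \<in> Y" for x y
    using subgroup.m_closed[OF sg, of "hmat x" "hmat y"] that by (simp add: mem heis_ops hmat_mult)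
  have inv: "hinv x \<in> Y" if "x \<in> Y" for x
    using subgroup.m_inv_closed[OF sg, of "hmat x"] that by (simp add: mem heis_inv)
  have cnj: "hmul (hmul g x) (hinv g) \<in> Y" if "x \<in> Y" for g x
    using conj[of "hmat g" "hmat x"] that by (simp add: mem heis_inv heis_ops hmat_mult hmat_carrier)
  have one: "0 \<in> Y" using subgroup.one_closed[OF sg] by (simp add: heis_ops hmat_one mem)
  have comm: "(0, fst (fst g) * snd (fst x) - fst (fst x) * snd (fst g)) \<in> Y" if x: "x \<in> Y" for g x :: "'a triple"
  proof -
    have "hmul (hmul (hmul g x) (hinv g)) (hinv x) = (0, fst (fst g) * snd (fst x) - fst (fst x) * snd (fst g))"
      by (simp add: hmul_def hinv_def prod_eq_iff algebra_simps)
    then show ?thesis using mul[OF cnj[OF x, of g] inv[OF x]] by simp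
  qed
  have c1: "(0, r * fst (fst x)) \<in> Y" if "x \<in> Y" for r x
    using comm[OF that, of "((0, - r), 0)"] by (simp add: mult.commute)
  have c2: "(0, r * snd (fst x)) \<in> Y" if "x \<in> Y" for r x
    using comm[OF that, of "((r, 0), 0)"] by simp
  have "add_subgroup Y"
  proof (rule add_subgroupI[OF one])
    fix x y assume x: "x \<in> Y" and y: "y \<in> Y"
    have "hmul (hmul (hmul x (hinv y)) (0, snd (fst y) * fst (fst x))) (0, (- snd (fst y)) * fst (fst y)) = x - y"
      by (simp add: hmul_def hinv_def prod_eq_iff algebra_simps)
    then show "x - y \<in> Y" using mul[OF mul[OF mul[OF x inv[OF y]] c1[OF x]] c1[OF y]] by metis
  qed
  then show "heis_ideal Y" using c1 c2 by (simp add: heis_ideal_def)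
next
  assume "heis_ideal Y"
  then have Y: "add_subgroup Y" and c1: "\<And>x r. x \<in> Y \<Longrightarrow> (0, r * fst (fst x)) \<in> Y"
    and c2: "\<And>x r. x \<in> Y \<Longrightarrow> (0, r * snd (fst x)) \<in> Y" by (auto simp: heis_ideal_def)
  have mul: "hmul x y \<in> Y" if "x \<in> Y" "y \<in> Y" for x y
    unfolding hmul_def using that by (intro add_subgroup_add[OF Y] c2)
  have inv: "hinv x \<in> Y" if "x \<in> Y" for x
    unfolding hinv_def using that by (intro add_subgroup_add[OF Y] add_subgroup_minus[OF Y] c2)
  have cnj: "hmul (hmul g x) (hinv g) \<in> Y" if x: "x \<in> Y" for g x
  proof -
    have "hmul (hmul g x) (hinv g) = x + (0, fst (fst g) * snd (fst x)) - (0, snd (fst g) * fst (fst x))"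
      by (simp add: hmul_def hinv_def prod_eq_iff algebra_simps)
    also have "\<dots> \<in> Y" using x by (intro add_subgroup_diff[OF Y] add_subgroup_add[OF Y] c1 c2)
    finally show ?thesis .
  qed
  have sg: "subgroup (hmat ` Y) heisenberg_group"
  proof (rule group.subgroupI[OF group_heisenberg])
    show "hmat ` Y \<subseteq> carrier heisenberg_group" by (auto simp: hmat_carrier)
    show "hmat ` Y \<noteq> {}" using add_subgroup_zero[OF Y] by auto
  qed (auto simp: heis_inv inv heis_ops hmat_mult mul)
  show "hmat ` Y \<lhd> heisenberg_group"
    unfolding group.normal_inv_iff[OF group_heisenberg]
  proof (intro conjI sg ballI)
    fix g h :: "'a ^ 3 ^ 3" assume "g \<in> carrier heisenberg_group" "h \<in> hmat ` Y"
    then obtain a x where "g = hmat a" "h = hmat x" "x \<in> Y" by (auto simp: hmat_carrier)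
    then show "g \<otimes>\<^bsub>heisenberg_group\<^esub> h \<otimes>\<^bsub>heisenberg_group\<^esub> inv\<^bsub>heisenberg_group\<^esub> g \<in> hmat ` Y"
      using cnj by (simp add: heis_inv heis_ops hmat_mult)
  qed
qed

text \<open>
Even the cosets agree: multiplying by \<open>x\<close> and adding \<open>x\<close> differ by a central element of \<open>Y\<close>.
\<close>

lemma card_rcosets_hmat:
  assumes "heis_ideal Y"
  shows "card (rcosets\<^bsub>heisenberg_group\<^esub> (hmat ` Y)) = add_index UNIV Y"
proof -
  have Y: "add_subgroup Y" and c1: "\<And>x r. x \<in> Y \<Longrightarrow> (0, r * fst (fst x)) \<in> Y"
    using assms by (auto simp: heis_ideal_def)
  have coset: "(hmat ` Y) #>\<^bsub>heisenberg_group\<^esub> hmat x = hmat ` ((+) x ` Y)" for x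
  proof -
    have "(hmat ` Y) #>\<^bsub>heisenberg_group\<^esub> hmat x = hmat ` ((\<lambda>n. hmul n x) ` Y)"
      by (auto simp: r_coset_def heis_ops hmat_mult)
    also have "(\<lambda>n. hmul n x) ` Y = (+) x ` Y"
    proof (intro equalityI subsetI)
      fix z assume "z \<in> (\<lambda>n. hmul n x) ` Y"
      then obtain m where m: "m \<in> Y" "z = hmul m x" by blast
      have "z = x + (m + (0, snd (fst x) * fst (fst m)))" by (simp add: m hmul_def algebra_simps)
      then show "z \<in> (+) x ` Y" using add_subgroup_add[OF Y m(1) c1[OF m(1)]] by blast
    next
      fix z assume "z \<in> (+) x ` Y"
      then obtain m where m: "m \<in> Y" "z = x + m" by blast
      let ?m = "m - (0, snd (fst x) * fst (fst m))"
      have "z = hmul ?m x" by (simp add: m hmul_def prod_eq_iff algebra_simps)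
      then show "z \<in> (\<lambda>n. hmul n x) ` Y" using add_subgroup_diff[OF Y m(1) c1[OF m(1)]] by blast
    qed
    finally show ?thesis .
  qed
  have "rcosets\<^bsub>heisenberg_group\<^esub> (hmat ` Y) = (`) hmat ` range (\<lambda>x. (+) x ` Y)"
    by (auto simp: RCOSETS_def hmat_carrier coset)
  then show ?thesis by (simp add: add_index_def card_image inj_on_def inj_image_eq_iff[OF hmat_inj])
qed

section \<open>Openness of subgroups of finite index\<close>

text \<open>
Two of the multiples \<open>0, x, ..., m x\<close> lie in the same coset.
\<close>

lemma fact_add_index_mem:
  fixes Y :: "'b::comm_ring_1 set"
  assumes Y: "add_subgroup Y" and m: "add_index UNIV Y = m" "m \<noteq> 0"
  shows "of_nat (fact m) * x \<in> Y"
proof -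
  let ?f = "\<lambda>j::nat. (+) (of_nat j * x) ` Y"
  have fin: "finite (range (\<lambda>x. (+) x ` Y))" using m finite_cosets by blast
  have "\<not> inj_on ?f {..m}"
  proof
    assume "inj_on ?f {..m}"
    then have "card {..m} \<le> card (range (\<lambda>x. (+) x ` Y))"
      using fin by (intro card_inj_on_le[of ?f]) auto
    then show False using m by (simp add: add_index_def)
  qed
  then have "\<exists>i j. i < j \<and> j \<le> m \<and> ?f i = ?f j"
    unfolding inj_on_def by (metis atMost_iff linorder_neqE_nat)
  then obtain i j where ij: "i < j" "j \<le> m" "?f j = ?f i" by metis
  have "of_nat (j - i) * x \<in> Y"
    using ij by (simp add: coset_eq_iff[OF Y] of_nat_diff left_diff_distrib)
  moreover have "j - i dvd fact m" using ij by (intro dvd_fact) auto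
  then obtain k where "fact m = k * (j - i)" by (auto simp: dvd_def mult.commute)
  ultimately show ?thesis using add_subgroup_of_nat[OF Y, of "of_nat (j - i) * x" k] by (simp add: mult.assoc)
qed

context ramified_dvr begin

definition cube :: "nat \<Rightarrow> 'a triple set" where
  "cube k = (pi_ideal k \<times> pi_ideal k) \<times> pi_ideal k"

lemma finite_index_cube:
  assumes Y: "add_subgroup Y" and m: "add_index UNIV Y \<noteq> 0"
  shows "\<exists>k. cube k \<subseteq> Y"
proof -
  let ?f = "of_nat (fact (add_index UNIV Y)) :: 'a"
  have "?f \<noteq> 0" by simp
  then obtain k u where u: "u dvd 1" "?f = u * \<pi> ^ k" using unif by blast
  then obtain w where w: "1 = u * w" by (auto simp: dvd_def)
  have "x \<in> Y" if x: "x \<in> cube k" for x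
  proof -
    obtain a b c where abc: "x = ((\<pi> ^ k * a, \<pi> ^ k * b), \<pi> ^ k * c)"
      using x by (auto simp: cube_def pi_ideal_def dvd_def)
    have "w * ?f = (u * w) * \<pi> ^ k" by (simp only: u(2) mult_ac)
    then have pk: "\<pi> ^ k = ?f * w" using w by (simp only: mult_1_left mult.commute[of w] flip: w)
    have "x = of_nat (fact (add_index UNIV Y)) * ((w * a, w * b), w * c)"
      by (simp only: abc pk times_prod_def of_nat_prod fst_conv snd_conv mult.assoc)
    then show ?thesis using fact_add_index_mem[OF Y refl m] by simp
  qed
  then show ?thesis by blast
qed

end

text \<open>
The complement is a finite union of cosets, hence closed.
\<close>

lemma open_of_closed_finite_index:
  fixes Y :: "'a::{topological_group_add, ab_group_add} set"
  assumes Y: "add_subgroup Y" "closed Y" and fin: "add_index UNIV Y \<noteq> 0"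
  shows "open Y"
proof -
  have cl: "closed ((+) x ` Y)" for x
  proof -
    have "(+) x ` Y = (\<lambda>y. y - x) -` Y" by (force simp: image_def)
    moreover have "closed ((\<lambda>y. y - x) -` Y)"
      by (rule closed_vimage[OF Y(2)]) (intro continuous_intros)
    ultimately show ?thesis by simp
  qed
  have X0: "Y = (+) 0 ` Y" by simp
  have "- Y = \<Union> (range (\<lambda>x. (+) x ` Y) - {Y})"
  proof (intro equalityI subsetI)
    fix y assume y: "y \<in> - Y"
    have "y \<in> (+) y ` Y" using add_subgroup_zero[OF Y(1)] by (metis add.right_neutral image_eqI)
    moreover have "(+) y ` Y \<noteq> Y" using y calculation by auto
    ultimately show "y \<in> \<Union> (range (\<lambda>x. (+) x ` Y) - {Y})" by blast
  next
    fix y assume "y \<in> \<Union> (range (\<lambda>x. (+) x ` Y) - {Y})"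
    then obtain x where x: "y \<in> (+) x ` Y" "(+) x ` Y \<noteq> Y" by blast
    then obtain z where z: "z \<in> Y" "y = x + z" by blast
    have "y \<notin> Y"
    proof
      assume "y \<in> Y"
      then have "x - 0 \<in> Y" using add_subgroup_diff[OF Y(1) _ z(1), of y] z(2) by simp
      then have "(+) x ` Y = (+) 0 ` Y" by (simp only: coset_eq_iff[OF Y(1)])
      then show False using x(2) by simp
    qed
    then show "y \<in> - Y" by simp
  qed
  moreover have "closed (\<Union> (range (\<lambda>x. (+) x ` Y) - {Y}))"
    using finite_cosets[OF fin] cl by (intro closed_Union) auto
  ultimately show ?thesis by (metis open_closed)
qed

text \<open>
The ideals \<open>\<pi> ^ k R\<close> are compact as images of the compact ring, hence closed, and they have finite index; so they are open.
A subgroup of finite index contains a cube of such ideals.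
\<close>

lemma openin_hmat:
  fixes Y :: "'a::{idom, ring_char_0, topological_group_add, topological_semigroup_mult, t2_space} triple set"
  assumes dvr: "ramified_dvr p n (\<pi> :: 'a)" and comp: "compact (UNIV :: 'a set)"
    and Y: "add_subgroup Y" "add_index UNIV Y \<noteq> 0"
  shows "openin (top_of_set (carrier heisenberg_group)) (hmat ` Y)"
proof -
  interpret ramified_dvr p n \<pi> by (rule dvr)
  obtain k where k: "cube k \<subseteq> Y" using finite_index_cube[OF Y] by blast
  have "pi_ideal k = range ((*) (\<pi> ^ k))" by (auto simp: pi_ideal_def dvd_def)
  moreover have "continuous_on UNIV ((*) (\<pi> ^ k))"
    unfolding continuous_on_def by (intro ballI tendsto_mult tendsto_const tendsto_ident_at)
  ultimately have "compact (pi_ideal k)" using compact_continuous_image comp by metis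
  then have "closed (pi_ideal k)" by (rule compact_imp_closed)
  moreover have "add_index UNIV (pi_ideal k) \<noteq> 0"
  proof -
    have "pi_ideal k \<in> lattices" by (rule latticeI[OF add_subgroup_pi_ideal subset_refl])
    then show ?thesis using add_index_gaps[of "pi_ideal k"] prime_gt_0_nat[OF prime] by simp
  qed
  ultimately have "open (pi_ideal k)" by (intro open_of_closed_finite_index add_subgroup_pi_ideal)
  define U where "U x = {A :: 'a ^ 3 ^ 3. A $ 1 $ 2 - fst (fst x) \<in> pi_ideal k \<and> A $ 2 $ 3 - snd (fst x) \<in> pi_ideal k
     \<and> A $ 1 $ 3 - snd x \<in> pi_ideal k}" for x
  have "open (U x)" for x
  proof -
    have 1: "open {A :: 'a ^ 3 ^ 3. A $ i $ j - c \<in> pi_ideal k}" for i j c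
    proof -
      have "open ((\<lambda>A :: 'a ^ 3 ^ 3. A $ i $ j - c) -` pi_ideal k)"
      proof (rule open_vimage[OF \<open>open (pi_ideal k)\<close>])
        show "continuous_on UNIV (\<lambda>A :: 'a ^ 3 ^ 3. A $ i $ j - c)"
          unfolding continuous_on_def by (intro ballI tendsto_diff tendsto_vec_nth tendsto_const tendsto_ident_at)
      qed
      then show ?thesis by (simp add: vimage_def)
    qed
    show ?thesis unfolding U_def by (intro open_Collect_conj 1)
  qed
  moreover have "hmat ` Y = carrier heisenberg_group \<inter> (\<Union>x\<in>Y. U x)"
  proof (intro equalityI subsetI)
    fix A assume "A \<in> hmat ` Y"
    then obtain x where x: "x \<in> Y" "A = hmat x" by blast
    have "hmat x \<in> U x" using add_subgroup_zero[OF add_subgroup_pi_ideal, of k] by (simp add: U_def hmat_nth)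
    then show "A \<in> carrier heisenberg_group \<inter> (\<Union>x\<in>Y. U x)" using x by (auto simp: hmat_carrier)
  next
    fix A assume "A \<in> carrier heisenberg_group \<inter> (\<Union>x\<in>Y. U x)"
    then obtain x y where xy: "A = hmat y" "x \<in> Y" "hmat y \<in> U x" by (auto simp: hmat_carrier)
    have "y - x \<in> cube k" using xy(3) by (simp add: U_def hmat_nth cube_def mem_Times_iff)
    then have "y \<in> Y" using k add_subgroup_add[OF Y(1) _ xy(2), of "y - x"] by auto
    then show "A \<in> hmat ` Y" using xy by blast
  qed
  ultimately show ?thesis unfolding openin_open by blast
qed

lemma normal_subgroup_count_heis:
  fixes \<pi> :: "'a::{idom, ring_char_0, topological_group_add, topological_semigroup_mult, t2_space}"
  assumes dvr: "ramified_dvr p n \<pi>" and comp: "compact (UNIV :: 'a set)" and m: "m \<noteq> 0"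
  shows "normal_subgroup_count (heisenberg_group :: ('a ^ 3 ^ 3) monoid) (top_of_set (carrier heisenberg_group)) m
    = card {Y :: 'a triple set. heis_ideal Y \<and> add_index UNIV Y = m}"
proof -
  have "{N. N \<lhd> (heisenberg_group :: ('a ^ 3 ^ 3) monoid) \<and> openin (top_of_set (carrier heisenberg_group)) N
      \<and> card (rcosets\<^bsub>heisenberg_group\<^esub> N) = m} = (`) hmat ` {Y. heis_ideal Y \<and> add_index UNIV Y = m}"
  proof (intro equalityI subsetI)
    fix N :: "('a ^ 3 ^ 3) set"
    assume "N \<in> {N. N \<lhd> heisenberg_group \<and> openin (top_of_set (carrier heisenberg_group)) N
      \<and> card (rcosets\<^bsub>heisenberg_group\<^esub> N) = m}"
    then have N: "N \<lhd> heisenberg_group" "card (rcosets\<^bsub>heisenberg_group\<^esub> N) = m" by auto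
    have "N \<subseteq> range hmat" using N(1) by (metis hmat_carrier normal_imp_subgroup subgroup.subset)
    then have eq: "N = hmat ` {x. hmat x \<in> N}" by auto
    then have "heis_ideal {x. hmat x \<in> N}" using N(1) normal_hmat_iff by metis
    moreover have "add_index UNIV {x. hmat x \<in> N} = m" using card_rcosets_hmat[OF calculation] eq N(2) by metis
    ultimately show "N \<in> (`) hmat ` {Y. heis_ideal Y \<and> add_index UNIV Y = m}" using eq by blast
  next
    fix N :: "('a ^ 3 ^ 3) set" assume "N \<in> (`) hmat ` {Y. heis_ideal Y \<and> add_index UNIV Y = m}"
    then obtain Y where Y: "N = hmat ` Y" "heis_ideal Y" "add_index UNIV Y = m" by blast
    have "openin (top_of_set (carrier heisenberg_group)) N"
      unfolding Y(1) using Y m by (intro openin_hmat[OF dvr comp]) (auto simp: heis_ideal_def)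
    then show "N \<in> {N. N \<lhd> heisenberg_group \<and> openin (top_of_set (carrier heisenberg_group)) N
      \<and> card (rcosets\<^bsub>heisenberg_group\<^esub> N) = m}"
      using Y normal_hmat_iff card_rcosets_hmat by blast
  qed
  then show ?thesis unfolding normal_subgroup_count_def
    by (simp add: card_image inj_on_def inj_image_eq_iff[OF hmat_inj])
qed

section \<open>Projection and centre of a normal subgroup\<close>

lemma add_index_Times:
  assumes "add_subgroup C" "add_subgroup D"
  shows "add_index (A \<times> B) (C \<times> D) = add_index A C * add_index B D"
proof -
  have "card ((\<lambda>x. (+) x ` (C \<times> D)) ` (A \<times> B))
      = card ((\<lambda>x. ((+) (fst x) ` C, (+) (snd x) ` D)) ` (A \<times> B))"
    using assms by (intro card_image_eqI) (auto simp: coset_eq_iff add_subgroup_Times)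
  also have "(\<lambda>x. ((+) (fst x) ` C, (+) (snd x) ` D)) ` (A \<times> B)
     = (\<lambda>x. (+) x ` C) ` A \<times> (\<lambda>x. (+) x ` D) ` B"
    by force
  finally show ?thesis by (simp add: add_index_def card_cartesian_product)
qed

context ramified_dvr begin

definition pi_scale :: "nat \<Rightarrow> 'a \<times> 'a \<Rightarrow> 'a \<times> 'a" where
  "pi_scale c l = (\<pi> ^ c * fst l, \<pi> ^ c * snd l)"

lemma pi_scale_diff: "pi_scale c (x - y) = pi_scale c x - pi_scale c y"
  by (simp add: pi_scale_def prod_eq_iff right_diff_distrib)

lemma inj_pi_scale: "inj (pi_scale c)"
  using nonunit by (auto simp: inj_def pi_scale_def prod_eq_iff)

lemma pi_scale_range: "range (pi_scale c) = pi_ideal c \<times> pi_ideal c"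
  by (auto simp: pi_scale_def pi_ideal_def image_iff mem_Times_iff elim!: dvdE)

abbreviation cond :: "'a set \<Rightarrow> nat" where "cond M \<equiv> conductor (gaps M)"

abbreviation plane_lattices :: "('a \<times> 'a) set set" where "plane_lattices \<equiv> p_open p UNIV"

lemma pi_ideal_subset_cond: "M \<in> lattices \<Longrightarrow> pi_ideal k \<subseteq> M \<longleftrightarrow> cond M \<le> k"
  by (simp add: pi_ideal_subset_iff conductor_le_iff finite_gaps)

definition centre :: "'a triple set \<Rightarrow> 'a set" where "centre Y = {c. (0, c) \<in> Y}"

lemma add_subgroup_pi_scale: "add_subgroup L \<Longrightarrow> add_subgroup (pi_scale c ` L)"
proof (rule add_subgroupI)
  assume L: "add_subgroup L"
  show "0 \<in> pi_scale c ` L" using add_subgroup_zero[OF L] by (intro image_eqI[of _ _ 0]) (auto simp: pi_scale_def zero_prod_def)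
  fix x y assume "x \<in> pi_scale c ` L" "y \<in> pi_scale c ` L"
  then show "x - y \<in> pi_scale c ` L" using add_subgroup_diff[OF L] by (auto simp flip: pi_scale_diff)
qed

lemma add_index_pi_scale:
  assumes "L \<in> plane_lattices" shows "add_index UNIV (pi_scale c ` L) = p ^ (2 * c) * add_index UNIV L"
proof -
  have L: "add_subgroup L" using assms by (simp add: p_open_def)
  have "add_index UNIV (pi_scale c ` L) = add_index UNIV (range (pi_scale c)) * add_index (range (pi_scale c)) (pi_scale c ` L)"
    using L by (intro add_index_mult add_subgroup_UNIV add_subgroup_pi_scale) auto
  also have "add_index (range (pi_scale c)) (pi_scale c ` L) = add_index UNIV L"
    by (rule add_index_image[OF pi_scale_diff inj_pi_scale L])
  also have "add_index UNIV (range (pi_scale c)) = p ^ (2 * c)"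
    using add_index_Times[OF add_subgroup_pi_ideal[of c] add_subgroup_pi_ideal[of c], of UNIV UNIV]
    by (simp add: pi_scale_range add_index_pi_ideal_pow mult_2 power_add)
  finally show ?thesis .
qed

lemma fst_snd_pow: "fst (of_nat k ^ t * x) = of_nat k ^ t * fst x" "snd (of_nat k ^ t * x) = of_nat k ^ t * snd x"
  for x :: "'b::comm_ring_1 \<times> 'c::comm_ring_1"
proof -
  have "of_nat k ^ t * x = (of_nat (k ^ t) * fst x, of_nat (k ^ t) * snd x)"
    unfolding of_nat_power[symmetric] by (simp only: of_nat_prod times_prod_def fst_conv snd_conv)
  then show "fst (of_nat k ^ t * x) = of_nat k ^ t * fst x" "snd (of_nat k ^ t * x) = of_nat k ^ t * snd x"
    by simp_all
qed

lemma pi_scale_p_open: "L \<in> plane_lattices \<Longrightarrow> pi_scale c ` L \<in> plane_lattices"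
proof -
  assume L: "L \<in> plane_lattices"
  then obtain t where t: "\<And>x. of_nat p ^ t * x \<in> L" and aL: "add_subgroup L" by (auto simp: p_open_def)
  have "of_nat p ^ (t + c) * x \<in> pi_scale c ` L" for x
  proof -
    obtain w where w: "of_nat p ^ c = \<pi> ^ c * w" using dvd_power_same[OF pi_dvd_p, of c] by (auto simp: dvd_def)
    have "of_nat p ^ (t + c) * x = pi_scale c (of_nat p ^ t * (w * fst x, w * snd x))"
      unfolding prod_eq_iff pi_scale_def fst_snd_pow fst_conv snd_conv by (simp add: power_add w mult_ac)
    then show ?thesis using t by blast
  qed
  then show ?thesis using add_subgroup_pi_scale[OF aL] by (auto simp: p_open_def)
qed

text \<open>
The projection \<open>L\<close> is free of rank \<open>2 n\<close>, and \<open>(b i, 0)\<close> for a basis \<open>b\<close> of \<open>L\<close> is a basis of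
\<open>L \<times> R\<close> modulo the centre.
\<close>

lemma card_centre_fibre:
  assumes free: "padic_free p (UNIV :: 'a set) n" and L: "L \<in> plane_lattices" and M: "M \<in> lattices"
  shows "card {Y. add_subgroup Y \<and> Y + {0} \<times> UNIV = L \<times> UNIV \<and> Y \<inter> ({0} \<times> UNIV) = {0} \<times> M}
    = add_index UNIV M ^ (2 * n)"
proof -
  have aL: "add_subgroup L" and aM: "add_subgroup M" using L M by (auto simp: p_open_def)
  have "padic_free p (UNIV :: ('a \<times> 'a) set) (n + n)" using padic_free_Times[OF free free] by simp
  then have "padic_free p L (n + n)" using L by (rule padic_free_p_open)
  then obtain b where B: "padic_basis p L (n + n) b" using padic_free_basis by blast
  obtain t where t: "\<And>x. of_nat p ^ t * x \<in> M" using M by (auto simp: p_open_def)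
  have fst_of: "fst (of_int c * x) = of_int c * fst x" "snd (of_int c * x) = of_int c * snd x" for c and x :: "'a triple"
    by (simp_all add: times_prod_def of_int_prod)
  have fst_sum: "fst (\<Sum>i\<in>I. f i) = (\<Sum>i\<in>I. fst (f i))" for I and f :: "nat \<Rightarrow> 'a triple"
    by (induction I rule: infinite_finite_induct) auto
  have K: "z \<in> {0} \<times> UNIV \<longleftrightarrow> fst z = 0" for z :: "'a triple" by (simp add: mem_Times_iff)
  have gen: "\<exists>c. \<exists>y\<in>L. x = (\<Sum>i<n + n. of_int (c i) * b i) + of_nat p ^ t * y" if "x \<in> L" for x
    using B that by (simp add: padic_basis_def)
  have ind: "\<forall>k c. \<forall>y\<in>L. (\<Sum>i<n + n. of_int (c i) * b i) = of_nat p ^ k * y \<longrightarrow> (\<forall>i<n + n. int p ^ k dvd c i)"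
    using B unfolding padic_basis_def by (elim conjE)
  have tf: "\<forall>k. \<forall>y\<in>L. of_nat p ^ k * y = 0 \<longrightarrow> y = 0"
    using B unfolding padic_basis_def by (elim conjE)
  have "card {Y. add_subgroup Y \<and> Y + {0} \<times> UNIV = L \<times> UNIV \<and> Y \<inter> ({0} \<times> UNIV) = {0} \<times> M}
      = add_index ({0} \<times> UNIV) ({0 :: 'a \<times> 'a} \<times> M) ^ card {..<n + n}"
  proof (rule card_relative_complements[where q = "int p ^ t" and b = "\<lambda>i. (b i, 0)"])
    fix x :: "'a triple" assume "x \<in> L \<times> UNIV"
    then have "fst x \<in> L" by auto
    then obtain c y where y: "y \<in> L" "fst x = (\<Sum>i<n + n. of_int (c i) * b i) + of_nat p ^ t * y"
      using gen by blast
    then have "x - (\<Sum>i<n + n. of_int (c i) * (b i, 0)) - of_int (int p ^ t) * (y, 0) \<in> {0} \<times> UNIV"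
      unfolding K by (simp add: fst_sum fst_of del: of_int_power of_int_of_nat_eq) simp
    then show "\<exists>c. \<exists>y\<in>L \<times> UNIV. x - (\<Sum>i<n + n. of_int (c i) * (b i, 0)) - of_int (int p ^ t) * y \<in> {0} \<times> UNIV"
      using y(1) by (intro exI[of _ c] bexI[of _ "(y, 0)"]) auto
  next
    fix c and y :: "'a triple" assume y: "y \<in> L \<times> UNIV"
      and "(\<Sum>i<n + n. of_int (c i) * (b i, 0)) - of_int (int p ^ t) * y \<in> {0} \<times> UNIV"
    then have "(\<Sum>i<n + n. of_int (c i) * b i) - of_int (int p ^ t) * fst y = 0"
      unfolding K by (simp add: fst_sum fst_of del: of_int_power of_int_of_nat_eq)
    then have "(\<Sum>i<n + n. of_int (c i) * b i) = of_nat p ^ t * fst y" by simp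
    moreover have "fst y \<in> L" using y by (simp add: mem_Times_iff)
    ultimately have "\<forall>i<n + n. int p ^ t dvd c i" using ind by blast
    then show "\<forall>i\<in>{..<n + n}. int p ^ t dvd c i" by simp
  next
    fix y :: "'a triple" assume y: "y \<in> L \<times> UNIV" and "of_int (int p ^ t) * y \<in> {0} \<times> UNIV"
    then have "of_int (int p ^ t) * fst y = 0" unfolding K fst_of by simp
    then have "fst y = 0" using tf y by auto
    moreover have "of_int (int p ^ t) * snd y \<in> M" using t by simp
    ultimately show "of_int (int p ^ t) * y \<in> {0} \<times> M" unfolding mem_Times_iff fst_of by simp
  next
    fix x :: "'a triple" assume "x \<in> {0} \<times> UNIV"
    moreover have "of_int (int p ^ t) * snd x \<in> M" using t by simp
    ultimately show "of_int (int p ^ t) * x \<in> {0} \<times> M" unfolding mem_Times_iff fst_of by simp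
  next
    fix i assume "i \<in> {..<n + n}"
    then show "(b i, 0) \<in> L \<times> UNIV" using B by (simp add: padic_basis_def)
  qed (use aL aM add_subgroup_zero[OF aL] in \<open>auto intro!: add_subgroup_Times add_subgroup_singleton add_subgroup_UNIV\<close>)
  then show ?thesis
    unfolding add_index_Times[OF add_subgroup_singleton aM] add_index_self[OF add_subgroup_singleton] by (simp add: mult_2)
qed

definition finite_heis :: "'a triple set set" where
  "finite_heis = {Y. heis_ideal Y \<and> add_index UNIV Y \<noteq> 0}"

text \<open>
The projection of \<open>Y\<close> is divisible by \<open>\<pi> ^ c\<close>, where \<open>c\<close> is the conductor of the centre part.  After division the two
components are independent of each other.
\<close>

definition split_heis :: "'a triple set \<Rightarrow> ('a \<times> 'a) set \<times> 'a set" where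
  "split_heis Y = ({l. pi_scale (cond (centre Y)) l \<in> fst ` Y}, centre Y)"

lemma lattice_add_index_pos: "M \<in> lattices \<Longrightarrow> add_index UNIV M > 0"
  using add_index_gaps prime_gt_0_nat[OF prime] by simp

text \<open>
If all multiples of a nonzero \<open>y = u \<pi> ^ j\<close> lie in the centre part, then so does \<open>\<pi> ^ j R\<close>, hence the
conductor is at most \<open>j\<close>.
\<close>

lemma finite_heis_split:
  assumes Y: "Y \<in> finite_heis"
  shows "split_heis Y \<in> plane_lattices \<times> lattices"
    and "Y + {0} \<times> UNIV = pi_scale (cond (centre Y)) ` fst (split_heis Y) \<times> UNIV"
    and "Y \<inter> ({0} \<times> UNIV) = {0} \<times> centre Y"
proof -
  have aX: "add_subgroup Y" and c: "\<And>x r. x \<in> Y \<Longrightarrow> (0, r * fst (fst x)) \<in> Y" "\<And>x r. x \<in> Y \<Longrightarrow> (0, r * snd (fst x)) \<in> Y"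
    and i: "add_index UNIV Y \<noteq> 0"
    using Y by (auto simp: finite_heis_def heis_ideal_def)
  obtain k where k: "cube k \<subseteq> Y" using finite_index_cube[OF aX i] by blast
  have M: "centre Y \<in> lattices"
  proof (rule latticeI[of _ k])
    show "add_subgroup (centre Y)"
      using aX by (auto simp: add_subgroup_def centre_def zero_prod_def) (metis diff_Pair diff_zero zero_prod_def)
    show "pi_ideal k \<subseteq> centre Y" using k by (auto simp: cube_def centre_def zero_prod_def pi_ideal_def)
  qed
  let ?c = "cond (centre Y)"
  have div: "y \<in> pi_ideal ?c" if "\<And>r. r * y \<in> centre Y" for y
  proof (cases "y = 0")
    case False
    then obtain j u where u: "u dvd 1" "y = u * \<pi> ^ j" using unif by blast
    then obtain w where w: "1 = u * w" by (auto simp: dvd_def)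
    have "pi_ideal j \<subseteq> centre Y"
    proof
      fix z assume "z \<in> pi_ideal j"
      then obtain z' where "z = \<pi> ^ j * z'" by (auto simp: pi_ideal_def dvd_def)
      then have "z = (u * w) * (\<pi> ^ j * z')" using w by simp
      then have "z = (z' * w) * y" by (simp add: u(2) mult_ac)
      then show "z \<in> centre Y" using that by simp
    qed
    then have "?c \<le> j" by (simp add: pi_ideal_subset_cond[OF M])
    then show ?thesis by (simp add: u pi_ideal_def dvd_mult le_imp_power_dvd)
  qed (simp add: pi_ideal_def)
  have sub: "fst ` Y \<subseteq> range (pi_scale ?c)"
  proof
    fix l assume "l \<in> fst ` Y"
    then obtain x where x: "x \<in> Y" "l = fst x" by blast
    have "fst l \<in> pi_ideal ?c" "snd l \<in> pi_ideal ?c"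
      by (rule div, use c[OF x(1)] x(2) in \<open>simp add: centre_def\<close>)+
    then show "l \<in> range (pi_scale ?c)" unfolding pi_scale_range by (simp add: mem_Times_iff)
  qed
  have aL: "add_subgroup (fst ` Y)"
  proof (rule add_subgroupI)
    show "0 \<in> fst ` Y" using imageI[OF add_subgroup_zero[OF aX], of fst] by simp
    fix x y assume "x \<in> fst ` Y" "y \<in> fst ` Y"
    then obtain x' y' where "x' \<in> Y" "y' \<in> Y" "x = fst x'" "y = fst y'" by blast
    then show "x - y \<in> fst ` Y" using imageI[OF add_subgroup_diff[OF aX, of x' y'], of fst] by simp
  qed
  have aL': "add_subgroup {l. pi_scale ?c l \<in> fst ` Y}"
  proof (rule add_subgroupI)
    have "pi_scale ?c 0 = 0" by (simp add: pi_scale_def zero_prod_def)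
    then show "0 \<in> {l. pi_scale ?c l \<in> fst ` Y}" using add_subgroup_zero[OF aL] by simp
  qed (use add_subgroup_diff[OF aL] in \<open>auto simp: pi_scale_diff\<close>)
  have "of_nat p ^ k * l \<in> {l. pi_scale ?c l \<in> fst ` Y}" for l
  proof -
    obtain w where w: "of_nat p ^ k = \<pi> ^ k * w" using dvd_power_same[OF pi_dvd_p, of k] by (auto simp: dvd_def)
    have "(pi_scale ?c (of_nat p ^ k * l), 0) \<in> cube k"
      by (simp add: cube_def pi_ideal_def pi_scale_def fst_snd_pow w mem_Times_iff)
    then show ?thesis using k by force
  qed
  then have "{l. pi_scale ?c l \<in> fst ` Y} \<in> plane_lattices" using aL' by (auto simp: p_open_def)
  then show "split_heis Y \<in> plane_lattices \<times> lattices" using M by (simp add: split_heis_def)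
  have "Y + {0} \<times> UNIV = fst ` Y \<times> UNIV"
  proof (intro equalityI subsetI)
    fix z assume "z \<in> fst ` Y \<times> (UNIV :: 'a set)"
    then obtain x where x: "x \<in> Y" "fst z = fst x" by (auto simp: mem_Times_iff)
    have "z = x + (0, snd z - snd x)" using x(2) by (simp add: prod_eq_iff)
    moreover have "(0, snd z - snd x) \<in> {0} \<times> (UNIV :: 'a set)" by simp
    ultimately show "z \<in> Y + {0} \<times> UNIV" using set_plus_intro[OF x(1)] by metis
  next
    fix z assume "z \<in> Y + {0} \<times> (UNIV :: 'a set)"
    then obtain x y where xy: "x \<in> Y" "y \<in> {0} \<times> (UNIV :: 'a set)" "z = x + y" by (rule set_plusE)
    then have "fst z = fst x" by (simp add: mem_Times_iff)
    then show "z \<in> fst ` Y \<times> UNIV" using xy(1) by (simp add: mem_Times_iff)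
  qed
  also have "fst ` Y = pi_scale ?c ` {l. pi_scale ?c l \<in> fst ` Y}"
    using image_vimage_eq[of "pi_scale ?c" "fst ` Y"] sub by (simp add: vimage_def Int_absorb2)
  finally show "Y + {0} \<times> UNIV = pi_scale ?c ` fst (split_heis Y) \<times> UNIV" by (simp add: split_heis_def)
  show "Y \<inter> ({0} \<times> UNIV) = {0} \<times> centre Y" by (auto simp: centre_def)
qed

lemma add_index_of_split:
  assumes aX: "add_subgroup Y" and L: "L \<in> plane_lattices" and M: "M \<in> lattices"
    and P: "Y + {0} \<times> UNIV = pi_scale c ` L \<times> UNIV" and K: "Y \<inter> ({0} \<times> UNIV) = {0} \<times> M"
  shows "add_index UNIV Y = p ^ (2 * c) * add_index UNIV L * add_index UNIV M"
proof -
  have aL: "add_subgroup L" and aM: "add_subgroup M" using L M by (auto simp: p_open_def)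
  have aK: "add_subgroup ({0 :: 'a \<times> 'a} \<times> (UNIV :: 'a set))" by (intro add_subgroup_Times add_subgroup_singleton add_subgroup_UNIV)
  have "add_index UNIV Y = add_index UNIV (Y + {0} \<times> UNIV) * add_index (Y + {0} \<times> UNIV) Y"
    by (intro add_index_mult add_subgroup_UNIV add_subgroup_plus aX aK subset_plus_left) auto
  also have "add_index (Y + {0} \<times> UNIV) Y = add_index UNIV M"
    unfolding add_index_plus[OF aX aK] K using add_index_Times[OF add_subgroup_singleton aM, of "{0 :: 'a \<times> 'a}" UNIV]
    by (simp add: add_index_self add_subgroup_singleton)
  also have "add_index UNIV (Y + {0} \<times> UNIV) = p ^ (2 * c) * add_index UNIV L"
    unfolding P using add_index_Times[OF add_subgroup_pi_scale[OF aL, of c] add_subgroup_UNIV, of UNIV "UNIV :: 'a set"]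
    by (simp add: add_index_self add_subgroup_UNIV add_index_pi_scale[OF L])
  finally show ?thesis .
qed

text \<open>
Conversely, a projection inside \<open>\<pi> ^ c R \<times> \<pi> ^ c R\<close> generates an ideal inside \<open>M\<close>, so every subgroup with the
prescribed projection and centre is an ideal of the Lie ring.
\<close>

lemma split_heis_fibre:
  assumes L: "L \<in> plane_lattices" and M: "M \<in> lattices"
    and pos: "add_index UNIV L > 0"
  shows "{Y \<in> finite_heis. split_heis Y = (L, M)}
    = {Y. add_subgroup Y \<and> Y + {0} \<times> UNIV = pi_scale (cond M) ` L \<times> UNIV \<and> Y \<inter> ({0} \<times> UNIV) = {0} \<times> M}"
proof (intro equalityI subsetI)
  fix Y assume "Y \<in> {Y \<in> finite_heis. split_heis Y = (L, M)}"
  then have Y: "Y \<in> finite_heis" "split_heis Y = (L, M)" by auto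
  then have "centre Y = M" "add_subgroup Y" by (auto simp: split_heis_def finite_heis_def heis_ideal_def)
  then show "Y \<in> {Y. add_subgroup Y \<and> Y + {0} \<times> UNIV = pi_scale (cond M) ` L \<times> UNIV \<and> Y \<inter> ({0} \<times> UNIV) = {0} \<times> M}"
    using finite_heis_split(2,3)[OF Y(1)] Y(2) by simp
next
  fix Y assume "Y \<in> {Y. add_subgroup Y \<and> Y + {0} \<times> UNIV = pi_scale (cond M) ` L \<times> UNIV \<and> Y \<inter> ({0} \<times> UNIV) = {0} \<times> M}"
  then have aX: "add_subgroup Y" and P: "Y + {0} \<times> UNIV = pi_scale (cond M) ` L \<times> UNIV" and K: "Y \<inter> ({0} \<times> UNIV) = {0} \<times> M"
    by auto
  have mem: "(0, x) \<in> Y \<longleftrightarrow> x \<in> M" for x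
  proof -
    have "(0 :: 'a \<times> 'a, x) \<in> Y \<inter> ({0} \<times> UNIV) \<longleftrightarrow> (0 :: 'a \<times> 'a, x) \<in> {0} \<times> M" by (simp only: K)
    then show ?thesis by simp
  qed
  then have c: "centre Y = M" by (simp add: centre_def)
  have aK: "add_subgroup ({0 :: 'a \<times> 'a} \<times> (UNIV :: 'a set))" by (intro add_subgroup_Times add_subgroup_singleton add_subgroup_UNIV)
  have sub: "fst x \<in> pi_scale (cond M) ` L" if "x \<in> Y" for x
    using subset_plus_left[OF aK, of Y] that unfolding P by (auto simp: mem_Times_iff)
  have FM: "pi_ideal (cond M) \<subseteq> M" by (simp add: pi_ideal_subset_cond[OF M])
  have "(0, r * y) \<in> Y" if "y \<in> pi_ideal (cond M)" for r y
  proof -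
    have "r * y \<in> M" using FM that by (auto simp: pi_ideal_def)
    then show ?thesis by (simp add: mem)
  qed
  moreover have "fst (fst x) \<in> pi_ideal (cond M)" "snd (fst x) \<in> pi_ideal (cond M)" if "x \<in> Y" for x
    using sub[OF that] by (auto simp: pi_scale_def pi_ideal_def)
  ultimately have "heis_ideal Y" using aX by (simp add: heis_ideal_def)
  moreover have "add_index UNIV Y \<noteq> 0"
    using add_index_of_split[OF aX L M P K] pos lattice_add_index_pos[OF M] prime_gt_0_nat[OF prime] by simp
  ultimately have Y: "Y \<in> finite_heis" by (simp add: finite_heis_def)
  have f: "fst ` Y = pi_scale (cond M) ` L"
  proof
    show "pi_scale (cond M) ` L \<subseteq> fst ` Y"
    proof
      fix l assume "l \<in> pi_scale (cond M) ` L"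
      then have "(l, 0) \<in> Y + {0} \<times> UNIV" unfolding P by simp
      then obtain x z where "x \<in> Y" "z \<in> {0} \<times> (UNIV :: 'a set)" "(l, 0) = x + z" by (rule set_plusE)
      then have "l = fst x" by (auto simp: prod_eq_iff)
      then show "l \<in> fst ` Y" using \<open>x \<in> Y\<close> by blast
    qed
  qed (use sub in blast)
  have "split_heis Y = (L, M)"
    unfolding split_heis_def c f by (simp add: inj_image_mem_iff[OF inj_pi_scale])
  then show "Y \<in> {Y \<in> finite_heis. split_heis Y = (L, M)}" using Y by simp
qed

section \<open>The zeta function as a sum over lattices\<close>

definition weight :: "complex \<Rightarrow> nat set \<Rightarrow> complex" where
  "weight T G = (of_nat p ^ (2 * n) * T) ^ card G * T ^ (2 * conductor G)"

text \<open>
The factor \<open>[R : M] ^ (2 n)\<close> counts the fibre of \<open>split_heis\<close>, and the index of a normal subgroup over \<open>(L, M)\<close> is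
\<open>p ^ (2 c) [R \<times> R : L] [R : M]\<close>; so the sum factors.
\<close>

lemma heis_sum_split:
  assumes free: "padic_free p (UNIV :: 'a set) n" and s: "Re s \<ge> real (2 * n)"
    and S: "((\<lambda>M. weight (of_nat p powr (- s)) (gaps M)) has_sum S) lattices"
  shows "((\<lambda>Y. of_nat (add_index UNIV Y) powr (- s)) has_sum (padic_lattice_zeta p (2 * n) s * S)) finite_heis"
proof -
  define T where "T = of_nat p powr (- s)"
  define g where "g y = of_nat (p ^ (2 * cond (snd y)) * add_index UNIV (fst y) * add_index UNIV (snd y)) powr (- s)"
    for y :: "('a \<times> 'a) set \<times> 'a set"
  have free2: "padic_free p (UNIV :: ('a \<times> 'a) set) (2 * n)" using padic_free_Times[OF free free] by (simp add: mult_2)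
  have p0: "p > 0" using prime prime_gt_0_nat by blast
  have posL: "add_index UNIV L > 0" if "L \<in> plane_lattices" for L
    using padic_free_add_index_pow[OF free2 that] p0 by auto
  let ?B = "plane_lattices \<times> lattices"
  have card: "card {Y \<in> finite_heis. split_heis Y = y} = add_index UNIV (snd y) ^ (2 * n)" if y: "y \<in> ?B" for y
  proof -
    have "card {Y \<in> finite_heis. split_heis Y = (fst y, snd y)} = add_index UNIV (snd y) ^ (2 * n)"
      using y posL by (subst split_heis_fibre) (auto intro!: card_centre_fibre[OF free] pi_scale_p_open)
    then show ?thesis by simp
  qed
  have "((\<lambda>L. of_nat (add_index UNIV L) powr (- s)) has_sum padic_lattice_zeta p (2 * n) s) plane_lattices"
    unfolding padic_lattice_zeta_def by (rule zeta_padic_free[OF free2 prime s])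
  then have "((\<lambda>(L, M). of_nat (add_index UNIV L) powr (- s) * weight T (gaps M))
      has_sum (padic_lattice_zeta p (2 * n) s * S)) ?B"
    using S unfolding T_def by (rule has_sum_product_complex)
  also have "?this \<longleftrightarrow> ((\<lambda>y. of_nat (card {Y \<in> finite_heis. split_heis Y = y}) * g y)
      has_sum (padic_lattice_zeta p (2 * n) s * S)) ?B"
  proof (rule has_sum_cong)
    fix y assume y: "y \<in> ?B"
    obtain L M where [simp]: "y = (L, M)" by (cases y)
    have M: "M \<in> lattices" using y by simp
    have 1: "of_nat (card {Y \<in> finite_heis. split_heis Y = (L, M)}) = (of_nat p ^ card (gaps M) :: complex) ^ (2 * n)"
      using card[OF y] by (simp add: add_index_gaps[OF M])
    have 2: "g (L, M) = (T ^ (2 * cond M) * of_nat (add_index UNIV L) powr (- s)) * T ^ card (gaps M)"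
      by (simp only: g_def fst_conv snd_conv add_index_gaps[OF M] of_nat_mult_powr of_nat_power_powr T_def)
    have "of_nat (card {Y \<in> finite_heis. split_heis Y = (L, M)}) * g (L, M)
      = (of_nat p ^ card (gaps M)) ^ (2 * n) * ((T ^ (2 * cond M) * of_nat (add_index UNIV L) powr (- s)) * T ^ card (gaps M))"
      by (simp only: 1 2)
    also have "\<dots> = of_nat (add_index UNIV L) powr (- s) * weight T (gaps M)"
      by (simp add: weight_def power_mult_distrib mult_ac flip: power_mult)
    finally show "(case y of (L, M) \<Rightarrow> of_nat (add_index UNIV L) powr (- s) * weight T (gaps M))
      = of_nat (card {Y \<in> finite_heis. split_heis Y = y}) * g y" by simp
  qed
  also have "\<dots> \<longleftrightarrow> ((\<lambda>Y. g (split_heis Y)) has_sum (padic_lattice_zeta p (2 * n) s * S)) finite_heis"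
  proof (rule has_sum_fibres[symmetric])
    show "finite {Y \<in> finite_heis. split_heis Y = y}" if y: "y \<in> ?B" for y
    proof (rule card_ge_0_finite)
      show "card {Y \<in> finite_heis. split_heis Y = y} > 0"
        unfolding card[OF y] using lattice_add_index_pos[of "snd y"] y by auto
    qed
  qed (rule finite_heis_split(1))
  also have "\<dots> \<longleftrightarrow> ?thesis"
  proof (rule has_sum_cong)
    fix Y assume Y: "Y \<in> finite_heis"
    have aY: "add_subgroup Y" using Y by (simp add: finite_heis_def heis_ideal_def)
    have L: "fst (split_heis Y) \<in> plane_lattices" and M: "centre Y \<in> lattices"
      using finite_heis_split(1)[OF Y] by (auto simp: split_heis_def)
    have "add_index UNIV Y = p ^ (2 * cond (centre Y)) * add_index UNIV (fst (split_heis Y)) * add_index UNIV (centre Y)"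
      by (rule add_index_of_split[OF aY L M finite_heis_split(2,3)[OF Y]])
    moreover have "snd (split_heis Y) = centre Y" by (simp add: split_heis_def)
    ultimately show "g (split_heis Y) = of_nat (add_index UNIV Y) powr (- s)"
      unfolding g_def by (simp only:)
  qed
  finally show ?thesis .
qed

lemma weight_Suc:
  assumes "finite G" shows "weight T (insert 0 (Suc ` G)) = of_nat p ^ (2 * n) * T ^ 3 * weight T G"
proof -
  have "card (insert 0 (Suc ` G)) = Suc (card G)" using assms by (simp add: card_image)
  then show ?thesis
    by (simp add: weight_def conductor_Suc[OF assms] power_mult_distrib algebra_simps power3_eq_cube power2_eq_square)
qed

text \<open>
The sum over all lattices converges by comparison with the zeta function of \<open>R\<close> at \<open>s - 2 n\<close>.  Splitting it according
to whether \<open>0\<close> is a gap gives \<open>S = S0 + z S\<close>, where \<open>z\<close> is the effect of multiplication by \<open>\<pi>\<close> on the weight.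
\<close>

lemma lattice_sum:
  fixes s :: complex
  defines "T \<equiv> of_nat p powr (- s)"
  defines "q \<equiv> \<lambda>m. of_nat p ^ ((2 * n + m) * (n - m)) * T ^ (3 * n - m)"
  assumes free: "padic_free p (UNIV :: 'a set) n" and s: "Re s \<ge> real (3 * n)"
    and q: "\<And>m. m \<in> {1..n - 1} \<Longrightarrow> norm (q m) < 1"
  shows "((\<lambda>M. weight T (gaps M)) has_sum
     ((\<Sum>w | w permutes {1..n - 1}. inverse (of_nat p ^ inversions (n - 1) w) * inverse (T ^ (2 * (n - 1 - w (n - 1))))
          * (\<Prod>j\<in>right_descents (n - 1) w. q (j + 1)))
       / ((1 - of_nat p ^ (2 * n) * T ^ 3) * (\<Prod>m = 1..n - 1. (1 - q m))))) lattices"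
proof -
  \<comment> \<open>The part of the sum over the lattices that are not contained in the maximal ideal.\<close>
  define S0 where "S0 = ((\<Sum>w | w permutes {1..n - 1}. inverse (of_nat p ^ inversions (n - 1) w) * inverse (T ^ (2 * (n - 1 - w (n - 1))))
          * (\<Prod>j\<in>right_descents (n - 1) w. q (j + 1))) / (\<Prod>m = 1..n - 1. (1 - q m)))"
  define z where "z = of_nat p ^ (2 * n) * T ^ 3"
  have p0: "p > 0" "p > 1" using prime prime_gt_0_nat prime_gt_1_nat by auto
  have nT: "norm T = real p powr (- Re s)" using norm_of_nat_powr[OF p0(1), of "- s"] by (simp add: T_def)
  have "real p powr (- Re s) \<le> real p powr 0" using p0 s by (intro powr_mono) auto
  then have T1: "norm T \<le> 1" using nT p0 by simp
  have T0: "T \<noteq> 0" using p0 by (simp add: T_def)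
  have SucN: "Suc (n - 1) = n" using n by simp
  let ?l0 = "{M \<in> lattices. 0 \<notin> gaps M}" and ?l1 = "{M \<in> lattices. 0 \<in> gaps M}"
  have "((\<lambda>G. of_nat p ^ (\<Sum>g\<in>G. card {h \<in> generators n G. h < g}) * (of_nat p ^ (2 * n) * T) ^ card G * T ^ (2 * conductor G))
     has_sum S0) (gap_sets n)"
    using has_sum_gap_sets[of "of_nat p" T "n - 1", unfolded SucN] p0 T0 q by (simp add: q_def S0_def)
  also have "?this \<longleftrightarrow> ((\<lambda>G. of_nat (card {M \<in> ?l0. gaps M = G}) * weight T G) has_sum S0) (gap_sets n)"
  proof (rule has_sum_cong)
    fix G assume G: "G \<in> gap_sets n"
    then have "{M \<in> ?l0. gaps M = G} = {M \<in> lattices. gaps M = G}" by (auto simp: gap_sets_def)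
    then show "of_nat p ^ (\<Sum>g\<in>G. card {h \<in> generators n G. h < g}) * (of_nat p ^ (2 * n) * T) ^ card G * T ^ (2 * conductor G)
       = of_nat (card {M \<in> ?l0. gaps M = G}) * weight T G"
      using card_lattices_gaps[of G] G by (simp add: gap_sets_def weight_def)
  qed
  also have "\<dots> \<longleftrightarrow> ((\<lambda>M. weight T (gaps M)) has_sum S0) ?l0"
  proof (rule has_sum_fibres[symmetric])
    show "gaps M \<in> gap_sets n" if "M \<in> ?l0" for M
      using that finite_gaps gaps_closed by (auto simp: gap_sets_def)
    fix G assume G: "G \<in> gap_sets n"
    then have "{M \<in> ?l0. gaps M = G} = {M \<in> lattices. gaps M = G}" by (auto simp: gap_sets_def)
    then have "card {M \<in> ?l0. gaps M = G} > 0"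
      using card_lattices_gaps[of G] G p0 by (simp add: gap_sets_def)
    then show "finite {M \<in> ?l0. gaps M = G}" by (rule card_ge_0_finite)
  qed
  finally have S0: "((\<lambda>M. weight T (gaps M)) has_sum S0) ?l0" .
  have "(\<lambda>M. weight T (gaps M)) summable_on lattices"
  proof (rule abs_summable_summable)
    have "((\<lambda>M. of_nat (add_index UNIV M) powr (- (s - of_nat (2 * n)))) has_sum
      (\<Prod>i<n. inverse (1 - of_nat p powr (of_nat i - (s - of_nat (2 * n)))))) lattices"
      using s by (intro zeta_padic_free[OF free prime]) simp
    then have "(\<lambda>M. norm (of_nat (add_index UNIV M) powr (- (s - of_nat (2 * n))))) summable_on lattices"
      by (simp only: has_sum_imp_summable summable_on_iff_abs_summable_on_complex[symmetric])
    then show "(\<lambda>M. norm (weight T (gaps M))) summable_on lattices"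
    proof (rule Infinite_Sum.abs_summable_on_comparison_test')
      fix M assume M: "M \<in> lattices"
      have "of_nat p powr (- (s - of_nat (2 * n))) = of_nat p ^ (2 * n) * T"
        using powr_add[of "of_nat p" "of_nat (2 * n)" "- s"] p0 by (simp add: T_def powr_nat' del: of_nat_mult)
      then have *: "of_nat (add_index UNIV M) powr (- (s - of_nat (2 * n))) = (of_nat p ^ (2 * n) * T) ^ card (gaps M)"
        by (simp only: add_index_gaps[OF M] of_nat_power_powr)
      have "norm T ^ (2 * cond M) \<le> 1" using T1 by (intro power_le_one) auto
      then show "norm (weight T (gaps M)) \<le> norm (of_nat (add_index UNIV M) powr (- (s - of_nat (2 * n))))"
        unfolding * weight_def norm_mult norm_power by (simp add: mult_left_le)
    qed
  qed
  then obtain S where S: "((\<lambda>M. weight T (gaps M)) has_sum S) lattices" by (auto simp: summable_on_def)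
  have "((\<lambda>M. weight T (gaps ((*) \<pi> ` M))) has_sum z * S) lattices"
  proof -
    have "((\<lambda>M. z * weight T (gaps M)) has_sum z * S) lattices" by (rule has_sum_cmult_right[OF S])
    then show ?thesis
      by (rule has_sum_cong[THEN iffD1, rotated]) (simp add: gaps_times_pi weight_Suc finite_gaps z_def)
  qed
  then have S1: "((\<lambda>M. weight T (gaps M)) has_sum z * S) ?l1"
    using has_sum_reindex_bij_betw[OF bij_times_pi, of "\<lambda>M. weight T (gaps M)"] by blast
  have "((\<lambda>M. weight T (gaps M)) has_sum (S0 + z * S)) (?l0 \<union> ?l1)"
    by (rule has_sum_Un_disjoint[OF S0 S1]) auto
  also have "?l0 \<union> ?l1 = lattices" by auto
  finally have "S = S0 + z * S" using S has_sum_unique by blast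
  moreover have "norm z < 1"
  proof -
    have "(real p powr (- Re s)) ^ 3 = real p powr (3 * (- Re s))"
      by (simp add: power3_eq_cube flip: powr_add)
    moreover have "real p ^ (2 * n) = real p powr real (2 * n)" using p0 by (simp only: powr_realpow of_nat_0_less_iff)
    ultimately have "norm z = real p powr (real (2 * n) + 3 * (- Re s))"
      unfolding z_def norm_mult norm_power nT powr_add norm_of_nat by (simp only:)
    also have "\<dots> < 1" using s p0 n by (intro powr_less_one) auto
    finally show ?thesis .
  qed
  then have "z \<noteq> 1" by auto
  ultimately have "S = S0 / (1 - z)" by (simp add: field_simps)
  then show ?thesis using S by (simp add: S0_def z_def mult.commute)
qed

end

lemma powr_affine:
  fixes s :: complex
  assumes "p > 0"
  shows "of_nat p powr (of_nat a - of_nat b * s) = of_nat p ^ a * (of_nat p powr (- s)) ^ b"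
proof -
  have b: "of_nat p powr (of_nat b * (- s)) = (of_nat p powr (- s)) ^ b"
  proof (induction b)
    case (Suc b)
    have "of_nat (Suc b) * (- s) = - s + of_nat b * (- s)" by (simp add: algebra_simps)
    then have "of_nat p powr (of_nat (Suc b) * (- s)) = of_nat p powr (- s) * of_nat p powr (of_nat b * (- s))"
      by (simp only: powr_add)
    then show ?case by (simp only: Suc power_Suc)
  qed (use assms in simp)
  have "of_nat p powr (of_nat a - of_nat b * s) = of_nat p powr (of_nat a) * of_nat p powr (of_nat b * (- s))"
    unfolding powr_add[symmetric] by simp
  also have "of_nat p powr (of_nat a) = (of_nat p ^ a :: complex)" using assms by (simp add: powr_nat')
  finally show ?thesis by (simp only: b)
qed

theorem corollary3p18:
  fixes p n :: nat
    and R :: "'a::{idom, ring_char_0, topological_group_add, topological_semigroup_mult, t2_space} itself"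
  assumes "Factorial_Ring.prime p"
    and "totally_ramified_extension p n R"
  shows "\<exists>\<sigma>::real. \<forall>s::complex. Re s > \<sigma> \<longrightarrow>
    (let H = (heisenberg_group :: ('a ^ 3 ^ 3) monoid);
         T = top_of_set (carrier H);
         x = (\<lambda>i::nat. (of_nat p :: complex) powr
               ((2 * of_nat n + of_nat i) * (of_nat n - of_nat i) - (3 * of_nat n - of_nat i) * s))
     in summable (\<lambda>m. normal_zeta_term H T s (Suc m)) \<and>
        normal_zeta H T s =
          padic_lattice_zeta p (2 * n) s *
          ((\<Sum>w\<in>carrier (sym_group (n - 1)).
              of_nat p powr (- of_nat (coxeter_length (n - 1) w)
                             + 2 * of_nat (parabolic_length (n - 1) {1..n - 3} w) * s) *
              (\<Prod>j\<in>right_descents (n - 1) w. x (j + 1)))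
           / ((1 - of_nat p powr (2 * of_nat n - 3 * s)) * (\<Prod>i = 1..n - 1. (1 - x i)))))"
\<comment> \<open>The bound makes every exponent \<open>(2 n + i) (n - i) - (3 n - i) s\<close> have negative real part, because
  \<open>(2 n + i) (n - i) \<le> 3 n\<^sup>2\<close>, and it gives the convergence of the zeta functions of \<open>R\<close> at \<open>s - 2 n\<close> and of
  \<open>R \<times> R\<close> at \<open>s\<close>.\<close>
proof (intro exI[of _ "3 * real n ^ 2 + 3 * real n"] allI impI)
  fix s :: complex assume s: "Re s > 3 * real n ^ 2 + 3 * real n"
  have free: "padic_free p (UNIV :: 'a set) n" and "\<exists>\<pi>::'a. ramified_dvr p n \<pi>"
    using totally_ramified_dvr[OF assms] by blast+
  then obtain \<pi> :: 'a where dvr: "ramified_dvr p n \<pi>" by blast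
  have comp: "compact (UNIV :: 'a set)"
    using assms(2) by (simp add: totally_ramified_extension_def finite_padic_extension_def)
  interpret ramified_dvr p n \<pi> by (rule dvr)
  have p: "p > 0" "p > 1" using prime prime_gt_0_nat prime_gt_1_nat by auto
  define T where "T = of_nat p powr (- s)"
  define x where "x i = (of_nat p :: complex) powr
     ((2 * of_nat n + of_nat i) * (of_nat n - of_nat i) - (3 * of_nat n - of_nat i) * s)" for i :: nat
  define q where "q m = of_nat p ^ ((2 * n + m) * (n - m)) * T ^ (3 * n - m)" for m
  define N where "N = n - 1"
  have xq: "x i = q i" if "i \<le> n" for i
    using powr_affine[OF p(1), of "(2 * n + i) * (n - i)" "3 * n - i" s] that
    by (simp add: x_def q_def T_def of_nat_diff)
  have normq: "norm (q m) < 1" if "m \<in> {1..N}" for m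
  proof -
    have mn: "m \<le> n" "m < n" using that by (auto simp: N_def)
    have "norm (x m) < 1" unfolding x_def
    proof (rule norm_of_nat_powr_less_1[OF p(2)])
      have "Re ((2 * of_nat n + of_nat m) * (of_nat n - of_nat m) - (3 * of_nat n - of_nat m) * s)
        = (2 * real n + real m) * (real n - real m) - (3 * real n - real m) * Re s" by simp
      also have "\<dots> \<le> (3 * real n) * real n - 1 * Re s"
      proof (intro diff_mono mult_mono)
        have "real m + 1 \<le> real n" using mn by linarith
        then show "1 \<le> 3 * real n - real m" by linarith
        have "0 \<le> 3 * real n ^ 2 + 3 * real n" by simp
        then show "0 \<le> Re s" using s by linarith
      qed (use mn in auto)
      also have "\<dots> < 0" using s by (simp add: power2_eq_square)
      finally show "Re ((2 * of_nat n + of_nat m) * (of_nat n - of_nat m) - (3 * of_nat n - of_nat m) * s) < 0" .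
    qed
    then show ?thesis using xq[OF mn(1)] by simp
  qed
  have sn: "Re s \<ge> real (3 * n)" "Re s \<ge> real (2 * n)"
  proof -
    have "3 * real n \<le> Re s" using s zero_le_power2[of "real n"] by linarith
    then show "Re s \<ge> real (3 * n)" "Re s \<ge> real (2 * n)" by auto
  qed
  define c where "c w = inverse (of_nat p ^ inversions N w) * inverse (T ^ (2 * (N - w N)))
     * (\<Prod>j\<in>right_descents N w. q (j + 1))" for w
  define S where "S = (\<Sum>w | w permutes {1..N}. c w) / ((1 - of_nat p ^ (2 * n) * T ^ 3) * (\<Prod>m = 1..N. (1 - q m)))"
  have lat: "((\<lambda>M. weight T (gaps M)) has_sum S) lattices"
    using lattice_sum[OF free sn(1)] normq unfolding S_def c_def N_def q_def T_def by simp
  let ?H = "heisenberg_group :: ('a ^ 3 ^ 3) monoid"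
  let ?T = "top_of_set (carrier ?H)"
  let ?Z = "padic_lattice_zeta p (2 * n) s * S"
  have sum: "((\<lambda>Y. of_nat (add_index UNIV Y) powr (- s)) has_sum ?Z) finite_heis"
    by (rule heis_sum_split[OF free sn(2) lat[unfolded T_def]])
  \<comment> \<open>The series is indexed by the index minus one, which starts at \<open>0\<close>.\<close>
  define g where "g m = of_nat (Suc m) powr (- s)" for m
  have fin: "finite {Y \<in> finite_heis. add_index UNIV Y - 1 = m}" for m
    by (rule has_sum_imp_finite_fibre[OF sum, of _ "g m"])
       (auto simp: g_def finite_heis_def simp del: of_nat_Suc)
  have "((\<lambda>Y. g (add_index UNIV Y - 1)) has_sum ?Z) finite_heis"
    using sum by (rule has_sum_cong[THEN iffD1, rotated]) (auto simp: g_def finite_heis_def)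
  then have "((\<lambda>m. of_nat (card {Y \<in> finite_heis. add_index UNIV Y - 1 = m}) * g m) has_sum ?Z) UNIV"
    by (rule has_sum_fibres[THEN iffD1, rotated 2]) (rule UNIV_I, rule fin)
  also have "?this \<longleftrightarrow> ((\<lambda>m. normal_zeta_term ?H ?T s (Suc m)) has_sum ?Z) UNIV"
  proof (rule has_sum_cong)
    fix m
    have "{Y \<in> finite_heis. add_index UNIV Y - 1 = m} = {Y. heis_ideal Y \<and> add_index UNIV Y = Suc m}"
      by (auto simp: finite_heis_def)
    then have "card {Y \<in> finite_heis. add_index UNIV Y - 1 = m} = normal_subgroup_count ?H ?T (Suc m)"
      using normal_subgroup_count_heis[OF dvr comp, of "Suc m"] by simp
    then show "of_nat (card {Y \<in> finite_heis. add_index UNIV Y - 1 = m}) * g m = normal_zeta_term ?H ?T s (Suc m)"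
      by (simp add: normal_zeta_term_def g_def)
  qed
  finally have sums: "(\<lambda>m. normal_zeta_term ?H ?T s (Suc m)) sums ?Z" by (rule has_sum_imp_sums)
  have cw: "c w = of_nat p powr (- of_nat (coxeter_length N w) + 2 * of_nat (parabolic_length N {1..n - 3} w) * s) *
              (\<Prod>j\<in>right_descents N w. x (j + 1))" if w: "w permutes {1..N}" for w
  proof -
    have "of_nat p powr (- of_nat (inversions N w) + 2 * of_nat (N - w N) * s)
       = inverse (of_nat p powr (of_nat (inversions N w) - of_nat (2 * (N - w N)) * s))"
      unfolding powr_minus[symmetric] by simp
    also have "\<dots> = inverse (of_nat p ^ inversions N w) * inverse (T ^ (2 * (N - w N)))"
      unfolding powr_affine[OF p(1)] T_def by simp
    finally have 1: "of_nat p powr (- of_nat (inversions N w) + 2 * of_nat (N - w N) * s)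
       = inverse (of_nat p ^ inversions N w) * inverse (T ^ (2 * (N - w N)))" .
    have "n - 3 = N - 2" unfolding N_def by arith
    then have 2: "parabolic_length N {1..n - 3} w = N - w N" using parabolic_length_last[OF w] by simp
    have 3: "(\<Prod>j\<in>right_descents N w. q (j + 1)) = (\<Prod>j\<in>right_descents N w. x (j + 1))"
      by (rule prod.cong) (auto simp: right_descents_def N_def xq)
    show ?thesis unfolding c_def coxeter_length_inversions[OF w] 2 1 3 ..
  qed
  have "S = (\<Sum>w\<in>carrier (sym_group N).
              of_nat p powr (- of_nat (coxeter_length N w) + 2 * of_nat (parabolic_length N {1..n - 3} w) * s) *
              (\<Prod>j\<in>right_descents N w. x (j + 1)))
           / ((1 - of_nat p powr (2 * of_nat n - 3 * s)) * (\<Prod>i = 1..N. (1 - x i)))"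
  proof -
    have "(\<Prod>m = 1..N. (1 - q m)) = (\<Prod>i = 1..N. (1 - x i))" by (rule prod.cong) (auto simp: N_def xq)
    moreover have "of_nat p ^ (2 * n) * T ^ 3 = of_nat p powr (2 * of_nat n - 3 * s)"
      using powr_affine[OF p(1), of "2 * n" 3 s] by (simp add: T_def)
    moreover have "(\<Sum>w | w permutes {1..N}. c w) = (\<Sum>w\<in>carrier (sym_group N).
              of_nat p powr (- of_nat (coxeter_length N w) + 2 * of_nat (parabolic_length N {1..n - 3} w) * s) *
              (\<Prod>j\<in>right_descents N w. x (j + 1)))"
      by (rule sum.cong) (auto simp: sym_group_def cw)
    ultimately show ?thesis unfolding S_def by (simp only:)
  qed
  then show "let H = (heisenberg_group :: ('a ^ 3 ^ 3) monoid);
         T = top_of_set (carrier H);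
         x = (\<lambda>i::nat. (of_nat p :: complex) powr
               ((2 * of_nat n + of_nat i) * (of_nat n - of_nat i) - (3 * of_nat n - of_nat i) * s))
     in summable (\<lambda>m. normal_zeta_term H T s (Suc m)) \<and>
        normal_zeta H T s =
          padic_lattice_zeta p (2 * n) s *
          ((\<Sum>w\<in>carrier (sym_group (n - 1)).
              of_nat p powr (- of_nat (coxeter_length (n - 1) w)
                             + 2 * of_nat (parabolic_length (n - 1) {1..n - 3} w) * s) *
              (\<Prod>j\<in>right_descents (n - 1) w. x (j + 1)))
           / ((1 - of_nat p powr (2 * of_nat n - 3 * s)) * (\<Prod>i = 1..n - 1. (1 - x i))))"
    using sums_summable[OF sums] sums_unique[OF sums]
    unfolding Let_def normal_zeta_def N_def x_def[abs_def] by (simp only:)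
qed

end
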